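(* Let $(\mathcal{B},\Delta,\varepsilon)$ be an involutive bialgebra, let $(\rho,\eta,L)$ be a surjective Schürmann triple on $\mathcal{B}$ over a pre-Hilbert space $D$, and let $(j_{st})_{0\le s\le t}$ be the solution on the Fock space $\Gamma\big(L^2(\mathbb{R}_+,D)\big)$ of the quantum stochastic differential equations $$\mathrm{d}j_{st}=j_{st}\star\big(\mathrm{d}A^*_t\circ\eta+\mathrm{d}\Lambda_t\circ(\rho-\varepsilon)+\mathrm{d}A_t\circ\eta\circ *+L\,\mathrm{d}t\big),\qquad j_{ss}=\varepsilon\mathbf{1}.$$ Then the vacuum vector $\Omega$ is cyclic for $(j_{st})_{0\le s\le t}$, i.e. the subspace $$\mathrm{span}\{j_{s_1t_1}(b_1)\cdots j_{s_nt_n}(b_n)\Omega \mid n\in\mathbb{N},\ 0\le s_1\le t_1\le s_2\le\cdots\le t_n,\ b_1,\ldots,b_n\in\mathcal{B}\}$$ is dense in $\Gamma\big(L^2(\mathbb{R}_+,D)\big)$.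
   Context: An involutive bialgebra is a complex unital $*$-algebra $\mathcal{B}$ with unital $*$-homomorphisms $\Delta:\mathcal{B}\to\mathcal{B}\otimes\mathcal{B}$ (coassociative) and $\varepsilon:\mathcal{B}\to\mathbb{C}$ (counit). Sweedler notation: $\Delta(b)=\sum b_{(1)}\otimes b_{(2)}$. For linear maps $f,g$ on $\mathcal{B}$ with values in an algebra, $(f\star g)(b)=\sum f(b_{(1)})g(b_{(2)})$. For a pre-Hilbert space $D$, $\mathcal{L}(D)$ is the $*$-algebra of linear operators on $D$ having an adjoint defined on all of $D$. A Schürmann triple on $\mathcal{B}$ over $D$ is a triple $(\rho,\eta,L)$ where $\rho:\mathcal{B}\to\mathcal{L}(D)$ is a unital $*$-representation, $\eta:\mathcal{B}\to D$ is linear with $\eta(ab)=\rho(a)\eta(b)+\eta(a)\varepsilon(b)$, and $L:\mathcal{B}\to\mathbb{C}$ is a hermitian linear functional with $-\langle\eta(a^* ),\eta(b)\rangle=\varepsilon(a)L(b)-L(ab)+L(a)\varepsilon(b)$ for all $a,b\in\mathcal{B}$. It is called surjective if $\eta:\mathcal{B}\to D$ is surjective. $\Gamma\big(L^2(\mathbb{R}_+,D)\big)$ is the symmetric (boson) Fock space over $L^2(\mathbb{R}_+,\overline{D})$, $\Omega$ its vacuum vector, $\mathcal{E}(f)$ the exponential vectors, with $\langle\mathcal{E}(f),\mathcal{E}(g)\rangle=e^{\langle f,g\rangle}$ and $\Omega=\mathcal{E}(0)$. $A^*_t,\Lambda_t,A_t$ are the creation, conservation and annihilation processes (Hudson–Parthasarathy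 quantum stochastic calculus). Inner products are linear in the second argument. Known fact (Schürmann's representation theorem): the quantum stochastic differential equations have a unique solution (in an appropriate class of adapted processes); each $j_{st}$ is a unital $*$-homomorphism from $\mathcal{B}$ into the adjointable operators on a common dense invariant domain containing the exponential vectors of $D$-valued step functions, and $(j_{st})$ is a Lévy process with respect to the vacuum state with generator $L$, i.e.: $j_{rs}\star j_{st}=j_{rt}$ and $j_{tt}=\varepsilon\mathbf{1}$; for $0\le s_1\le t_1\le s_2\le\cdots\le t_n$ the ranges of $j_{s_1t_1},\ldots,j_{s_nt_n}$ commute with each other and vacuum expectations of products $j_{s_1t_1}(b_1)\cdots j_{s_nt_n}(b_n)$ factorize; and $\langle\Omega,j_{st}(b)\Omega\rangle=\varphi_{t-s}(b)$ with $\varphi_t=\exp_\star tL=\sum_n t^nL^{\star n}/n!$. In terms of matrix elements the equation means, for $D$-valued step functions $f,g$ and $0\le s\le t$, $$\langle\mathcal{E}(f),j_{st}(b)\mathcal{E}(g)\rangle=\varepsilon(b)\langle\mathcal{E}(f),\mathcal{E}(g)\rangle+\int_s^t\sum\langle\mathcal{E}(f),j_{s\tau}(b_{(1)})\mathcal{E}(g)\rangle\, c_\tau(b_{(2)})\,\mathrm{d}\tau,$$ $$c_\tau(b)=\langle f(\tau),\eta(b)\rangle+\langle f(\tau),(\rho(b)-\varepsilon(b))g(\tau)\rangle+\langle\eta(b^* ),g(\tau)\rangle+L(b).$$ *)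

theory Defs
  imports "HOL-Analysis.Analysis"
begin

section \<open>Complex vector spaces, *-algebras and Hilbert spaces\<close>

class complex_vector = ab_group_add +
  fixes scaleC :: "complex \<Rightarrow> 'a \<Rightarrow> 'a"  (infixr "*\<^sub>C" 75)
  assumes scaleC_add_right: "c *\<^sub>C (x + y) = c *\<^sub>C x + c *\<^sub>C y"
    and scaleC_add_left: "(c + d) *\<^sub>C x = c *\<^sub>C x + d *\<^sub>C x"
    and scaleC_scaleC: "c *\<^sub>C (d *\<^sub>C x) = (c * d) *\<^sub>C x"
    and scaleC_one: "1 *\<^sub>C x = x"

global_interpretation complex_vector: vector_space "scaleC :: complex \<Rightarrow> 'a \<Rightarrow> 'a :: complex_vector"
  defines cspan = complex_vector.span and csubspace = complex_vector.subspace
  by unfold_locales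
    (simp_all add: scaleC_add_right scaleC_add_left scaleC_scaleC scaleC_one)

abbreviation clinear :: "('a::complex_vector \<Rightarrow> 'b::complex_vector) \<Rightarrow> bool"
  where "clinear \<equiv> Vector_Spaces.linear scaleC scaleC"

lemma clinearI:
  assumes "\<And>x y. f (x + y) = f x + f y" "\<And>c x. f (c *\<^sub>C x) = c *\<^sub>C f x"
  shows "clinear f"
  using assms by unfold_locales auto

lemma clinear_add: "clinear f \<Longrightarrow> f (x + y) = f x + f y"
  and clinear_scaleC: "clinear f \<Longrightarrow> f (c *\<^sub>C x) = c *\<^sub>C f x"
  by (simp_all add: Vector_Spaces.linear_iff)

text \<open>Unital associative complex *-algebras. The class \<open>ring_1\<close> is avoided, since it
  excludes the zero algebra.\<close>

class complex_star_algebra = complex_vector + ring + monoid_mult +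
  fixes star :: "'a \<Rightarrow> 'a"
  assumes scaleC_mult_left: "(c *\<^sub>C x) * y = c *\<^sub>C (x * y)"
    and scaleC_mult_right: "x * (c *\<^sub>C y) = c *\<^sub>C (x * y)"
    and star_add: "star (x + y) = star x + star y"
    and star_scaleC: "star (c *\<^sub>C x) = cnj c *\<^sub>C star x"
    and star_mult: "star (x * y) = star y * star x"
    and star_star: "star (star x) = x"

instantiation complex :: complex_star_algebra
begin

definition "scaleC_complex = (times :: complex \<Rightarrow> complex \<Rightarrow> complex)"
definition "star_complex = cnj"

instance
  by standard (simp_all add: scaleC_complex_def star_complex_def algebra_simps)

end

definition unital_star_hom :: "('a::complex_star_algebra \<Rightarrow> 'b::complex_star_algebra) \<Rightarrow> bool"
  where "unital_star_hom f \<longleftrightarrow>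
    clinear f \<and> f 1 = 1 \<and> (\<forall>x y. f (x * y) = f x * f y) \<and> (\<forall>x. f (star x) = star (f x))"

text \<open>Pre-Hilbert spaces, with inner product linear in the second argument.\<close>

class complex_inner = complex_vector + real_normed_vector +
  fixes cinner :: "'a \<Rightarrow> 'a \<Rightarrow> complex"
  assumes scaleR_scaleC: "r *\<^sub>R x = complex_of_real r *\<^sub>C x"
    and cinner_commute: "cinner x y = cnj (cinner y x)"
    and cinner_add_right: "cinner x (y + z) = cinner x y + cinner x z"
    and cinner_scaleC_right: "cinner x (c *\<^sub>C y) = c * cinner x y"
    and cinner_same: "cinner x x = complex_of_real ((norm x)\<^sup>2)"

class complex_hilbert = complex_inner + complete_space

definition is_completion :: "('d::complex_inner \<Rightarrow> 'k::complex_hilbert) \<Rightarrow> bool"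
  where "is_completion \<iota> \<longleftrightarrow>
    clinear \<iota> \<and> (\<forall>x y. cinner (\<iota> x) (\<iota> y) = cinner x y) \<and> closure (range \<iota>) = UNIV"


section \<open>The algebraic tensor product\<close>

text \<open>A list \<open>[(a\<^sub>1, b\<^sub>1), \<dots>]\<close> stands for the formal sum of the \<open>a\<^sub>i \<otimes> b\<^sub>i\<close>.\<close>

inductive tensor_rel ::
  "('a::complex_vector \<times> 'b::complex_vector) list \<Rightarrow> ('a \<times> 'b) list \<Rightarrow> bool"
where
  rel_refl: "tensor_rel xs xs"
| rel_sym: "tensor_rel xs ys \<Longrightarrow> tensor_rel ys xs"
| rel_trans: "tensor_rel xs ys \<Longrightarrow> tensor_rel ys zs \<Longrightarrow> tensor_rel xs zs"
| rel_append: "tensor_rel xs xs' \<Longrightarrow> tensor_rel ys ys' \<Longrightarrow> tensor_rel (xs @ ys) (xs' @ ys')"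
| rel_comm: "tensor_rel (xs @ ys) (ys @ xs)"
| rel_add_left: "tensor_rel [(a + a', b)] [(a, b), (a', b)]"
| rel_add_right: "tensor_rel [(a, b + b')] [(a, b), (a, b')]"
| rel_scale: "tensor_rel [(c *\<^sub>C a, b)] [(a, c *\<^sub>C b)]"
| rel_zero: "tensor_rel [(0, b)] []"

quotient_type (overloaded) ('a, 'b) tensor =
    "('a::complex_vector \<times> 'b::complex_vector) list" / tensor_rel
  by (intro equivpI reflpI sympI transpI) (auto intro: tensor_rel.rel_refl tensor_rel.rel_sym tensor_rel.rel_trans)

lift_definition tensor_pure ::
    "'a::complex_vector \<Rightarrow> 'b::complex_vector \<Rightarrow> ('a, 'b) tensor"  (infixr "\<otimes>" 72)
  is "\<lambda>a b. [(a, b)]" .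

lemma tensor_rel_map_scaleC:
  assumes "tensor_rel xs ys"
  shows "tensor_rel (map (\<lambda>(a, b). (c *\<^sub>C a, b)) xs) (map (\<lambda>(a, b). (c *\<^sub>C a, b)) ys)"
  using assms
proof induction
  case (rel_scale d a b)
  show ?case
    using tensor_rel.rel_scale[of d "c *\<^sub>C a" b] by (simp add: mult.commute)
qed (auto intro: tensor_rel.intros simp: scaleC_add_right)

lemma tensor_rel_scaleC_add:
  "tensor_rel (map (\<lambda>(a, b). ((c + d) *\<^sub>C a, b)) xs)
     (map (\<lambda>(a, b). (c *\<^sub>C a, b)) xs @ map (\<lambda>(a, b). (d *\<^sub>C a, b)) xs)"
proof (induction xs)
  case Nil
  then show ?case by (simp add: tensor_rel.rel_refl)
next
  case (Cons p xs)
  obtain a b where p: "p = (a, b)" by fastforce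
  let ?f = "\<lambda>c. map (\<lambda>(a, b). (c *\<^sub>C a, b))"
  have "tensor_rel ([((c + d) *\<^sub>C a, b)] @ ?f (c + d) xs)
      ([(c *\<^sub>C a, b), (d *\<^sub>C a, b)] @ (?f c xs @ ?f d xs))"
    unfolding scaleC_add_left
    by (rule tensor_rel.rel_append[OF tensor_rel.rel_add_left Cons.IH[unfolded scaleC_add_left]])
  moreover have "tensor_rel ([(c *\<^sub>C a, b)] @ (([(d *\<^sub>C a, b)] @ ?f c xs) @ ?f d xs))
      ([(c *\<^sub>C a, b)] @ ((?f c xs @ [(d *\<^sub>C a, b)]) @ ?f d xs))"
    by (intro tensor_rel.rel_append tensor_rel.rel_refl tensor_rel.rel_comm)
  ultimately show ?case
    using tensor_rel.rel_trans by (fastforce simp: p)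
qed

lemma tensor_rel_scaleC_zero: "tensor_rel (map (\<lambda>(a, b). (0 *\<^sub>C a, b)) xs) []"
proof (induction xs)
  case Nil
  then show ?case by (simp add: tensor_rel.rel_refl)
next
  case (Cons p xs)
  show ?case
    using tensor_rel.rel_append[OF tensor_rel.rel_zero[of "snd p"] Cons.IH] by (simp add: case_prod_beta)
qed

instantiation tensor :: (complex_vector, complex_vector) complex_vector
begin

lift_definition zero_tensor :: "('a, 'b) tensor" is "[]" .

lift_definition plus_tensor :: "('a, 'b) tensor \<Rightarrow> ('a, 'b) tensor \<Rightarrow> ('a, 'b) tensor"
  is "(@)" by (rule tensor_rel.rel_append)

lift_definition scaleC_tensor :: "complex \<Rightarrow> ('a, 'b) tensor \<Rightarrow> ('a, 'b) tensor"
  is "\<lambda>c. map (\<lambda>(a, b). (c *\<^sub>C a, b))" by (rule tensor_rel_map_scaleC)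

definition uminus_tensor :: "('a, 'b) tensor \<Rightarrow> ('a, 'b) tensor"
  where "uminus_tensor x = (-1) *\<^sub>C x"

definition minus_tensor :: "('a, 'b) tensor \<Rightarrow> ('a, 'b) tensor \<Rightarrow> ('a, 'b) tensor"
  where "minus_tensor x y = x + - y"

instance
proof
  fix x y z :: "('a, 'b) tensor" and c d :: complex
  show "x + y + z = x + (y + z)" by transfer (simp add: tensor_rel.rel_refl)
  show "x + y = y + x" by transfer (rule tensor_rel.rel_comm)
  show "0 + x = x" by transfer (simp add: tensor_rel.rel_refl)
  have one: "1 *\<^sub>C w = w" for w :: "('a, 'b) tensor"
    by transfer (simp add: tensor_rel.rel_refl)
  have add: "(c + d) *\<^sub>C w = c *\<^sub>C w + d *\<^sub>C w" for c d and w :: "('a, 'b) tensor"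
    by transfer (rule tensor_rel_scaleC_add)
  have zero: "0 *\<^sub>C w = 0" for w :: "('a, 'b) tensor"
    by transfer (rule tensor_rel_scaleC_zero)
  show "- x + x = 0"
    using add[of "-1" 1 x] by (simp add: uminus_tensor_def one zero)
  show "x - y = x + - y" by (simp add: minus_tensor_def)
  show "c *\<^sub>C (x + y) = c *\<^sub>C x + c *\<^sub>C y" by transfer (simp add: tensor_rel.rel_refl)
  show "(c + d) *\<^sub>C x = c *\<^sub>C x + d *\<^sub>C x" by (rule add)
  show "c *\<^sub>C d *\<^sub>C x = (c * d) *\<^sub>C x"
  proof transfer
    fix c d :: complex and xs :: "('a \<times> 'b) list"
    have "map (\<lambda>(a, b). (c *\<^sub>C a, b)) (map (\<lambda>(a, b). (d *\<^sub>C a, b)) xs) =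
        map (\<lambda>(a, b). ((c * d) *\<^sub>C a, b)) xs"
      by (induction xs) auto
    then show "tensor_rel (map (\<lambda>(a, b). (c *\<^sub>C a, b)) (map (\<lambda>(a, b). (d *\<^sub>C a, b)) xs))
        (map (\<lambda>(a, b). ((c * d) *\<^sub>C a, b)) xs)"
      by (simp only: tensor_rel.rel_refl)
  qed
  show "1 *\<^sub>C x = x" by (rule one)
qed

end

lemma tensor_pure_add_left: "(a + a') \<otimes> b = a \<otimes> b + a' \<otimes> b"
  by transfer (simp add: tensor_rel.rel_add_left)

lemma tensor_pure_add_right: "a \<otimes> (b + b') = a \<otimes> b + a \<otimes> b'"
  by transfer (simp add: tensor_rel.rel_add_right)

lemma tensor_pure_scaleC_left: "(c *\<^sub>C a) \<otimes> b = c *\<^sub>C (a \<otimes> b)"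
  by transfer (simp add: tensor_rel.rel_refl)

lemma tensor_pure_scaleC_right: "a \<otimes> (c *\<^sub>C b) = c *\<^sub>C (a \<otimes> b)"
  by transfer (simp add: tensor_rel.rel_scale tensor_rel.rel_sym)

lemma abs_tensor_Cons: "abs_tensor (p # xs) = fst p \<otimes> snd p + abs_tensor xs"
  by (simp add: tensor_pure.abs_eq plus_tensor.abs_eq)

lemma tensor_induct [case_names zero pure add]:
  assumes "P 0" "\<And>a b. P (a \<otimes> b)" "\<And>x y. P x \<Longrightarrow> P y \<Longrightarrow> P (x + y)"
  shows "P t"
proof -
  have "P (abs_tensor xs)" for xs
    by (induction xs) (auto simp: abs_tensor_Cons zero_tensor.abs_eq[symmetric] intro: assms)
  then show ?thesis
    by (metis Quotient_tensor Quotient_abs_rep)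
qed

definition cbilinear ::
    "('a::complex_vector \<Rightarrow> 'b::complex_vector \<Rightarrow> 'c::complex_vector) \<Rightarrow> bool"
  where "cbilinear \<beta> \<longleftrightarrow> (\<forall>b. clinear (\<lambda>a. \<beta> a b)) \<and> (\<forall>a. clinear (\<beta> a))"

lemma cbilinearI:
  assumes "\<And>a a' b. \<beta> (a + a') b = \<beta> a b + \<beta> a' b"
    and "\<And>a b b'. \<beta> a (b + b') = \<beta> a b + \<beta> a b'"
    and "\<And>c a b. \<beta> (c *\<^sub>C a) b = c *\<^sub>C \<beta> a b"
    and "\<And>c a b. \<beta> a (c *\<^sub>C b) = c *\<^sub>C \<beta> a b"
  shows "cbilinear \<beta>"
  unfolding cbilinear_def using assms by (auto intro!: clinearI)

lemma cbilinearD: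
  assumes "cbilinear \<beta>"
  shows "\<beta> (a + a') b = \<beta> a b + \<beta> a' b" "\<beta> a (b + b') = \<beta> a b + \<beta> a b'"
    "\<beta> (c *\<^sub>C a) b = c *\<^sub>C \<beta> a b" "\<beta> a (c *\<^sub>C b) = c *\<^sub>C \<beta> a b"
    "\<beta> 0 b = 0" "\<beta> a 0 = 0"
  using assms unfolding cbilinear_def
  by (auto simp: Vector_Spaces.linear_iff) (metis add_cancel_right_right)+

text \<open>If \<open>t\<close> is the sum of the \<open>a\<^sub>i \<otimes> b\<^sub>i\<close>, then \<open>tensor_lift \<beta> t\<close> is the sum of the
  \<open>\<beta> a\<^sub>i b\<^sub>i\<close>; it is independent of the representation of \<open>t\<close> when \<open>\<beta>\<close> is bilinear, and is
  only meaningful then.\<close>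

definition tensor_lift ::
    "('a::complex_vector \<Rightarrow> 'b::complex_vector \<Rightarrow> 'c::complex_vector) \<Rightarrow> ('a, 'b) tensor \<Rightarrow> 'c"
  where "tensor_lift \<beta> t = (\<Sum>(a, b)\<leftarrow>rep_tensor t. \<beta> a b)"

lemma tensor_lift_abs:
  assumes "cbilinear \<beta>"
  shows "tensor_lift \<beta> (abs_tensor xs) = (\<Sum>(a, b)\<leftarrow>xs. \<beta> a b)"
proof -
  have inv: "(\<Sum>(a, b)\<leftarrow>us. \<beta> a b) = (\<Sum>(a, b)\<leftarrow>vs. \<beta> a b)" if "tensor_rel us vs" for us vs
    using that by induction (simp_all add: cbilinearD[OF assms] add.commute)
  have "tensor_rel (rep_tensor (abs_tensor xs)) xs"
    by (metis Quotient_tensor Quotient_rep_abs tensor_rel.rel_refl)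
  then show ?thesis unfolding tensor_lift_def by (rule inv)
qed

lemma tensor_lift_pure: "cbilinear \<beta> \<Longrightarrow> tensor_lift \<beta> (a \<otimes> b) = \<beta> a b"
  by (simp add: tensor_pure.abs_eq tensor_lift_abs)

lemma tensor_lift_add:
  assumes "cbilinear \<beta>"
  shows "tensor_lift \<beta> (x + y) = tensor_lift \<beta> x + tensor_lift \<beta> y"
proof -
  obtain xs ys where "x = abs_tensor xs" "y = abs_tensor ys"
    by (metis Quotient_tensor Quotient_abs_rep)
  then show ?thesis by (simp add: plus_tensor.abs_eq tensor_lift_abs assms)
qed

lemma tensor_lift_zero: "cbilinear \<beta> \<Longrightarrow> tensor_lift \<beta> 0 = 0"
  by (simp add: zero_tensor.abs_eq tensor_lift_abs)

lemma tensor_lift_scaleC: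
  assumes "cbilinear \<beta>"
  shows "tensor_lift \<beta> (c *\<^sub>C x) = c *\<^sub>C tensor_lift \<beta> x"
proof (induction x rule: tensor_induct)
  case (pure a b)
  show ?case
    by (simp add: tensor_pure_scaleC_left[symmetric] tensor_lift_pure assms cbilinearD(3))
qed (simp_all add: tensor_lift_add tensor_lift_zero scaleC_add_right assms)

lemma tensor_lift_fun_add:
  "tensor_lift (\<lambda>a b. \<beta> a b + \<gamma> a b) t = tensor_lift \<beta> t + tensor_lift \<gamma> t"
proof -
  have "(\<Sum>(a, b)\<leftarrow>xs. \<beta> a b + \<gamma> a b) = (\<Sum>(a, b)\<leftarrow>xs. \<beta> a b) + (\<Sum>(a, b)\<leftarrow>xs. \<gamma> a b)" for xs
    by (induction xs) (auto simp: algebra_simps)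
  then show ?thesis by (simp add: tensor_lift_def)
qed

lemma tensor_lift_fun_scaleC: "tensor_lift (\<lambda>a b. c *\<^sub>C \<beta> a b) t = c *\<^sub>C tensor_lift \<beta> t"
proof -
  have "(\<Sum>(a, b)\<leftarrow>xs. c *\<^sub>C \<beta> a b) = c *\<^sub>C (\<Sum>(a, b)\<leftarrow>xs. \<beta> a b)" for xs
    by (induction xs) (auto simp: scaleC_add_right)
  then show ?thesis by (simp add: tensor_lift_def)
qed

lemma tensor_rel_map_star:
  assumes "tensor_rel xs ys"
  shows "tensor_rel (map (\<lambda>(a, b). (star a, star b)) xs)
    (map (\<lambda>(a, b). (star a, star b)) (ys :: ('a::complex_star_algebra \<times> 'b::complex_star_algebra) list))"
  using assms
proof induction
  case (rel_zero b)
  have "star (0::'a) = 0" using star_add[of "0::'a" 0] by simp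
  then show ?case by (simp add: tensor_rel.rel_zero)
qed (auto intro: tensor_rel.intros simp: star_add star_scaleC)

instantiation tensor :: (complex_star_algebra, complex_star_algebra) complex_star_algebra
begin

definition one_tensor :: "('a, 'b) tensor"
  where "1 = 1 \<otimes> 1"

definition times_tensor :: "('a, 'b) tensor \<Rightarrow> ('a, 'b) tensor \<Rightarrow> ('a, 'b) tensor"
  where "x * y = tensor_lift (\<lambda>a b. tensor_lift (\<lambda>c d. (a * c) \<otimes> (b * d)) y) x"

lift_definition star_tensor :: "('a, 'b) tensor \<Rightarrow> ('a, 'b) tensor"
  is "map (\<lambda>(a, b). (star a, star b))" by (rule tensor_rel_map_star)

instance
proof
  fix x y z :: "('a, 'b) tensor" and c :: complex
  have inner: "cbilinear (\<lambda>c d. (a * c) \<otimes> (b * d) :: ('a, 'b) tensor)" for a :: 'a and b :: 'b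
    by (rule cbilinearI)
      (simp_all add: distrib_left scaleC_mult_right tensor_pure_add_left tensor_pure_add_right
        tensor_pure_scaleC_left tensor_pure_scaleC_right)
  have outer: "cbilinear (\<lambda>a b. tensor_lift (\<lambda>c d. (a * c) \<otimes> (b * d)) y :: ('a, 'b) tensor)" for y
    by (rule cbilinearI)
      (simp_all add: distrib_right scaleC_mult_left tensor_pure_add_left tensor_pure_add_right
        tensor_pure_scaleC_left tensor_pure_scaleC_right tensor_lift_fun_add tensor_lift_fun_scaleC)
  have pp: "(a \<otimes> b) * (c \<otimes> d) = (a * c) \<otimes> (b * d)" for a c :: 'a and b d :: 'b
    unfolding times_tensor_def by (rule trans[OF tensor_lift_pure[OF outer] tensor_lift_pure[OF inner]])
  have dr: "(u + v) * w = u * w + v * w" for u v w :: "('a, 'b) tensor"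
    by (simp add: times_tensor_def tensor_lift_add outer)
  have dl: "u * (v + w) = u * v + u * w" for u v w :: "('a, 'b) tensor"
    by (simp add: times_tensor_def tensor_lift_add inner tensor_lift_fun_add)
  have zl: "0 * w = 0" and zr: "w * 0 = 0" for w :: "('a, 'b) tensor"
    using dr[of 0 0 w] dl[of w 0 0] by simp_all
  have sadd: "star (u + v) = star u + star v" for u v :: "('a, 'b) tensor"
    by transfer (simp add: tensor_rel.rel_refl)
  have szero: "star (0 :: ('a, 'b) tensor) = 0"
    by transfer (simp add: tensor_rel.rel_refl)
  have spure: "star (a \<otimes> b) = star a \<otimes> star b" for a :: 'a and b :: 'b
    by transfer (simp add: tensor_rel.rel_refl)
  show "(x + y) * z = x * z + y * z" by (rule dr)
  show "x * (y + z) = x * y + x * z" by (rule dl)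
  show "1 * x = x"
    by (induction x rule: tensor_induct) (simp_all add: one_tensor_def pp dl zr)
  show "x * 1 = x"
    by (induction x rule: tensor_induct) (simp_all add: one_tensor_def pp dr zl)
  show "(c *\<^sub>C x) * y = c *\<^sub>C (x * y)"
    by (simp add: times_tensor_def tensor_lift_scaleC outer)
  show "x * (c *\<^sub>C y) = c *\<^sub>C (x * y)"
    by (simp add: times_tensor_def tensor_lift_scaleC inner tensor_lift_fun_scaleC)
  show "x * y * z = x * (y * z)"
  proof (induction x rule: tensor_induct)
    case (pure a b)
    show ?case
    proof (induction y rule: tensor_induct)
      case (pure a' b')
      show ?case
        by (induction z rule: tensor_induct) (simp_all add: pp dl zr mult.assoc)
    qed (simp_all add: dl dr zl zr)
  qed (simp_all add: dr zl)
  show "star (x * y) = star y * star x"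
  proof (induction x rule: tensor_induct)
    case (pure a b)
    show ?case
      by (induction y rule: tensor_induct)
        (simp_all add: pp dl dr zl zr sadd szero spure star_mult)
  qed (simp_all add: dl dr zl zr sadd szero)
  show "star (x + y) = star x + star y" by (rule sadd)
  show "star (star x) = x"
    by (induction x rule: tensor_induct) (simp_all add: sadd szero spure star_star)
  show "star (c *\<^sub>C x) = cnj c *\<^sub>C star x"
    by (induction x rule: tensor_induct)
      (simp_all add: scaleC_add_right sadd szero spure star_scaleC
        tensor_pure_scaleC_left[symmetric])
qed

end

definition tensor_map ::
    "('a::complex_vector \<Rightarrow> 'c::complex_vector) \<Rightarrow> ('b::complex_vector \<Rightarrow> 'd::complex_vector) \<Rightarrow>
      ('a, 'b) tensor \<Rightarrow> ('c, 'd) tensor"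
  where "tensor_map f g = tensor_lift (\<lambda>a b. f a \<otimes> g b)"

definition tensor_assoc ::
    "(('a::complex_vector, 'b::complex_vector) tensor, 'c::complex_vector) tensor \<Rightarrow>
      ('a, ('b, 'c) tensor) tensor"
  where "tensor_assoc = tensor_lift (\<lambda>x c. tensor_lift (\<lambda>a b. a \<otimes> b \<otimes> c) x)"


section \<open>Involutive bialgebras and Schuermann triples\<close>

locale involutive_bialgebra =
  fixes \<Delta> :: "'b::complex_star_algebra \<Rightarrow> ('b, 'b) tensor" and \<epsilon> :: "'b \<Rightarrow> complex"
  assumes comult_hom: "unital_star_hom \<Delta>"
    and counit_hom: "unital_star_hom \<epsilon>"
    and coassoc: "tensor_assoc (tensor_map \<Delta> (\<lambda>x. x) (\<Delta> b)) = tensor_map (\<lambda>x. x) \<Delta> (\<Delta> b)"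
    and counit_left: "tensor_lift (\<lambda>x y. \<epsilon> x *\<^sub>C y) (\<Delta> b) = b"
    and counit_right: "tensor_lift (\<lambda>x y. \<epsilon> y *\<^sub>C x) (\<Delta> b) = b"

text \<open>Convolution of linear functionals.\<close>

definition conv ::
    "('b::complex_star_algebra \<Rightarrow> ('b, 'b) tensor) \<Rightarrow> ('b \<Rightarrow> complex) \<Rightarrow> ('b \<Rightarrow> complex) \<Rightarrow>
      'b \<Rightarrow> complex"
  where "conv \<Delta> F G b = tensor_lift (\<lambda>x y. F x * G y) (\<Delta> b)"

text \<open>\<open>adjointable E\<close> is the *-algebra of linear operators on the pre-Hilbert space \<open>E\<close> with an
  adjoint defined on all of \<open>E\<close>. The space is a subspace of a type, and the values of an operator
  outside \<open>E\<close> are irrelevant.\<close>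

definition adjointable :: "'h::complex_inner set \<Rightarrow> ('h \<Rightarrow> 'h) set"
  where "adjointable E = {T.
    (\<forall>x\<in>E. T x \<in> E) \<and>
    (\<forall>x\<in>E. \<forall>y\<in>E. T (x + y) = T x + T y) \<and>
    (\<forall>c. \<forall>x\<in>E. T (c *\<^sub>C x) = c *\<^sub>C T x) \<and>
    (\<exists>S. (\<forall>x\<in>E. S x \<in> E) \<and> (\<forall>x\<in>E. \<forall>y\<in>E. cinner (S x) y = cinner x (T y)))}"

text \<open>Unital *-homomorphisms into \<open>adjointable E\<close>; the last clause says that \<open>\<pi> (star b)\<close> is
  the adjoint of \<open>\<pi> b\<close>.\<close>

definition star_representation ::
    "'h::complex_inner set \<Rightarrow> ('b::complex_star_algebra \<Rightarrow> 'h \<Rightarrow> 'h) \<Rightarrow> bool"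
  where "star_representation E \<pi> \<longleftrightarrow>
    (\<forall>b. \<pi> b \<in> adjointable E) \<and>
    (\<forall>a b. \<forall>x\<in>E. \<pi> (a + b) x = \<pi> a x + \<pi> b x) \<and>
    (\<forall>c b. \<forall>x\<in>E. \<pi> (c *\<^sub>C b) x = c *\<^sub>C \<pi> b x) \<and>
    (\<forall>x\<in>E. \<pi> 1 x = x) \<and>
    (\<forall>a b. \<forall>x\<in>E. \<pi> (a * b) x = \<pi> a (\<pi> b x)) \<and>
    (\<forall>b. \<forall>x\<in>E. \<forall>y\<in>E. cinner (\<pi> (star b) x) y = cinner x (\<pi> b y))"

locale schuermann_triple =
  fixes \<epsilon> :: "'b::complex_star_algebra \<Rightarrow> complex"
    and \<rho> :: "'b \<Rightarrow> 'd::complex_inner \<Rightarrow> 'd" and \<eta> :: "'b \<Rightarrow> 'd" and L :: "'b \<Rightarrow> complex"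
  assumes rep: "star_representation UNIV \<rho>"
    and cocycle_linear: "clinear \<eta>"
    and cocycle: "\<eta> (a * b) = \<rho> a (\<eta> b) + \<epsilon> b *\<^sub>C \<eta> a"
    and generator_linear: "clinear L"
    and generator_hermitian: "L (star a) = cnj (L a)"
    and coboundary: "- cinner (\<eta> (star a)) (\<eta> b) = \<epsilon> a * L b - L (a * b) + L a * \<epsilon> b"


section \<open>Symmetric Fock space over the square-integrable functions on the half-line\<close>

text \<open>Since the Hilbert space \<open>'k\<close> need not be separable, measurability is strong measurability.
  Elements of \<open>L2\<close> are functions, not classes modulo null sets: the Fock space below depends on
  them only through their inner products.\<close>

definition L2 :: "(real \<Rightarrow> 'k::complex_inner) set"
  where "L2 = {f.
    (\<exists>s. (\<forall>n. simple_function (lebesgue_on {0..}) (s n)) \<and>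
      (AE t in lebesgue_on {0..}. (\<lambda>n. s n t) \<longlonglongrightarrow> f t)) \<and>
    integrable (lebesgue_on {0..}) (\<lambda>t. (norm (f t))\<^sup>2)}"

definition L2_inner :: "(real \<Rightarrow> 'k::complex_inner) \<Rightarrow> (real \<Rightarrow> 'k) \<Rightarrow> complex"
  where "L2_inner f g = (LINT t|lebesgue_on {0..}. cinner (f t) (g t))"

text \<open>\<open>sp [f\<^sub>1, \<dots>, f\<^sub>n]\<close> is the symmetrisation (the orthogonal projection onto the symmetric
  tensors) of \<open>f\<^sub>1 \<otimes> \<dots> \<otimes> f\<^sub>n\<close>. The stated inner products say that it lies in the \<open>n\<close>-particle
  space, that the \<open>n\<close>-particle spaces are mutually orthogonal, and that \<open>sp\<close> is multilinear and
  symmetric; together with totality they determine the space, as the Hilbert space direct sum of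
  the symmetric tensor powers of the completion of \<open>V\<close> modulo null vectors, up to a unique
  unitary compatible with \<open>sp\<close>.\<close>

locale symmetric_fock_space =
  fixes V :: "'v set" and ip :: "'v \<Rightarrow> 'v \<Rightarrow> complex" and sp :: "'v list \<Rightarrow> 'h::complex_hilbert"
  assumes cinner_sp: "fs \<in> lists V \<Longrightarrow> gs \<in> lists V \<Longrightarrow>
      cinner (sp fs) (sp gs) =
        (if length fs = length gs
         then (\<Sum>\<pi> | \<pi> permutes {..<length fs}. \<Prod>i<length fs. ip (fs ! i) (gs ! \<pi> i)) / fact (length fs)
         else 0)"
    and sp_total: "closure (cspan (sp ` lists V)) = UNIV"

definition vacuum :: "('v list \<Rightarrow> 'h) \<Rightarrow> 'h"
  where "vacuum sp = sp []"

definition exp_vector :: "('v list \<Rightarrow> 'h::complex_hilbert) \<Rightarrow> 'v \<Rightarrow> 'h"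
  where "exp_vector sp f = (\<Sum>n. (1 / sqrt (fact n)) *\<^sub>R sp (replicate n f))"


section \<open>Solutions of the quantum stochastic differential equation\<close>

definition step_functions :: "(real \<Rightarrow> 'd::complex_vector) set"
  where "step_functions = {f. \<exists>(n::nat) a b x. (\<forall>k<n. 0 \<le> a k \<and> a k \<le> b k) \<and>
    f = (\<lambda>\<tau>. \<Sum>k<n. if \<tau> \<in> {a k..<b k} then x k else 0)}"

definition qsde_coeff ::
    "('b::complex_star_algebra \<Rightarrow> complex) \<Rightarrow> ('b \<Rightarrow> 'd::complex_inner \<Rightarrow> 'd) \<Rightarrow> ('b \<Rightarrow> 'd) \<Rightarrow>
      ('b \<Rightarrow> complex) \<Rightarrow> (real \<Rightarrow> 'd) \<Rightarrow> (real \<Rightarrow> 'd) \<Rightarrow> real \<Rightarrow> 'b \<Rightarrow> complex"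
  where "qsde_coeff \<epsilon> \<rho> \<eta> L f g \<tau> b =
    cinner (f \<tau>) (\<eta> b) + cinner (f \<tau>) (\<rho> b (g \<tau>) - \<epsilon> b *\<^sub>C g \<tau>) + cinner (\<eta> (star b)) (g \<tau>) + L b"

definition before :: "real \<Rightarrow> (real \<Rightarrow> 'd::zero) \<Rightarrow> real \<Rightarrow> 'd"
  where "before t f = (\<lambda>\<tau>. if \<tau> < t then f \<tau> else 0)"

definition after :: "real \<Rightarrow> (real \<Rightarrow> 'd::zero) \<Rightarrow> real \<Rightarrow> 'd"
  where "after t f = (\<lambda>\<tau>. if \<tau> < t then 0 else f \<tau>)"

text \<open>\<open>E\<close> is the exponential vector map on \<open>D\<close>-valued step functions and \<open>\<D>\<close> the common dense
  invariant domain of all operators \<open>j s t b\<close>. Adaptedness says, in terms of matrix elements, that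
  for \<open>0 \<le> s \<le> t\<close> the operator \<open>j s t b\<close> acts as an ampliation with respect to the factorisation
  of the Fock space at time \<open>t\<close>. The field \<open>qsde\<close> is the weak form of
  \<open>dj = j \<star> (dA\<^sup>* \<circ> \<eta> + d\<Lambda> \<circ> (\<rho> - \<epsilon>) + dA \<circ> \<eta> \<circ> * + L dt)\<close> obtained from the first
  fundamental formula of quantum stochastic calculus.\<close>

locale qsde_solution =
  fixes \<Delta> :: "'b::complex_star_algebra \<Rightarrow> ('b, 'b) tensor" and \<epsilon> :: "'b \<Rightarrow> complex"
    and \<rho> :: "'b \<Rightarrow> 'd::complex_inner \<Rightarrow> 'd" and \<eta> :: "'b \<Rightarrow> 'd" and L :: "'b \<Rightarrow> complex"
    and E :: "(real \<Rightarrow> 'd) \<Rightarrow> 'h::complex_hilbert"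
    and \<D> :: "'h set" and j :: "real \<Rightarrow> real \<Rightarrow> 'b \<Rightarrow> 'h \<Rightarrow> 'h"
  assumes domain_subspace: "csubspace \<D>"
    and domain_dense: "closure \<D> = UNIV"
    and exp_in_domain: "f \<in> step_functions \<Longrightarrow> E f \<in> \<D>"
    and rep: "0 \<le> s \<Longrightarrow> s \<le> t \<Longrightarrow> star_representation \<D> (j s t)"
    and adapted: "0 \<le> s \<Longrightarrow> s \<le> t \<Longrightarrow> f \<in> step_functions \<Longrightarrow> g \<in> step_functions \<Longrightarrow>
      cinner (E f) (j s t b (E g)) =
        cinner (E (before t f)) (j s t b (E (before t g))) * cinner (E (after t f)) (E (after t g))"
    and initial: "0 \<le> s \<Longrightarrow> x \<in> \<D> \<Longrightarrow> j s s b x = \<epsilon> b *\<^sub>C x"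
    and qsde: "0 \<le> s \<Longrightarrow> s \<le> t \<Longrightarrow> f \<in> step_functions \<Longrightarrow> g \<in> step_functions \<Longrightarrow>
      ((\<lambda>\<tau>. conv \<Delta> (\<lambda>x. cinner (E f) (j s \<tau> x (E g))) (qsde_coeff \<epsilon> \<rho> \<eta> L f g \<tau>) b) has_integral
        cinner (E f) (j s t b (E g)) - \<epsilon> b * cinner (E f) (E g)) {s..t}"

end

theory Submission
  imports Defs
begin

text \<open>
  Let \<open>E f\<close> be the exponential vector of a \<open>D\<close>-valued step function \<open>f\<close>. These vectors are total in
  the Fock space, so it suffices to approximate each of them by products of increments applied to
  the vacuum. If \<open>\<eta> b = x\<close> and \<open>\<epsilon> b = 0\<close>, then \<open>j\<^sub>s\<^sub>,\<^sub>s\<^sub>+\<^sub>\<delta> (1 + b - \<delta> L(b)) \<Omega>\<close> agrees with the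
  exponential vector of \<open>x 1\<^bsub>[s,s+\<delta>)\<^esub>\<close> up to \<open>O(\<delta>\<^sup>2)\<close>, uniformly in \<open>s\<close>, both in its norm and in
  its inner product with that vector. Since these quantities multiply over disjoint intervals, the
  product of \<open>n\<close> such increments with \<open>\<delta> = (t - s) / n\<close> converges in norm to the exponential vector
  of \<open>x 1\<^bsub>[s,t)\<^esub>\<close>. Multiplicativity comes from adaptedness at the right end point, which is
  assumed, and at the left end point, which follows from the uniqueness of solutions of the integral
  equation for the matrix elements: by coassociativity that equation lives on a finite-dimensional
  space.
\<close>

section \<open>Inner products\<close>

text \<open>The operators may be unbounded and are accessible through matrix elements, so each
  product vector \<open>v\<close> is compared with its target \<open>u\<close> by two scalars, its
  norm and its inner product with \<open>u\<close>: these determine |v - u|^2. With the vacuum on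
  the right the conservation and annihilation terms vanish, and the coefficient of the equation
  reduces to <x, \<eta>(b)> + L(b). The correction -\<delta> L(b) removes the drift of the vacuum
  component. What remains to first order is \<delta> |x|^2 in both scalars, from <x, \<eta>(b)> in
  one and from L(star b * b) = |\<eta>(b)|^2 in the other, which is the first-order term of
  exp(\<delta> |x|^2), the squared norm of the exponential vector. The n errors of order \<delta>^2
  add up to order 1/n. The obstacle is that an increment is applied to a vector already built from
  later increments, whereas adaptedness is stated for exponential vectors. Such a vector lies in the
  closed span of the exponential vectors supported after the increment, and passing to the adjoint
  on the left carries the matrix-element identities over by continuity.\<close>

lemma cinner_add_left: "cinner (x + y) z = cinner x z + cinner y z"
  by (metis cinner_add_right cinner_commute complex_cnj_add)

lemma cinner_scaleC_left: "cinner (c *\<^sub>C x) y = cnj c * cinner x y"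
  by (metis cinner_commute cinner_scaleC_right complex_cnj_mult)

lemma cinner_zero_right [simp]: "cinner x 0 = 0"
  using cinner_add_right[of x 0 0] by simp

lemma cinner_zero_left [simp]: "cinner 0 x = 0"
  using cinner_add_left[of 0 0 x] by simp

lemma cinner_minus_right: "cinner x (- y) = - cinner x y"
  using cinner_add_right[of x y "- y"] by (simp add: add_eq_0_iff2)

lemma cinner_diff_right: "cinner x (y - z) = cinner x y - cinner x z"
  using cinner_add_right[of x y "- z"] by (simp add: cinner_minus_right)

lemma cinner_diff_left: "cinner (x - y) z = cinner x z - cinner y z"
  by (metis cinner_commute cinner_diff_right complex_cnj_diff)

lemma cinner_scaleR_right: "cinner x (r *\<^sub>R y) = r *\<^sub>R cinner x y"
  by (simp add: scaleR_scaleC cinner_scaleC_right scaleR_conv_of_real)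

lemma cinner_scaleR_left: "cinner (r *\<^sub>R x) y = r *\<^sub>R cinner x y"
  by (simp add: scaleR_scaleC cinner_scaleC_left scaleR_conv_of_real)

lemma norm_cinner_le:
  fixes x y :: "'a::complex_inner"
  shows "norm (cinner x y) \<le> norm x * norm y"
proof (cases "y = 0")
  case False
  \<comment> \<open>\<open>c *\<^sub>C y\<close> is the orthogonal projection of \<open>x\<close>
    onto the line of \<open>y\<close>; the inequality is the nonnegativity of the squared norm of
    the remainder.\<close>
  define c where "c = cinner y x / of_real ((norm y)\<^sup>2)"
  have ny: "norm y \<noteq> 0" using False by simp
  have "cinner (x - c *\<^sub>C y) (x - c *\<^sub>C y) =
      cinner x x - c * cinner x y - cnj c * cinner y x + cnj c * c * cinner y y"
    by (simp add: cinner_diff_left cinner_diff_right cinner_scaleC_left cinner_scaleC_right algebra_simps)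
  also have "\<dots> = cinner x x - c * cinner x y"
    using ny by (simp add: c_def cinner_same power2_eq_square)
  also have "c * cinner x y = of_real ((norm (cinner x y))\<^sup>2 / (norm y)\<^sup>2)"
    unfolding c_def using complex_norm_square[of "cinner x y"] cinner_commute[of y x]
    by (simp add: mult.commute)
  finally have "of_real ((norm (x - c *\<^sub>C y))\<^sup>2) =
      complex_of_real ((norm x)\<^sup>2 - (norm (cinner x y))\<^sup>2 / (norm y)\<^sup>2)"
    by (simp add: cinner_same)
  then have "(norm (x - c *\<^sub>C y))\<^sup>2 = (norm x)\<^sup>2 - (norm (cinner x y))\<^sup>2 / (norm y)\<^sup>2"
    using of_real_eq_iff by blast
  then have "(norm (cinner x y))\<^sup>2 / (norm y)\<^sup>2 \<le> (norm x)\<^sup>2"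
    by (smt (verit) zero_le_power2)
  then have "(norm (cinner x y))\<^sup>2 \<le> (norm x * norm y)\<^sup>2"
    using ny by (simp add: pos_divide_le_eq power_mult_distrib)
  then show ?thesis
    by (rule power2_le_imp_le) simp
qed simp

lemma bounded_bilinear_cinner: "bounded_bilinear (cinner :: 'a::complex_inner \<Rightarrow> 'a \<Rightarrow> complex)"
  by standard (auto simp: cinner_add_left cinner_add_right cinner_scaleR_left cinner_scaleR_right
      intro!: exI[of _ 1] norm_cinner_le)

lemmas tendsto_cinner [tendsto_intros] = bounded_bilinear.tendsto[OF bounded_bilinear_cinner]
lemmas continuous_on_cinner [continuous_intros] =
  bounded_bilinear.continuous_on[OF bounded_bilinear_cinner]

lemma norm_scaleC: "norm (c *\<^sub>C x) = norm c * norm (x :: 'a::complex_inner)"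
proof -
  have "complex_of_real ((norm (c *\<^sub>C x))\<^sup>2) = (c * cnj c) * cinner x x"
    by (simp add: cinner_same[symmetric] cinner_scaleC_left cinner_scaleC_right del: of_real_power)
  also have "\<dots> = of_real ((norm c)\<^sup>2) * of_real ((norm x)\<^sup>2)"
    by (simp only: complex_norm_square cinner_same)
  also have "\<dots> = of_real ((norm c * norm x)\<^sup>2)"
    by (simp add: power_mult_distrib)
  finally have "(norm (c *\<^sub>C x))\<^sup>2 = (norm c * norm x)\<^sup>2"
    using of_real_eq_iff by blast
  then show ?thesis by simp
qed

lemma bounded_linear_scaleC: "bounded_linear (\<lambda>x :: 'a::complex_inner. c *\<^sub>C x)"
  by (rule bounded_linear_intro[where K = "norm c"])
    (simp_all add: scaleC_add_right scaleR_scaleC scaleC_scaleC norm_scaleC mult.commute)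

lemma csubspace_closure:
  fixes S :: "'a::complex_inner set"
  assumes "csubspace S"
  shows "csubspace (closure S)"
proof (rule complex_vector.subspaceI)
  show "0 \<in> closure S"
    using assms closure_subset complex_vector.subspace_0 by blast
next
  fix x y assume "x \<in> closure S" "y \<in> closure S"
  then obtain f g where "\<And>n. f n \<in> S" "f \<longlonglongrightarrow> x" "\<And>n. g n \<in> S" "g \<longlonglongrightarrow> y"
    unfolding closure_sequential by blast
  then show "x + y \<in> closure S"
    unfolding closure_sequential
    by (intro exI[of _ "\<lambda>n. f n + g n"]) (auto intro: tendsto_add complex_vector.subspace_add[OF assms])
next
  fix c x assume "x \<in> closure S"
  then obtain f where "\<And>n. f n \<in> S" "f \<longlonglongrightarrow> x"
    unfolding closure_sequential by blast
  then show "c *\<^sub>C x \<in> closure S"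
    unfolding closure_sequential
    by (intro exI[of _ "\<lambda>n. c *\<^sub>C f n"])
      (auto intro: bounded_linear.tendsto[OF bounded_linear_scaleC] complex_vector.subspace_scale[OF assms])
qed

lemma csubspace_closure_cspan: "csubspace (closure (cspan (A :: 'a::complex_inner set)))"
  by (intro csubspace_closure complex_vector.subspace_span)

lemma closure_cspan_subset:
  assumes "csubspace M" "closed M" "A \<subseteq> M"
  shows "closure (cspan A) \<subseteq> M"
  using assms by (intro closure_minimal complex_vector.span_minimal)

lemma closure_cspan_superset: "A \<subseteq> closure (cspan (A :: 'a::complex_inner set))"
  using closure_subset complex_vector.span_superset by blast

text \<open>Together with closedness this allows an identity between two functionals of
  \<open>z\<close> to be checked on a total set; it is how matrix-element formulas pass from
  exponential vectors to other vectors.\<close>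

lemma csubspace_cinner_eq:
  "csubspace {z :: 'a::complex_inner. cinner x z = c * cinner y z}"
  by (rule complex_vector.subspaceI)
    (auto simp: cinner_add_right cinner_scaleC_right algebra_simps)

lemma closed_cinner_eq:
  "closed {z :: 'a::complex_inner. cinner x z = c * cinner y z}"
  by (intro closed_Collect_eq continuous_intros)

text \<open>The difference \<open>x - y\<close> is orthogonal to a total set, hence to every vector,
  in particular to itself.\<close>

lemma cinner_ext:
  fixes x y :: "'a::complex_inner"
  assumes total: "closure (cspan A) = UNIV" and eq: "\<And>a. a \<in> A \<Longrightarrow> cinner a x = cinner a y"
  shows "x = y"
proof -
  have "cinner x a = 1 * cinner y a" if "a \<in> A" for a
    using eq[OF that] by (metis cinner_commute mult_1)
  then have "closure (cspan A) \<subseteq> {z. cinner x z = 1 * cinner y z}"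
    by (intro closure_cspan_subset csubspace_cinner_eq closed_cinner_eq) auto
  then have "cinner x (x - y) = cinner y (x - y)" using total by auto
  then have "cinner (x - y) (x - y) = 0" by (simp add: cinner_diff_left)
  then show ?thesis by (simp add: cinner_same)
qed

lemma norm_diff_square:
  fixes x y :: "'a::complex_inner"
  shows "(norm (x - y))\<^sup>2 = (norm x)\<^sup>2 + (norm y)\<^sup>2 - 2 * Re (cinner x y)"
proof -
  have "complex_of_real ((norm (x - y))\<^sup>2) = cinner x x + cinner y y - (cinner x y + cinner y x)"
    by (simp only: cinner_same[symmetric] cinner_diff_left cinner_diff_right) simp
  also have "\<dots> = of_real ((norm x)\<^sup>2) + of_real ((norm y)\<^sup>2) - (cinner x y + cnj (cinner x y))"
    by (simp only: cinner_same cinner_commute[of y x])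
  also have "\<dots> = of_real ((norm x)\<^sup>2 + (norm y)\<^sup>2 - 2 * Re (cinner x y))"
    by (simp add: complex_add_cnj)
  finally show ?thesis using of_real_eq_iff by blast
qed

\<comment> \<open>Completeness gives access to the summability results for Banach spaces, on which
  the exponential series rests.\<close>
subclass (in complex_hilbert) banach ..

section \<open>Square-integrable functions\<close>

abbreviation half_line :: "real measure" where "half_line \<equiv> lebesgue_on {0..}"

text \<open>Lebesgue measure is complete: modifying \<open>h\<close> on a null set changes preimages
  by subsets of a null set, and these are measurable.\<close>

lemma measurable_half_line_AE_eq:
  assumes h: "h \<in> borel_measurable half_line" and ae: "AE t in half_line. h t = g t"
  shows "g \<in> borel_measurable half_line"
proof (rule measurableI)
  fix A :: "'a set" assume A: "A \<in> sets borel"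
  obtain N where N: "{t \<in> space half_line. h t \<noteq> g t} \<subseteq> N" "N \<in> null_sets half_line"
    using ae by (auto elim!: AE_E simp: null_sets_def)
  have sub: "X \<in> sets half_line" if "X \<subseteq> N" for X
  proof -
    have "N \<in> null_sets lebesgue" "N \<subseteq> {0..}"
      using N(2) by (auto simp: null_sets_restrict_space)
    with that show ?thesis
      using completion.complete2[of X N] by (auto simp: sets_restrict_space_iff null_sets_def)
  qed
  have "g -` A \<inter> space half_line = ((h -` A \<inter> space half_line) - N) \<union> (g -` A \<inter> space half_line \<inter> N)"
    using N(1) by auto
  also have "\<dots> \<in> sets half_line"
    using measurable_sets[OF h A] N(2) sub by (intro sets.Un sets.Diff) auto
  finally show "g -` A \<inter> space half_line \<in> sets half_line" .
qed auto

lemma measurable_half_line_AE_lim: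
  fixes u :: "nat \<Rightarrow> real \<Rightarrow> 'a::{banach, second_countable_topology}"
  assumes u: "\<And>n. u n \<in> borel_measurable half_line"
    and lim: "AE t in half_line. (\<lambda>n. u n t) \<longlonglongrightarrow> g t"
  shows "g \<in> borel_measurable half_line"
proof (rule measurable_half_line_AE_eq)
  show "(\<lambda>t. lim (\<lambda>n. u n t)) \<in> borel_measurable half_line"
    using u by (rule borel_measurable_lim_metric)
  show "AE t in half_line. lim (\<lambda>n. u n t) = g t"
    using lim by eventually_elim (rule limI)
qed

definition strongly_measurable :: "(real \<Rightarrow> 'k::complex_inner) \<Rightarrow> bool"
  where "strongly_measurable f \<longleftrightarrow>
    (\<exists>s. (\<forall>n. simple_function half_line (s n)) \<and> (AE t in half_line. (\<lambda>n. s n t) \<longlonglongrightarrow> f t))"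

lemma L2_iff: "f \<in> L2 \<longleftrightarrow> strongly_measurable f \<and> integrable half_line (\<lambda>t. (norm (f t))\<^sup>2)"
  by (simp add: L2_def strongly_measurable_def)

lemma strongly_measurable_simple: "simple_function half_line f \<Longrightarrow> strongly_measurable f"
  unfolding strongly_measurable_def by (intro exI[of _ "\<lambda>_. f"]) simp

lemma strongly_measurable_add:
  assumes "strongly_measurable f" "strongly_measurable g"
  shows "strongly_measurable (\<lambda>t. f t + g t)"
proof -
  obtain u v where u: "\<And>n. simple_function half_line (u n)" "AE t in half_line. (\<lambda>n. u n t) \<longlonglongrightarrow> f t"
    and v: "\<And>n. simple_function half_line (v n)" "AE t in half_line. (\<lambda>n. v n t) \<longlonglongrightarrow> g t"
    using assms unfolding strongly_measurable_def by blast
  have "AE t in half_line. (\<lambda>n. u n t + v n t) \<longlonglongrightarrow> f t + g t"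
    using u(2) v(2) by eventually_elim (rule tendsto_add)
  then show ?thesis
    unfolding strongly_measurable_def
    by (intro exI[of _ "\<lambda>n t. u n t + v n t"] conjI allI simple_function_add u(1) v(1))
qed

lemma strongly_measurable_scaleC:
  assumes "strongly_measurable f"
  shows "strongly_measurable (\<lambda>t. c *\<^sub>C f t)"
proof -
  obtain u where u: "\<And>n. simple_function half_line (u n)" "AE t in half_line. (\<lambda>n. u n t) \<longlonglongrightarrow> f t"
    using assms unfolding strongly_measurable_def by blast
  have "AE t in half_line. (\<lambda>n. c *\<^sub>C u n t) \<longlonglongrightarrow> c *\<^sub>C f t"
    using u(2) by eventually_elim (rule bounded_linear.tendsto[OF bounded_linear_scaleC])
  then show ?thesis
    unfolding strongly_measurable_def
    by (intro exI[of _ "\<lambda>n t. c *\<^sub>C u n t"] conjI allI simple_function_compose1[OF u(1)])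
qed

text \<open>The values may lie in a nonseparable space, so the inner product is written as an almost
  everywhere limit of inner products of simple functions, which are scalar simple functions.\<close>

lemma measurable_cinner:
  assumes "strongly_measurable f" "strongly_measurable g"
  shows "(\<lambda>t. cinner (f t) (g t)) \<in> borel_measurable half_line"
proof -
  obtain u v where u: "\<And>n. simple_function half_line (u n)" "AE t in half_line. (\<lambda>n. u n t) \<longlonglongrightarrow> f t"
    and v: "\<And>n. simple_function half_line (v n)" "AE t in half_line. (\<lambda>n. v n t) \<longlonglongrightarrow> g t"
    using assms unfolding strongly_measurable_def by blast
  show ?thesis
  proof (rule measurable_half_line_AE_lim)
    show "(\<lambda>t. cinner (u n t) (v n t)) \<in> borel_measurable half_line" for n
      by (rule borel_measurable_simple_function[OF simple_function_compose2[OF u(1) v(1)]])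
    show "AE t in half_line. (\<lambda>n. cinner (u n t) (v n t)) \<longlonglongrightarrow> cinner (f t) (g t)"
      using u(2) v(2) by eventually_elim (rule tendsto_cinner)
  qed
qed

lemma measurable_norm_strongly:
  assumes "strongly_measurable f"
  shows "(\<lambda>t. norm (f t)) \<in> borel_measurable half_line"
proof -
  have "(\<lambda>t. sqrt (Re (cinner (f t) (f t)))) \<in> borel_measurable half_line"
    using measurable_cinner[OF assms assms] by measurable
  then show ?thesis by (simp add: cinner_same)
qed

lemma norm_add_square_le:
  fixes x y :: "'a::real_normed_vector"
  shows "(norm (x + y))\<^sup>2 \<le> 2 * (norm x)\<^sup>2 + 2 * (norm y)\<^sup>2"
proof -
  have "(norm (x + y))\<^sup>2 \<le> (norm x + norm y)\<^sup>2"
    by (rule power_mono[OF norm_triangle_ineq norm_ge_zero])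
  also have "\<dots> \<le> 2 * (norm x)\<^sup>2 + 2 * (norm y)\<^sup>2"
    using sum_squares_bound[of "norm x" "norm y"] unfolding power2_sum by linarith
  finally show ?thesis .
qed

lemma L2_add:
  assumes "f \<in> L2" "g \<in> L2"
  shows "(\<lambda>t. f t + g t) \<in> L2"
proof -
  have m: "strongly_measurable (\<lambda>t. f t + g t)"
    using assms unfolding L2_iff by (blast intro: strongly_measurable_add)
  have "integrable half_line (\<lambda>t. (norm (f t + g t))\<^sup>2)"
  proof (rule Bochner_Integration.integrable_bound)
    show "integrable half_line (\<lambda>t. 2 * (norm (f t))\<^sup>2 + 2 * (norm (g t))\<^sup>2)"
      using assms by (auto simp: L2_iff)
    show "(\<lambda>t. (norm (f t + g t))\<^sup>2) \<in> borel_measurable half_line"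
      using measurable_norm_strongly[OF m] by measurable
    show "AE t in half_line. norm ((norm (f t + g t))\<^sup>2) \<le> norm (2 * (norm (f t))\<^sup>2 + 2 * (norm (g t))\<^sup>2)"
    proof (rule AE_I2)
      fix t
      show "norm ((norm (f t + g t))\<^sup>2) \<le> norm (2 * (norm (f t))\<^sup>2 + 2 * (norm (g t))\<^sup>2)"
        using norm_add_square_le[of "f t" "g t"] by simp
    qed
  qed
  with m show ?thesis by (simp add: L2_iff)
qed

lemma L2_scaleC: "f \<in> L2 \<Longrightarrow> (\<lambda>t. c *\<^sub>C f t) \<in> L2"
  by (auto simp: L2_iff norm_scaleC power_mult_distrib intro: strongly_measurable_scaleC)

lemma L2_zero: "(\<lambda>t. 0) \<in> L2"
  by (simp add: L2_iff strongly_measurable_simple)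

lemma uminus_scaleC: "- x = (- 1) *\<^sub>C (x :: 'a::complex_vector)"
  by (metis complex_vector.scale_minus_left scaleC_one)

lemma L2_diff: "f \<in> L2 \<Longrightarrow> g \<in> L2 \<Longrightarrow> (\<lambda>t. f t - g t) \<in> L2"
  using L2_add[of f "\<lambda>t. (- 1) *\<^sub>C g t"] L2_scaleC[of g "- 1"]
  by (simp add: uminus_scaleC[symmetric])

lemma norm_mult_le_squares: "norm x * norm y \<le> (norm x)\<^sup>2 + (norm y)\<^sup>2"
  using sum_squares_bound[of "norm x" "norm y"] mult_nonneg_nonneg[OF norm_ge_zero[of x] norm_ge_zero[of y]]
  by linarith

lemma integrable_cinner:
  assumes "f \<in> L2" "g \<in> L2"
  shows "integrable half_line (\<lambda>t. cinner (f t) (g t))"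
proof (rule Bochner_Integration.integrable_bound)
  show "integrable half_line (\<lambda>t. (norm (f t))\<^sup>2 + (norm (g t))\<^sup>2)"
    using assms by (auto simp: L2_iff)
  show "(\<lambda>t. cinner (f t) (g t)) \<in> borel_measurable half_line"
    using assms by (auto simp: L2_iff intro: measurable_cinner)
  show "AE t in half_line. norm (cinner (f t) (g t)) \<le> norm ((norm (f t))\<^sup>2 + (norm (g t))\<^sup>2)"
  proof (rule AE_I2)
    fix t
    show "norm (cinner (f t) (g t)) \<le> norm ((norm (f t))\<^sup>2 + (norm (g t))\<^sup>2)"
      using norm_cinner_le[of "f t" "g t"] norm_mult_le_squares[of "f t" "g t"] by simp
  qed
qed

lemma L2_inner_add_right:
  "f \<in> L2 \<Longrightarrow> g \<in> L2 \<Longrightarrow> h \<in> L2 \<Longrightarrow> L2_inner f (\<lambda>t. g t + h t) = L2_inner f g + L2_inner f h"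
  by (simp add: L2_inner_def cinner_add_right integrable_cinner)

lemma L2_inner_scaleC_right: "L2_inner f (\<lambda>t. c *\<^sub>C g t) = c * L2_inner f g"
  by (simp add: L2_inner_def cinner_scaleC_right)

definition L2_norm_sq :: "(real \<Rightarrow> 'k::complex_inner) \<Rightarrow> real"
  where "L2_norm_sq f = (LINT t|half_line. (norm (f t))\<^sup>2)"

lemma L2_norm_sq_nonneg: "0 \<le> L2_norm_sq f"
  by (simp add: L2_norm_sq_def)

lemma L2_inner_same: "L2_inner f f = of_real (L2_norm_sq f)"
  by (simp only: L2_inner_def L2_norm_sq_def cinner_same integral_complex_of_real)

lemma L2_norm_sq_add_le:
  assumes "f \<in> L2" "g \<in> L2"
  shows "L2_norm_sq (\<lambda>t. f t + g t) \<le> 2 * L2_norm_sq f + 2 * L2_norm_sq g"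
proof -
  have "L2_norm_sq (\<lambda>t. f t + g t) \<le> (LINT t|half_line. 2 * (norm (f t))\<^sup>2 + 2 * (norm (g t))\<^sup>2)"
    unfolding L2_norm_sq_def using L2_add[OF assms] assms
    by (intro integral_mono) (auto simp: L2_iff norm_add_square_le)
  then show ?thesis
    using assms by (simp add: L2_norm_sq_def L2_iff)
qed

text \<open>Elements of \<open>L2\<close> form a set of functions, not a type with an inner product,
  so Cauchy-Schwarz is obtained by integrating |<f t, g t>| \<le> (c |f t|^2 + |g t|^2 / c) / 2 and
  choosing \<open>c\<close>.\<close>

lemma norm_L2_inner_le:
  assumes f: "f \<in> L2" and g: "g \<in> L2"
  shows "norm (L2_inner f g) \<le> sqrt (L2_norm_sq f) * sqrt (L2_norm_sq g)"
proof (rule field_le_epsilon)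
  have bound: "norm (L2_inner f g) \<le> (c * L2_norm_sq f + L2_norm_sq g / c) / 2" if "c > 0" for c
  proof -
    have pt: "norm (cinner (f t) (g t)) \<le> (c * (norm (f t))\<^sup>2 + (norm (g t))\<^sup>2 / c) / 2" for t
    proof -
      have "0 \<le> (c * norm (f t) - norm (g t))\<^sup>2 / (2 * c)" using that by simp
      also have "\<dots> = (c * (norm (f t))\<^sup>2 + (norm (g t))\<^sup>2 / c) / 2 - norm (f t) * norm (g t)"
        using that by (simp add: field_simps power2_eq_square)
      finally show ?thesis using norm_cinner_le[of "f t" "g t"] by linarith
    qed
    have "norm (L2_inner f g) \<le> (LINT t|half_line. norm (cinner (f t) (g t)))"
      unfolding L2_inner_def by (rule integral_norm_bound)
    also have "\<dots> \<le> (LINT t|half_line. (c * (norm (f t))\<^sup>2 + (norm (g t))\<^sup>2 / c) / 2)"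
      using integrable_cinner[OF f g] f g pt by (intro integral_mono) (auto simp: L2_iff)
    also have "\<dots> = (c * L2_norm_sq f + L2_norm_sq g / c) / 2"
      using f g by (simp add: L2_norm_sq_def L2_iff)
    finally show ?thesis .
  qed
  fix e :: real assume e: "0 < e"
  define a where "a = sqrt (L2_norm_sq f)"
  define b where "b = sqrt (L2_norm_sq g)"
  have ab: "a \<ge> 0" "b \<ge> 0" "L2_norm_sq f = a\<^sup>2" "L2_norm_sq g = b\<^sup>2"
    by (simp_all add: a_def b_def L2_norm_sq_nonneg)
  define d where "d = e / (a + b + 1)"
  have d: "d > 0" "d * (a + b) \<le> e"
    using e ab by (auto simp: d_def divide_simps)
  \<comment> \<open>The optimal value is b / a; adding d > 0 to both norms keeps it defined and
    positive when one of them vanishes, and \<open>d\<close> was chosen so that the loss is at most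
    \<open>e\<close>.\<close>
  define c where "c = (b + d) / (a + d)"
  have c: "c > 0" using ab d by (simp add: c_def add_nonneg_pos)
  have pos: "a + d > 0" "b + d > 0" using ab d by auto
  have "c * a\<^sup>2 \<le> (b + d) * a"
  proof -
    have "c * a\<^sup>2 = (b + d) * a * (a / (a + d))" by (simp add: c_def power2_eq_square)
    also have "\<dots> \<le> (b + d) * a * 1"
      using ab d pos by (intro mult_left_mono) auto
    finally show ?thesis by simp
  qed
  moreover have "b\<^sup>2 / c \<le> (a + d) * b"
  proof -
    have "b\<^sup>2 / c = (a + d) * b * (b / (b + d))" by (simp add: c_def power2_eq_square)
    also have "\<dots> \<le> (a + d) * b * 1"
      using ab d pos by (intro mult_left_mono) auto
    finally show ?thesis by simp
  qed
  moreover have "0 \<le> d * a" "0 \<le> d * b"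
    using d(1) ab(1,2) by simp_all
  moreover have "(X + Y) / 2 \<le> P + (Q + R)"
    if "X \<le> P + Q" "Y \<le> P + R" "0 \<le> Q" "0 \<le> R" for X Y P Q R :: real
    using that by simp
  ultimately have "(c * a\<^sup>2 + b\<^sup>2 / c) / 2 \<le> a * b + d * (a + b)"
    unfolding distrib_left distrib_right mult.commute[of b a] by blast
  moreover have "norm (L2_inner f g) \<le> (c * a\<^sup>2 + b\<^sup>2 / c) / 2"
    using bound[OF c] by (simp only: ab(3,4))
  ultimately have "norm (L2_inner f g) \<le> a * b + e"
    using d(2) by linarith
  then show "norm (L2_inner f g) \<le> sqrt (L2_norm_sq f) * sqrt (L2_norm_sq g) + e"
    by (simp only: a_def b_def)
qed

section \<open>Step functions\<close>

definition piece :: "real set \<Rightarrow> 'd::zero \<Rightarrow> real \<Rightarrow> 'd"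
  where "piece A x = (\<lambda>\<tau>. if \<tau> \<in> A then x else 0)"

lemma step_functions_zero: "(\<lambda>\<tau>. 0) \<in> step_functions"
  unfolding step_functions_def by (auto intro!: exI[of _ 0])

lemma step_functions_add_piece:
  assumes f: "f \<in> step_functions" and ab: "0 \<le> a" "a \<le> b"
  shows "(\<lambda>\<tau>. f \<tau> + piece {a..<b} x \<tau>) \<in> step_functions"
proof -
  obtain n :: nat and a' b' x' where *: "\<forall>k<n. 0 \<le> a' k \<and> a' k \<le> b' k"
    and f: "f = (\<lambda>\<tau>. \<Sum>k<n. if \<tau> \<in> {a' k..<b' k} then x' k else 0)"
    using f unfolding step_functions_def by blast
  show ?thesis
    unfolding step_functions_def
  proof (intro CollectI exI conjI)
    show "\<forall>k<Suc n. 0 \<le> (a'(n := a)) k \<and> (a'(n := a)) k \<le> (b'(n := b)) k"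
      using * ab by auto
    show "(\<lambda>\<tau>. f \<tau> + piece {a..<b} x \<tau>) = (\<lambda>\<tau>. \<Sum>k<Suc n.
        if \<tau> \<in> {(a'(n := a)) k..<(b'(n := b)) k} then (x'(n := x)) k else 0)"
      by (auto simp: f piece_def fun_eq_iff intro!: sum.cong)
  qed
qed

lemma step_functions_induct [consumes 1, case_names zero add]:
  assumes "f \<in> step_functions"
    and zero: "P (\<lambda>\<tau>. 0)"
    and add: "\<And>f a b x. f \<in> step_functions \<Longrightarrow> P f \<Longrightarrow> 0 \<le> a \<Longrightarrow> a \<le> b \<Longrightarrow>
      P (\<lambda>\<tau>. f \<tau> + piece {a..<b} x \<tau>)"
  shows "P f"
proof -
  have "P (\<lambda>\<tau>. \<Sum>k<n. if \<tau> \<in> {a k..<b k} then x k else 0)"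
    if "\<forall>k<n. 0 \<le> a k \<and> a k \<le> b k" for n :: nat and a b x
    using that
  proof (induction n)
    case (Suc n)
    have "(\<lambda>\<tau>. \<Sum>k<n. if \<tau> \<in> {a k..<b k} then x k else 0) \<in> step_functions"
      unfolding step_functions_def using Suc.prems
      by (intro CollectI exI[of _ n] exI[of _ a] exI[of _ b] exI[of _ x]) auto
    then have "P (\<lambda>\<tau>. (\<Sum>k<n. if \<tau> \<in> {a k..<b k} then x k else 0) + piece {a n..<b n} (x n) \<tau>)"
      using Suc by (intro add) auto
    then show ?case by (simp add: piece_def)
  qed (simp add: zero)
  with assms(1) show ?thesis unfolding step_functions_def by blast
qed

lemma step_functions_piece: "0 \<le> a \<Longrightarrow> a \<le> b \<Longrightarrow> piece {a..<b} x \<in> step_functions"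
  using step_functions_add_piece[OF step_functions_zero] by simp

lemma step_functions_add:
  assumes "f \<in> step_functions" "g \<in> step_functions"
  shows "(\<lambda>\<tau>. f \<tau> + g \<tau>) \<in> step_functions"
  using assms(2)
proof (induction rule: step_functions_induct)
  case (add g a b x)
  then show ?case
    using step_functions_add_piece[OF add.IH add.hyps(2,3)] by (simp add: add.assoc)
qed (simp add: assms)

lemma step_functions_map:
  assumes "f \<in> step_functions" "h 0 = 0" "\<And>x y. h (x + y) = h x + h y"
  shows "(\<lambda>\<tau>. h (f \<tau>)) \<in> step_functions"
  using assms(1)
proof (induction rule: step_functions_induct)
  case (add f a b x)
  have "(\<lambda>\<tau>. h (f \<tau> + piece {a..<b} x \<tau>)) = (\<lambda>\<tau>. h (f \<tau>) + piece {a..<b} (h x) \<tau>)"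
    using assms by (auto simp: piece_def fun_eq_iff)
  then show ?case
    using step_functions_add_piece[OF add.IH add.hyps(2,3)] by simp
qed (simp add: step_functions_zero assms)

lemma step_functions_scaleC: "f \<in> step_functions \<Longrightarrow> (\<lambda>\<tau>. c *\<^sub>C f \<tau>) \<in> step_functions"
  by (rule step_functions_map[where h = "scaleC c"]) (simp_all add: scaleC_add_right)

lemma step_functions_before:
  assumes "f \<in> step_functions" "0 \<le> t"
  shows "before t f \<in> step_functions"
  using assms(1)
proof (induction rule: step_functions_induct)
  case zero
  show ?case using step_functions_zero by (simp add: before_def)
next
  case (add f a b x)
  have "before t (\<lambda>\<tau>. f \<tau> + piece {a..<b} x \<tau>) =
      (\<lambda>\<tau>. before t f \<tau> + piece {min a t..<min b t} x \<tau>)"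
    by (auto simp: before_def piece_def fun_eq_iff)
  then show ?case
    using step_functions_add_piece[OF add.IH, of "min a t" "min b t"] add.hyps assms(2) by simp
qed

lemma step_functions_after:
  assumes "f \<in> step_functions"
  shows "after t f \<in> step_functions"
  using assms(1)
proof (induction rule: step_functions_induct)
  case zero
  show ?case using step_functions_zero by (simp add: after_def)
next
  case (add f a b x)
  have "after t (\<lambda>\<tau>. f \<tau> + piece {a..<b} x \<tau>) =
      (\<lambda>\<tau>. after t f \<tau> + piece {max a t..<max b t} x \<tau>)"
    by (auto simp: after_def piece_def fun_eq_iff)
  then show ?case
    using step_functions_add_piece[OF add.IH, of "max a t" "max b t"] add.hyps by simp
qed

lemma step_functions_finite_range:
  assumes "f \<in> step_functions"
  shows "finite (range f)"
  using assms
proof (induction rule: step_functions_induct)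
  case (add f a b x)
  have "range (\<lambda>\<tau>. f \<tau> + piece {a..<b} x \<tau>) \<subseteq> (\<lambda>(u, v). u + v) ` (range f \<times> {0, x})"
    by (auto simp: piece_def image_iff)
  moreover have "finite ((\<lambda>(u, v). u + v) ` (range f \<times> {0, x}))"
    using add.IH by simp
  ultimately show ?case by (rule finite_subset)
qed simp

text \<open>\<open>P\<close> collects the end points of the intervals. The test sets
  \<open>{u<..v}\<close> are open on the left and closed on the right because the pieces
  \<open>{a..<b}\<close> change their value at the end point itself: a jump at \<open>u\<close> has
  already happened, one at \<open>v\<close> counts. The last clause starts the backward induction
  over the jumps.\<close>

lemma step_functions_breakpoints:
  assumes "f \<in> step_functions"
  shows "\<exists>P. finite P \<and> (\<forall>u v. u \<le> v \<longrightarrow> P \<inter> {u<..v} = {} \<longrightarrow> f v = f u) \<and>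
    (\<forall>u. (\<forall>p\<in>P. p \<le> u) \<longrightarrow> f u = 0)"
  using assms
proof (induction rule: step_functions_induct)
  case (add f a b x)
  then obtain P where P: "finite P" "\<And>u v. u \<le> v \<Longrightarrow> P \<inter> {u<..v} = {} \<Longrightarrow> f v = f u"
    "\<And>u. (\<forall>p\<in>P. p \<le> u) \<Longrightarrow> f u = 0"
    by blast
  show ?case
  proof (intro exI[of _ "insert a (insert b P)"] conjI allI impI)
    show "finite (insert a (insert b P))" using P(1) by simp
  next
    fix u v assume uv: "u \<le> v" "insert a (insert b P) \<inter> {u<..v} = {}"
    then have "f v = f u" by (intro P(2)) auto
    moreover have "piece {a..<b} x v = piece {a..<b} x u"
      using uv by (auto simp: piece_def)
    ultimately show "f v + piece {a..<b} x v = f u + piece {a..<b} x u" by simp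
  next
    fix u assume "\<forall>p\<in>insert a (insert b P). p \<le> u"
    then show "f u + piece {a..<b} x u = 0" by (auto simp: P(3) piece_def)
  qed
qed (auto intro: exI[of _ "{}"])

section \<open>Density of the \<open>D\<close>-valued step functions in \<open>L2\<close>\<close>

lemma strongly_measurable_piece:
  assumes "A \<in> sets half_line"
  shows "strongly_measurable (piece A y)"
proof (rule strongly_measurable_simple)
  have "simple_function half_line (\<lambda>t. if t \<in> A then y else 0)"
    using assms by (intro simple_function_If_set) (auto simp: Int_absorb1 sets.sets_into_space)
  then show "simple_function half_line (piece A y)" by (simp add: piece_def)
qed

lemma bounded_half_line:
  assumes "A \<in> sets half_line" "A \<subseteq> {..<real N}"
  shows "emeasure half_line A < \<infinity>" "measure half_line A \<le> N"
proof -
  have "A \<subseteq> {0..}" using sets.sets_into_space[OF assms(1)] by simp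
  with assms(2) have sub: "A \<subseteq> {0..<real N}" by auto
  have *: "{0..<real N} \<in> sets half_line" by (auto simp: sets_restrict_space_iff)
  have eq: "emeasure half_line {0..<real N} = ennreal N"
    by (subst emeasure_restrict_space) (auto simp: emeasure_lborel_Ico)
  have le: "emeasure half_line A \<le> ennreal N"
    using emeasure_mono[OF sub *] eq by simp
  then show "emeasure half_line A < \<infinity>" by (simp add: le_less_trans)
  show "measure half_line A \<le> N"
    using le by (simp add: measure_def enn2real_leI)
qed

lemma L2_piece:
  assumes "A \<in> sets half_line" "emeasure half_line A < \<infinity>"
  shows "piece A y \<in> L2"
proof -
  have "integrable half_line (\<lambda>t. indicator A t *\<^sub>R (norm y)\<^sup>2)"
    using assms by (intro integrable_scaleR_left integrable_real_indicator) auto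
  also have "(\<lambda>t. indicator A t *\<^sub>R (norm y)\<^sup>2) = (\<lambda>t. (norm (piece A y t))\<^sup>2)"
    by (auto simp: piece_def indicator_def fun_eq_iff)
  finally show ?thesis
    using assms by (simp add: L2_iff strongly_measurable_piece)
qed

lemma L2_norm_sq_piece:
  assumes "A \<in> sets half_line" "emeasure half_line A < \<infinity>"
  shows "L2_norm_sq (piece A y) = measure half_line A * (norm y)\<^sup>2"
proof -
  have "L2_norm_sq (piece A y) = (LINT t|half_line. indicator A t *\<^sub>R (norm y)\<^sup>2)"
    unfolding L2_norm_sq_def
    by (rule Bochner_Integration.integral_cong) (auto simp: piece_def indicator_def)
  also have "\<dots> = measure half_line A * (norm y)\<^sup>2"
    using assms sets.sets_into_space[OF assms(1)]
    by (subst integral_scaleR_left) (auto intro: integrable_real_indicator simp: Int_absorb2)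
  finally show ?thesis .
qed

lemma L2_norm_sq_AE_cong:
  assumes "f \<in> L2" "g \<in> L2" "AE t in half_line. f t = g t"
  shows "L2_norm_sq f = L2_norm_sq g"
  unfolding L2_norm_sq_def
  using assms by (intro integral_cong_AE) (auto simp: L2_iff)

lemma completion_simps:
  assumes "is_completion \<iota>"
  shows "\<iota> (x + y) = \<iota> x + \<iota> y" "\<iota> (c *\<^sub>C x) = c *\<^sub>C \<iota> x" "\<iota> 0 = 0"
    "\<iota> (x - y) = \<iota> x - \<iota> y" "cinner (\<iota> x) (\<iota> y) = cinner x y" "norm (\<iota> x) = norm x"
proof -
  have lin: "clinear \<iota>" and iso: "\<And>x y. cinner (\<iota> x) (\<iota> y) = cinner x y"
    using assms by (auto simp: is_completion_def)
  show "\<iota> (x + y) = \<iota> x + \<iota> y" "\<iota> (c *\<^sub>C x) = c *\<^sub>C \<iota> x"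
    by (rule clinear_add[OF lin] clinear_scaleC[OF lin])+
  interpret Vector_Spaces.linear scaleC scaleC \<iota> by (rule lin)
  show "\<iota> 0 = 0" "\<iota> (x - y) = \<iota> x - \<iota> y" by (rule zero diff)+
  show "cinner (\<iota> x) (\<iota> y) = cinner x y" by (rule iso)
  have "complex_of_real ((norm (\<iota> x))\<^sup>2) = of_real ((norm x)\<^sup>2)"
    using iso[of x x] by (simp only: cinner_same)
  then have "(norm (\<iota> x))\<^sup>2 = (norm x)\<^sup>2" using of_real_eq_iff by blast
  then show "norm (\<iota> x) = norm x" by simp
qed

lemma Ico_half_line: "0 \<le> a \<Longrightarrow> {a..<b} \<in> sets half_line"
  by (auto simp: sets_restrict_space_iff)

lemma L2_piece_Ico:
  assumes "0 \<le> a"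
  shows "piece {a..<b} y \<in> L2"
proof -
  obtain N where "b \<le> real N" using real_arch_simple by blast
  then have "{a..<b} \<subseteq> {..<real N}" by auto
  then show ?thesis
    using bounded_half_line(1) Ico_half_line[OF assms] by (blast intro: L2_piece)
qed

lemma L2_step:
  assumes "is_completion \<iota>" "h \<in> step_functions"
  shows "(\<lambda>t. \<iota> (h t)) \<in> L2"
  using assms(2)
proof (induction rule: step_functions_induct)
  case zero
  then show ?case by (simp add: completion_simps[OF assms(1)] L2_zero)
next
  case (add f a b x)
  have "(\<lambda>t. \<iota> (f t + piece {a..<b} x t)) = (\<lambda>t. \<iota> (f t) + piece {a..<b} (\<iota> x) t)"
    by (auto simp: fun_eq_iff piece_def completion_simps[OF assms(1)])
  then show ?case using add by (simp add: L2_add L2_piece_Ico)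
qed

text \<open>Membership in \<open>L2\<close> is included so that the class is stable under sums,
  negation and dominated limits; it is then enlarged from intervals through Borel sets and simple
  functions to all of \<open>L2\<close>.\<close>

definition step_approx :: "('d::complex_inner \<Rightarrow> 'k::complex_hilbert) \<Rightarrow> (real \<Rightarrow> 'k) \<Rightarrow> bool"
  where "step_approx \<iota> f \<longleftrightarrow> f \<in> L2 \<and>
    (\<forall>e>0. \<exists>h\<in>step_functions. L2_norm_sq (\<lambda>t. f t - \<iota> (h t)) < e)"

lemma step_approx_step:
  assumes "is_completion \<iota>" "h \<in> step_functions"
  shows "step_approx \<iota> (\<lambda>t. \<iota> (h t))"
  using assms L2_step[OF assms] by (auto simp: step_approx_def L2_norm_sq_def intro!: bexI[of _ h])

lemma step_approx_add:
  assumes c: "is_completion \<iota>" and f: "step_approx \<iota> f" and g: "step_approx \<iota> g"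
  shows "step_approx \<iota> (\<lambda>t. f t + g t)"
  unfolding step_approx_def
proof (intro conjI allI impI)
  have fL: "f \<in> L2" and gL: "g \<in> L2" using f g by (auto simp: step_approx_def)
  show "(\<lambda>t. f t + g t) \<in> L2" by (rule L2_add[OF fL gL])
  fix e :: real assume "e > 0"
  then have "e / 4 > 0" by simp
  then obtain h k where h: "h \<in> step_functions" "L2_norm_sq (\<lambda>t. f t - \<iota> (h t)) < e / 4"
    and k: "k \<in> step_functions" "L2_norm_sq (\<lambda>t. g t - \<iota> (k t)) < e / 4"
    using f g unfolding step_approx_def by blast
  have "L2_norm_sq (\<lambda>t. (f t - \<iota> (h t)) + (g t - \<iota> (k t))) < e"
    using L2_norm_sq_add_le[OF L2_diff[OF fL L2_step[OF c h(1)]] L2_diff[OF gL L2_step[OF c k(1)]]]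
      h(2) k(2) by linarith
  moreover have "(\<lambda>t. (f t - \<iota> (h t)) + (g t - \<iota> (k t))) = (\<lambda>t. f t + g t - \<iota> (h t + k t))"
    by (simp add: completion_simps[OF c] algebra_simps)
  ultimately show "\<exists>h\<in>step_functions. L2_norm_sq (\<lambda>t. f t + g t - \<iota> (h t)) < e"
    using step_functions_add[OF h(1) k(1)] by (intro bexI[of _ "\<lambda>t. h t + k t"]) auto
qed

lemma step_approx_uminus:
  assumes c: "is_completion \<iota>" and f: "step_approx \<iota> f"
  shows "step_approx \<iota> (\<lambda>t. - f t)"
  unfolding step_approx_def
proof (intro conjI allI impI)
  show "(\<lambda>t. - f t) \<in> L2"
    using f L2_scaleC[of f "- 1"] by (simp add: step_approx_def uminus_scaleC[symmetric])
  fix e :: real assume "e > 0"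
  then obtain h where h: "h \<in> step_functions" "L2_norm_sq (\<lambda>t. f t - \<iota> (h t)) < e"
    using f unfolding step_approx_def by blast
  have "norm (- f t - \<iota> ((- 1) *\<^sub>C h t)) = norm (f t - \<iota> (h t))" for t
    using norm_minus_commute[of "\<iota> (h t)" "f t"]
    by (simp only: completion_simps(2)[OF c]) (simp add: uminus_scaleC[symmetric])
  then show "\<exists>h\<in>step_functions. L2_norm_sq (\<lambda>t. - f t - \<iota> (h t)) < e"
    using h step_functions_scaleC[OF h(1), of "- 1"]
    by (intro bexI[of _ "\<lambda>t. (- 1) *\<^sub>C h t"]) (auto simp: L2_norm_sq_def)
qed

lemma step_approx_limit:
  assumes c: "is_completion \<iota>" and f: "f \<in> L2"
    and lim: "\<And>e. e > 0 \<Longrightarrow> \<exists>g. step_approx \<iota> g \<and> L2_norm_sq (\<lambda>t. f t - g t) < e"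
  shows "step_approx \<iota> f"
  unfolding step_approx_def
proof (intro conjI allI impI f)
  fix e :: real assume "e > 0"
  then have e4: "e / 4 > 0" by simp
  obtain g where g: "step_approx \<iota> g" "L2_norm_sq (\<lambda>t. f t - g t) < e / 4"
    using lim[OF e4] by blast
  then obtain h where h: "h \<in> step_functions" "L2_norm_sq (\<lambda>t. g t - \<iota> (h t)) < e / 4"
    using e4 unfolding step_approx_def by blast
  have gL: "g \<in> L2" using g by (simp add: step_approx_def)
  have "L2_norm_sq (\<lambda>t. (f t - g t) + (g t - \<iota> (h t))) < e"
    using L2_norm_sq_add_le[OF L2_diff[OF f gL] L2_diff[OF gL L2_step[OF c h(1)]]] g(2) h(2)
    by linarith
  then show "\<exists>h\<in>step_functions. L2_norm_sq (\<lambda>t. f t - \<iota> (h t)) < e"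
    using h(1) by auto
qed

lemma step_approx_AE:
  assumes c: "is_completion \<iota>" and f: "f \<in> L2" and g: "step_approx \<iota> g"
    and ae: "AE t in half_line. f t = g t"
  shows "step_approx \<iota> f"
proof (rule step_approx_limit[OF c f])
  fix e :: real assume "e > 0"
  have gL: "g \<in> L2" using g by (simp add: step_approx_def)
  have "L2_norm_sq (\<lambda>t. f t - g t) = L2_norm_sq (\<lambda>t. 0 :: 'b)"
    using ae by (intro L2_norm_sq_AE_cong L2_diff f gL L2_zero) (auto elim: eventually_mono)
  then show "\<exists>g. step_approx \<iota> g \<and> L2_norm_sq (\<lambda>t. f t - g t) < e"
    using g \<open>e > 0\<close> by (intro exI[of _ g]) (simp add: L2_norm_sq_def)
qed

lemma step_approx_dominated:
  assumes c: "is_completion \<iota>" and f: "f \<in> L2" and g: "g \<in> L2"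
    and u: "\<And>n :: nat. step_approx \<iota> (u n)"
    and lim: "AE t in half_line. (\<lambda>n. u n t) \<longlonglongrightarrow> f t"
    and le: "\<And>n t. norm (u n t) \<le> norm (g t)"
  shows "step_approx \<iota> f"
proof (rule step_approx_limit[OF c f])
  fix e :: real assume "e > 0"
  have uL: "u n \<in> L2" for n using u by (simp add: step_approx_def)
  have dL: "(\<lambda>t. f t - u n t) \<in> L2" for n by (intro L2_diff f uL)
  have "(\<lambda>n. LINT t|half_line. (norm (f t - u n t))\<^sup>2) \<longlonglongrightarrow> (LINT t|half_line. (0::real))"
  proof (rule integral_dominated_convergence)
    show "integrable half_line (\<lambda>t. 2 * (norm (f t))\<^sup>2 + 2 * (norm (g t))\<^sup>2)"
      using f g by (auto simp: L2_iff)
    show "(\<lambda>t. (norm (f t - u n t))\<^sup>2) \<in> borel_measurable half_line" for n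
      using dL by (auto simp: L2_iff)
    show "AE t in half_line. (\<lambda>n. (norm (f t - u n t))\<^sup>2) \<longlonglongrightarrow> 0"
      using lim
    proof eventually_elim
      case (elim t)
      have "(\<lambda>n. (norm (f t - u n t))\<^sup>2) \<longlonglongrightarrow> (norm (f t - f t))\<^sup>2"
        by (intro tendsto_intros elim)
      then show ?case by simp
    qed
    show "AE t in half_line. norm ((norm (f t - u n t))\<^sup>2) \<le> 2 * (norm (f t))\<^sup>2 + 2 * (norm (g t))\<^sup>2" for n
    proof (rule AE_I2)
      fix t
      have "(norm (u n t))\<^sup>2 \<le> (norm (g t))\<^sup>2" by (rule power_mono[OF le norm_ge_zero])
      then show "norm ((norm (f t - u n t))\<^sup>2) \<le> 2 * (norm (f t))\<^sup>2 + 2 * (norm (g t))\<^sup>2"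
        using norm_add_square_le[of "f t" "- u n t"]
        unfolding real_norm_def abs_power2 norm_minus_cancel diff_conv_add_uminus by linarith
    qed
  qed simp
  then have "(\<lambda>n. L2_norm_sq (\<lambda>t. f t - u n t)) \<longlonglongrightarrow> 0"
    by (simp add: L2_norm_sq_def)
  then have "\<forall>\<^sub>F n in sequentially. L2_norm_sq (\<lambda>t. f t - u n t) < e"
    using \<open>e > 0\<close> by (rule order_tendstoD)
  then obtain n where "L2_norm_sq (\<lambda>t. f t - u n t) < e"
    by (auto simp: eventually_sequentially)
  then show "\<exists>g. step_approx \<iota> g \<and> L2_norm_sq (\<lambda>t. f t - g t) < e"
    using u by blast
qed

lemma step_approx_zero: "is_completion \<iota> \<Longrightarrow> step_approx \<iota> (\<lambda>t. 0)"
  using step_approx_step[OF _ step_functions_zero, of \<iota>] by (simp add: completion_simps)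

lemma step_approx_sum:
  assumes c: "is_completion \<iota>" and "\<And>i. i \<in> I \<Longrightarrow> step_approx \<iota> (u i)"
  shows "step_approx \<iota> (\<lambda>t. \<Sum>i\<in>I. u i t)"
  using assms(2)
proof (induction I rule: infinite_finite_induct)
  case (insert i I)
  then show ?case by (simp add: step_approx_add[OF c])
qed (simp_all add: step_approx_zero[OF c])

text \<open>This is Dynkin's argument over the half-open intervals, which are stable under
  intersection and generate the Borel sets. Cutting with \<open>{0..<real N}\<close> keeps
  complements and countable unions square-integrable.\<close>

lemma step_approx_borel_piece:
  assumes c: "is_completion \<iota>" and A: "A \<in> sets borel"
  shows "step_approx \<iota> (piece (A \<inter> {0..<real N}) (\<iota> d))"
proof -
  let ?I = "{0..<real N}" and ?G = "range (\<lambda>(a, b). {a ..< b :: real})"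
  have A': "A \<in> sigma_sets UNIV ?G"
    using A by (simp add: borel_eq_atLeastLessThan)
  have meas: "X \<inter> ?I \<in> sets half_line" if "X \<in> sigma_sets UNIV ?G" for X
  proof -
    have "X \<in> sets borel" using that by (simp add: borel_eq_atLeastLessThan)
    then have "X \<inter> ?I \<in> sets lebesgue" by auto
    then show ?thesis by (auto simp: sets_restrict_space_iff)
  qed
  have L2p: "piece (X \<inter> ?I) (\<iota> d) \<in> L2" if "X \<in> sigma_sets UNIV ?G" for X
    using meas[OF that] by (intro L2_piece bounded_half_line(1)[of _ N]) auto
  have "Int_stable ?G"
    by (auto simp: Int_stable_def)
  then show ?thesis
    using subset_UNIV[of ?G, folded Pow_UNIV] A'
  proof (induction rule: sigma_sets_induct_disjoint)
    case (basic X)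
    then obtain a b where X: "X = {a..<b}" by auto
    define a' where "a' = max a 0"
    \<comment> \<open>Taking the maximum with \<open>a'\<close> turns an empty intersection into an
      empty interval with ordered end points, as \<open>step_functions\<close> requires.\<close>
    define b' where "b' = max a' (min b N)"
    have "(\<lambda>t. \<iota> (piece {a'..<b'} d t)) = piece (X \<inter> ?I) (\<iota> d)"
      by (auto simp: piece_def X a'_def b'_def completion_simps[OF c] fun_eq_iff)
    moreover have "piece {a'..<b'} d \<in> step_functions"
      by (intro step_functions_piece) (auto simp: a'_def b'_def)
    ultimately show ?case using step_approx_step[OF c] by metis
  next
    case empty
    show ?case using step_approx_zero[OF c] by (simp add: piece_def)
  next
    case (compl X)
    have "(\<lambda>t. \<iota> (piece ?I d t)) = piece ?I (\<iota> d)"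
      by (auto simp: piece_def completion_simps[OF c])
    then have "step_approx \<iota> (piece ?I (\<iota> d))"
      using step_approx_step[OF c step_functions_piece[of 0 "real N" d]] by simp
    from step_approx_add[OF c this step_approx_uminus[OF c compl.IH]]
    have "step_approx \<iota> (\<lambda>t. piece ?I (\<iota> d) t + - piece (X \<inter> ?I) (\<iota> d) t)" .
    moreover have "(\<lambda>t. piece ?I (\<iota> d) t + - piece (X \<inter> ?I) (\<iota> d) t) = piece ((UNIV - X) \<inter> ?I) (\<iota> d)"
      by (auto simp: piece_def fun_eq_iff)
    ultimately show ?case by simp
  next
    case (union X)
    show ?case
    proof (rule step_approx_dominated[OF c])
      show "step_approx \<iota> (\<lambda>t. \<Sum>i<n. piece (X i \<inter> ?I) (\<iota> d) t)" for n
        using union.IH by (intro step_approx_sum[OF c])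
      show "piece (\<Union> (range X) \<inter> ?I) (\<iota> d) \<in> L2"
        using union.hyps(2) by (intro L2p sigma_sets.Union) auto
      then show "piece (\<Union> (range X) \<inter> ?I) (\<iota> d) \<in> L2" .
      have sum: "(\<Sum>i<n. piece (X i \<inter> ?I) (\<iota> d) t) = piece ((\<Union>i<n. X i) \<inter> ?I) (\<iota> d) t" for n t
      proof (induction n)
        case (Suc n)
        have "X n \<inter> X i = {}" if "i < n" for i
          using union.hyps(1) that by (simp add: disjoint_family_on_def)
        then have "X n \<inter> (\<Union>i<n. X i) = {}" by blast
        with Suc show ?case by (auto simp: piece_def lessThan_Suc)
      qed (simp add: piece_def)
      show "norm (\<Sum>i<n. piece (X i \<inter> ?I) (\<iota> d) t) \<le> norm (piece (\<Union> (range X) \<inter> ?I) (\<iota> d) t)" for n t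
        unfolding sum by (auto simp: piece_def)
      show "AE t in half_line. (\<lambda>n. \<Sum>i<n. piece (X i \<inter> ?I) (\<iota> d) t) \<longlonglongrightarrow>
          piece (\<Union> (range X) \<inter> ?I) (\<iota> d) t"
      proof (rule AE_I2)
        fix t
        show "(\<lambda>n. \<Sum>i<n. piece (X i \<inter> ?I) (\<iota> d) t) \<longlonglongrightarrow> piece (\<Union> (range X) \<inter> ?I) (\<iota> d) t"
        proof (cases "\<exists>i. t \<in> X i")
          case True
          then obtain i where i: "t \<in> X i" by blast
          have "\<forall>n\<ge>Suc i. piece ((\<Union>i<n. X i) \<inter> ?I) (\<iota> d) t = piece (\<Union> (range X) \<inter> ?I) (\<iota> d) t"
            using i by (auto simp: piece_def Suc_le_eq)
          then show ?thesis
            unfolding sum by (intro tendsto_eventually) (auto simp: eventually_sequentially)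
        qed (auto simp: sum piece_def)
      qed
    qed
  qed
qed

text \<open>A Lebesgue set is a Borel set up to a null set, and null sets are invisible to
  approximation in \<open>L2\<close>.\<close>

lemma step_approx_piece_image:
  assumes c: "is_completion \<iota>" and A: "A \<in> sets half_line" "A \<subseteq> {..<real N}"
  shows "step_approx \<iota> (piece A (\<iota> d))"
proof -
  have "A \<in> sets lebesgue" "A \<subseteq> {0..}"
    using A(1) sets.sets_into_space[OF A(1)] by (auto simp: sets_restrict_space_iff)
  then obtain S Z Z' where *: "A = S \<union> Z" "Z \<subseteq> Z'" "Z' \<in> null_sets lborel" "S \<in> sets lborel"
    by (auto elim: sets_completionE)
  have "Z' \<in> null_sets lebesgue" using *(3) by (rule null_sets_completionI)
  then have "AE t in lebesgue. t \<notin> Z'" by (rule AE_not_in)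
  then have "AE t in half_line. t \<notin> Z'"
    by (subst AE_restrict_space_iff) (auto elim: eventually_mono)
  then have "AE t in half_line. piece A (\<iota> d) t = piece (S \<inter> {0..<real N}) (\<iota> d) t"
  proof eventually_elim
    case (elim t)
    then show ?case using \<open>A \<subseteq> {0..}\<close> A(2) *(1,2) by (auto simp: piece_def)
  qed
  moreover have "step_approx \<iota> (piece (S \<inter> {0..<real N}) (\<iota> d))"
    using *(4) by (intro step_approx_borel_piece[OF c]) simp
  moreover have "piece A (\<iota> d) \<in> L2"
    by (rule L2_piece[OF A(1) bounded_half_line(1)[OF A]])
  ultimately show ?thesis using step_approx_AE[OF c] by blast
qed

lemma step_approx_piece:
  assumes c: "is_completion \<iota>" and A: "A \<in> sets half_line" "A \<subseteq> {..<real N}"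
  shows "step_approx \<iota> (piece A y)"
proof (rule step_approx_limit[OF c])
  show "piece A y \<in> L2" using A bounded_half_line(1) by (blast intro: L2_piece)
  fix e :: real assume e: "e > 0"
  \<comment> \<open>Replacing \<open>y\<close> by \<open>\<iota> d\<close> at distance less than
    \<open>e'\<close> costs at most N e'^2 < e, because \<open>A\<close> has measure at most
    \<open>N\<close>; the added 1 covers N = 0.\<close>
  define e' where "e' = sqrt (e / (real N + 1))"
  have e': "e' > 0" "real N * e'\<^sup>2 < e" using e by (auto simp: e'_def field_simps)
  have "y \<in> closure (range \<iota>)" using c by (simp add: is_completion_def)
  then obtain d where d: "dist (\<iota> d) y < e'"
    using e' by (auto simp: closure_approachable)
  have "L2_norm_sq (\<lambda>t. piece A y t - piece A (\<iota> d) t) = L2_norm_sq (piece A (y - \<iota> d))"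
    by (rule arg_cong[of _ _ L2_norm_sq]) (auto simp: piece_def)
  also have "\<dots> \<le> real N * (norm (y - \<iota> d))\<^sup>2"
    using A bounded_half_line[OF A] by (simp add: L2_norm_sq_piece mult_right_mono)
  also have "\<dots> \<le> real N * e'\<^sup>2"
    using d by (intro mult_left_mono power_mono) (auto simp: dist_norm norm_minus_commute)
  finally show "\<exists>g. step_approx \<iota> g \<and> L2_norm_sq (\<lambda>t. piece A y t - g t) < e"
    using step_approx_piece_image[OF c A] e'(2) by (intro exI[of _ "piece A (\<iota> d)"]) auto
qed

lemma step_approx_simple:
  assumes c: "is_completion \<iota>" and s: "simple_function half_line s"
    and supp: "\<And>t. t \<notin> {..<real N} \<Longrightarrow> s t = 0"
  shows "step_approx \<iota> s"
proof -
  \<comment> \<open>The value 0 is left out: its level set is unbounded, while the other level sets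
    lie in the bounded support.\<close>
  let ?F = "s ` {0..} - {0}" and ?A = "\<lambda>y. s -` {y} \<inter> {0..}"
  have F: "finite ?F" using simple_functionD(1)[OF s] by simp
  have A: "?A y \<in> sets half_line" for y
    using simple_functionD(2)[OF s, of "{y}"] by simp
  have sub: "?A y \<subseteq> {..<real N}" if "y \<noteq> 0" for y
    using supp that by auto
  define r where "r t = (\<Sum>y\<in>?F. piece (?A y) y t)" for t
  have r: "step_approx \<iota> r"
  proof -
    have "step_approx \<iota> (\<lambda>t. \<Sum>y\<in>?F. piece (?A y) y t)"
      using A sub by (intro step_approx_sum[OF c] step_approx_piece[OF c, of _ N]) auto
    then show ?thesis by (simp add: r_def[abs_def])
  qed
  have eq: "r t = s t" if "t \<ge> 0" for t
  proof -
    have "r t = (\<Sum>y\<in>?F. if s t = y then y else 0)"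
      unfolding r_def using that by (intro sum.cong) (auto simp: piece_def)
    also have "\<dots> = s t" using F that by (simp add: sum.delta)
    finally show ?thesis .
  qed
  have ae: "AE t in half_line. s t = r t"
    by (intro AE_I2) (simp add: eq)
  have "integrable half_line (\<lambda>t. (norm (r t))\<^sup>2)"
    using r by (simp add: step_approx_def L2_iff)
  also have "integrable half_line (\<lambda>t. (norm (r t))\<^sup>2) \<longleftrightarrow> integrable half_line (\<lambda>t. (norm (s t))\<^sup>2)"
    by (rule Bochner_Integration.integrable_cong) (simp_all add: eq)
  finally have "s \<in> L2" using s by (simp add: L2_iff strongly_measurable_simple)
  then show ?thesis by (rule step_approx_AE[OF c _ r ae])
qed

theorem step_functions_dense_L2:
  assumes c: "is_completion \<iota>" and f: "f \<in> L2"
  shows "step_approx \<iota> f"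
proof -
  obtain s where s: "\<And>n. simple_function half_line (s n)" "AE t in half_line. (\<lambda>n. s n t) \<longlonglongrightarrow> f t"
    using f by (auto simp: L2_def)
  \<comment> \<open>The truncation makes the approximants dominated by 2 |f| and gives them bounded
    support. Convergence survives it: where \<open>f\<close> does not vanish, |s n t| < 2 |f t|
    eventually, and where \<open>f\<close> vanishes the truncated value is 0.\<close>
  let ?P = "\<lambda>n t. norm (s n t) \<le> 2 * norm (f t) \<and> t < real n"
  define u where "u n t = (if ?P n t then s n t else 0)" for n t
  have sf: "strongly_measurable f" using f by (simp add: L2_iff)
  have meas: "{t \<in> space half_line. ?P n t} \<in> sets half_line" for n
  proof -
    have [measurable]: "(\<lambda>t. norm (f t)) \<in> borel_measurable half_line"
      by (rule measurable_norm_strongly[OF sf])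
    have [measurable]: "(\<lambda>t. norm (s n t)) \<in> borel_measurable half_line"
      by (rule measurable_norm_strongly[OF strongly_measurable_simple[OF s(1)]])
    have [measurable]: "(\<lambda>t. t) \<in> borel_measurable half_line"
      using id_borel_measurable_lebesgue_on by (simp add: id_def)
    show ?thesis by measurable
  qed
  have u: "simple_function half_line (u n)" for n
    unfolding u_def using meas by (intro simple_function_If s(1)) auto
  show ?thesis
  proof (rule step_approx_dominated[OF c f])
    show "(\<lambda>t. 2 *\<^sub>C f t) \<in> L2" by (rule L2_scaleC[OF f])
    show "step_approx \<iota> (u n)" for n
      by (rule step_approx_simple[where N = n, OF c u]) (simp add: u_def)
    show "norm (u n t) \<le> norm (2 *\<^sub>C f t)" for n t
      by (simp add: u_def norm_scaleC)
    show "AE t in half_line. (\<lambda>n. u n t) \<longlonglongrightarrow> f t"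
      using s(2)
    proof eventually_elim
      case (elim t)
      show ?case
      proof (cases "f t = 0")
        case True
        then have "u n t = 0" for n by (simp add: u_def)
        with True show ?thesis by simp
      next
        case False
        then have "norm (f t) < 2 * norm (f t)" by simp
        with tendsto_norm[OF elim] have "\<forall>\<^sub>F n in sequentially. norm (s n t) < 2 * norm (f t)"
          by (rule order_tendstoD)
        moreover have "\<forall>\<^sub>F n in sequentially. t < real n"
          using filterlim_real_sequentially unfolding filterlim_at_top_dense by blast
        ultimately have "\<forall>\<^sub>F n in sequentially. u n t = s n t"
          by eventually_elim (simp add: u_def)
        with elim show ?thesis by (simp add: filterlim_cong)
      qed
    qed
  qed
qed

section \<open>Symmetric Fock space\<close>

locale L2_fock = symmetric_fock_space L2 L2_inner sp
  for sp :: "(real \<Rightarrow> 'k::complex_hilbert) list \<Rightarrow> 'h::complex_hilbert"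
begin

lemma sp_ext:
  assumes "\<And>hs. hs \<in> lists L2 \<Longrightarrow> cinner (sp hs) x = cinner (sp hs) y"
  shows "x = y"
  by (rule cinner_ext[OF sp_total]) (use assms in blast)

text \<open>Composition with the permutation \<open>p\<close> reindexes the sum in
  \<open>cinner_sp\<close>, so the inner products with a total family agree.\<close>

lemma sp_mset:
  assumes eq: "mset xs = mset ys" and ys: "ys \<in> lists L2"
  shows "sp xs = sp ys"
proof (rule sp_ext)
  fix hs assume hs: "hs \<in> lists (L2 :: (real \<Rightarrow> 'k) set)"
  obtain p where p: "p permutes {..<length ys}" "permute_list p ys = xs"
    using mset_eq_permutation[OF eq] by blast
  have xs: "xs \<in> lists L2" using ys mset_eq_setD[OF eq] by (simp add: lists_eq_set)
  have len: "length xs = length ys" using eq by (rule mset_eq_length)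
  have nth: "xs ! i = ys ! p i" if "i < length ys" for i
    using p that by (auto simp: permute_list_nth)
  show "cinner (sp hs) (sp xs) = cinner (sp hs) (sp ys)"
  proof (cases "length hs = length ys")
    case True
    let ?S = "{\<pi>. \<pi> permutes {..<length ys}}"
    have "(\<Sum>\<pi>\<in>?S. \<Prod>i<length ys. L2_inner (hs ! i) (ys ! \<pi> i)) =
        (\<Sum>\<pi>\<in>?S. \<Prod>i<length ys. L2_inner (hs ! i) (ys ! (p \<circ> \<pi>) i))"
      by (rule setum_permutations_compose_left[OF p(1)])
    also have "\<dots> = (\<Sum>\<pi>\<in>?S. \<Prod>i<length ys. L2_inner (hs ! i) (xs ! \<pi> i))"
    proof (intro sum.cong prod.cong refl)
      fix \<pi> i assume "\<pi> \<in> ?S" "i \<in> {..<length ys}"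
      then have "\<pi> i < length ys" using permutes_in_image[of \<pi> "{..<length ys}" i] by simp
      then show "L2_inner (hs ! i) (ys ! (p \<circ> \<pi>) i) = L2_inner (hs ! i) (xs ! \<pi> i)"
        by (simp add: nth)
    qed
    finally show ?thesis
      using True len by (simp add: cinner_sp[OF hs xs] cinner_sp[OF hs ys])
  qed (simp add: cinner_sp[OF hs xs] cinner_sp[OF hs ys] len)
qed

lemma sp_head_linear:
  assumes f: "f \<in> L2" and g: "g \<in> L2" and fs: "fs \<in> lists L2"
  shows "sp ((\<lambda>t. f t + c *\<^sub>C g t) # fs) = sp (f # fs) + c *\<^sub>C sp (g # fs)"
proof (rule sp_ext)
  fix hs assume hs: "hs \<in> lists (L2 :: (real \<Rightarrow> 'k) set)"
  let ?fg = "\<lambda>t. f t + c *\<^sub>C g t"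
  have fg: "?fg \<in> L2" by (intro L2_add f L2_scaleC g)
  have l: "x # fs \<in> lists L2" if "x \<in> L2" for x using that fs by simp
  show "cinner (sp hs) (sp (?fg # fs)) = cinner (sp hs) (sp (f # fs) + c *\<^sub>C sp (g # fs))"
  proof (cases "length hs = Suc (length fs)")
    case True
    define n where "n = Suc (length fs)"
    let ?n = n
    have lin: "(\<Prod>i<?n. L2_inner (hs ! i) ((?fg # fs) ! \<pi> i)) =
        (\<Prod>i<?n. L2_inner (hs ! i) ((f # fs) ! \<pi> i)) + c * (\<Prod>i<?n. L2_inner (hs ! i) ((g # fs) ! \<pi> i))"
      if "\<pi> \<in> {\<pi>. \<pi> permutes {..<?n}}" for \<pi>
    proof -
      have \<pi>: "\<pi> permutes {..<?n}" using that by simp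
      \<comment> \<open>The head of the list is paired with \<open>hs ! k\<close>, where
        \<open>k\<close> is the position sent to 0 by \<open>\<pi>\<close>; all other factors are
        independent of the head, so every summand is linear in it.\<close>
      define k where "k = inv \<pi> 0"
      have k: "k \<in> {..<?n}" "\<pi> k = 0"
        using permutes_in_image[OF permutes_inv[OF \<pi>], of 0] permutes_inverses(1)[OF \<pi>]
        by (auto simp: k_def n_def)
      have hk: "hs ! k \<in> L2" using hs k True unfolding n_def by (metis in_lists_conv_set lessThan_iff nth_mem)
      define R where "R = (\<Prod>i\<in>{..<?n} - {k}. L2_inner (hs ! i) (fs ! (\<pi> i - 1)))"
      have split: "(\<Prod>i<?n. L2_inner (hs ! i) ((x # fs) ! \<pi> i)) = L2_inner (hs ! k) x * R" for x
      proof -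
        have "(\<Prod>i<?n. L2_inner (hs ! i) ((x # fs) ! \<pi> i)) =
            L2_inner (hs ! k) ((x # fs) ! \<pi> k) * (\<Prod>i\<in>{..<?n} - {k}. L2_inner (hs ! i) ((x # fs) ! \<pi> i))"
          by (rule prod.remove) (use k in auto)
        also have "(\<Prod>i\<in>{..<?n} - {k}. L2_inner (hs ! i) ((x # fs) ! \<pi> i)) = R"
          unfolding R_def
        proof (intro prod.cong refl)
          fix i assume "i \<in> {..<?n} - {k}"
          then have "\<pi> i \<noteq> 0" using k(2) permutes_inj[OF \<pi>] by (metis DiffD2 injD singletonI)
          then show "L2_inner (hs ! i) ((x # fs) ! \<pi> i) = L2_inner (hs ! i) (fs ! (\<pi> i - 1))"
            by (simp add: nth_Cons')
        qed
        finally show ?thesis by (simp add: k)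
      qed
      have "L2_inner (hs ! k) ?fg = L2_inner (hs ! k) f + c * L2_inner (hs ! k) g"
        by (simp add: L2_inner_add_right[OF hk f L2_scaleC[OF g]] L2_inner_scaleC_right)
      then show ?thesis unfolding split by (simp add: algebra_simps)
    qed
    have inner: "cinner (sp hs) (sp (x # fs)) =
        (\<Sum>\<pi> | \<pi> permutes {..<n}. \<Prod>i<n. L2_inner (hs ! i) ((x # fs) ! \<pi> i)) / fact n"
      if "x \<in> L2" for x
      using cinner_sp[OF hs l[OF that]] True by (simp only: n_def length_Cons if_True simp_thms)
    let ?S = "{\<pi>. \<pi> permutes {..<n}}"
    have "(\<Sum>\<pi>\<in>?S. \<Prod>i<n. L2_inner (hs ! i) ((?fg # fs) ! \<pi> i)) =
        (\<Sum>\<pi>\<in>?S. (\<Prod>i<n. L2_inner (hs ! i) ((f # fs) ! \<pi> i)) +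
          c * (\<Prod>i<n. L2_inner (hs ! i) ((g # fs) ! \<pi> i)))"
      by (intro sum.cong lin refl)
    then show ?thesis
      unfolding cinner_add_right cinner_scaleC_right inner[OF fg] inner[OF f] inner[OF g]
      by (simp add: add_divide_distrib sum.distrib sum_distrib_left[symmetric])
  qed (simp add: cinner_add_right cinner_scaleC_right cinner_sp[OF hs l] fg f g)
qed

text \<open>By Cauchy-Schwarz every permutation contributes at most the product of the squared
  norms, and the n! permutations cancel the normalisation.\<close>

lemma norm_sp_le:
  assumes fs: "fs \<in> lists L2"
  shows "(norm (sp fs))\<^sup>2 \<le> (\<Prod>f\<leftarrow>fs. L2_norm_sq f)"
proof -
  let ?n = "length fs" and ?S = "{\<pi>. \<pi> permutes {..<length fs}}"
  let ?N = "\<lambda>i. L2_norm_sq (fs ! i)"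
  have mem: "fs ! i \<in> L2" if "i < ?n" for i using fs that by (metis in_lists_conv_set nth_mem)
  have "norm (\<Prod>i<?n. L2_inner (fs ! i) (fs ! \<pi> i)) \<le> (\<Prod>i<?n. ?N i)" if \<pi>: "\<pi> \<in> ?S" for \<pi>
  proof -
    have \<pi>: "\<pi> permutes {..<?n}" using \<pi> by simp
    have "norm (\<Prod>i<?n. L2_inner (fs ! i) (fs ! \<pi> i)) \<le> (\<Prod>i<?n. sqrt (?N i) * sqrt (?N (\<pi> i)))"
      unfolding prod_norm[symmetric]
    proof (rule prod_mono)
      fix i assume i: "i \<in> {..<?n}"
      then have "\<pi> i < ?n" using permutes_in_image[OF \<pi>] by blast
      with i show "0 \<le> norm (L2_inner (fs ! i) (fs ! \<pi> i)) \<and>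
          norm (L2_inner (fs ! i) (fs ! \<pi> i)) \<le> sqrt (?N i) * sqrt (?N (\<pi> i))"
        by (simp add: norm_L2_inner_le mem)
    qed
    also have "\<dots> = (\<Prod>i<?n. sqrt (?N i)) * (\<Prod>i<?n. sqrt (?N (\<pi> i)))"
      by (rule prod.distrib)
    also have "(\<Prod>i<?n. sqrt (?N (\<pi> i))) = (\<Prod>i<?n. sqrt (?N i))"
      using prod.permute[OF \<pi>, of "\<lambda>i. sqrt (?N i)"] by (simp add: comp_def)
    also have "(\<Prod>i<?n. sqrt (?N i)) * (\<Prod>i<?n. sqrt (?N i)) = (\<Prod>i<?n. ?N i)"
      by (simp add: prod.distrib[symmetric] L2_norm_sq_nonneg)
    finally show ?thesis .
  qed
  then have "norm (\<Sum>\<pi>\<in>?S. \<Prod>i<?n. L2_inner (fs ! i) (fs ! \<pi> i)) \<le> (\<Sum>\<pi>\<in>?S. \<Prod>i<?n. ?N i)"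
    by (rule sum_norm_le)
  also have "\<dots> = fact ?n * (\<Prod>i<?n. ?N i)"
    using card_permutations[of "{..<?n}" ?n] by simp
  finally have "norm (\<Sum>\<pi>\<in>?S. \<Prod>i<?n. L2_inner (fs ! i) (fs ! \<pi> i)) / fact ?n \<le> (\<Prod>i<?n. ?N i)"
    by (simp add: divide_le_eq mult.commute)
  then have "norm (cinner (sp fs) (sp fs)) \<le> (\<Prod>i<?n. ?N i)"
    by (simp add: cinner_sp[OF fs fs] norm_divide norm_fact)
  then have "(norm (sp fs))\<^sup>2 \<le> (\<Prod>i<?n. ?N i)"
    by (simp add: cinner_same norm_power)
  also have "\<dots> = (\<Prod>f\<leftarrow>fs. L2_norm_sq f)"
    by (simp add: prod.list_conv_set_nth atLeast0LessThan)
  finally show ?thesis .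
qed

lemma cinner_sp_replicate:
  assumes "f \<in> L2" "g \<in> L2"
  shows "cinner (sp (replicate m f)) (sp (replicate n g)) = (if m = n then L2_inner f g ^ n else 0)"
proof -
  have "(\<Sum>\<pi> | \<pi> permutes {..<n}. \<Prod>i<n. L2_inner (replicate n f ! i) (replicate n g ! \<pi> i)) =
      (\<Sum>\<pi> | \<pi> permutes {..<n}. L2_inner f g ^ n)"
  proof (rule sum.cong[OF refl])
    fix \<pi> assume "\<pi> \<in> {\<pi>. \<pi> permutes {..<n}}"
    then have "\<pi> i < n" if "i < n" for i using that permutes_in_image[of \<pi> "{..<n}" i] by simp
    then have "(\<Prod>i<n. L2_inner (replicate n f ! i) (replicate n g ! \<pi> i)) = (\<Prod>i<n. L2_inner f g)"
      by (intro prod.cong) auto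
    then show "(\<Prod>i<n. L2_inner (replicate n f ! i) (replicate n g ! \<pi> i)) = L2_inner f g ^ n" by simp
  qed
  also have "\<dots> = fact n * L2_inner f g ^ n"
    using card_permutations[of "{..<n}" n] by simp
  finally show ?thesis
    using assms by (subst cinner_sp) (auto simp: in_lists_conv_set)
qed

lemma norm_sp_replicate:
  assumes "f \<in> L2"
  shows "(norm (sp (replicate n f)))\<^sup>2 = L2_norm_sq f ^ n"
proof -
  have "complex_of_real ((norm (sp (replicate n f)))\<^sup>2) = of_real (L2_norm_sq f ^ n)"
    using cinner_sp_replicate[OF assms assms, of n n] by (simp add: cinner_same L2_inner_same)
  then show ?thesis using of_real_eq_iff by blast
qed

lemma summable_norm_exp_vector:
  assumes f: "f \<in> L2"
  shows "summable (\<lambda>n. norm ((1 / sqrt (fact n)) *\<^sub>R sp (replicate n f)))"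
proof (rule summable_comparison_test)
  let ?N = "L2_norm_sq f"
  show "summable (\<lambda>n. ((2 * ?N) ^ n /\<^sub>R fact n + (1 / 2) ^ n) / 2)"
    by (intro summable_divide summable_add summable_exp_generic summable_geometric) simp
  have "norm ((1 / sqrt (fact n)) *\<^sub>R sp (replicate n f)) \<le> ((2 * ?N) ^ n /\<^sub>R fact n + (1 / 2) ^ n) / 2" for n
  proof -
    \<comment> \<open>The squared norm N^n / n! is split as (2 N)^n / n! times (1/2)^n, both
      summable; the inequality between geometric and arithmetic mean then bounds its square root by
      a summable term.\<close>
    define u where "u = sqrt ((2 * ?N) ^ n / fact n)"
    define v where "v = sqrt ((1 / 2) ^ n)"
    have ns: "norm (sp (replicate n f)) = sqrt (?N ^ n)"
      using norm_sp_replicate[OF f, of n] by (metis norm_ge_zero real_sqrt_abs abs_of_nonneg)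
    have "(2 * ?N) ^ n / fact n * (1 / 2) ^ n = ?N ^ n / fact n"
      by (simp add: power_mult_distrib power_divide)
    then have "norm ((1 / sqrt (fact n)) *\<^sub>R sp (replicate n f)) = u * v"
      by (simp add: u_def v_def ns real_sqrt_mult[symmetric] real_sqrt_divide[symmetric])
    also have "\<dots> \<le> (u\<^sup>2 + v\<^sup>2) / 2" using sum_squares_bound[of u v] by simp
    also have "u\<^sup>2 = (2 * ?N) ^ n / fact n" unfolding u_def by (simp add: L2_norm_sq_nonneg)
    also have "v\<^sup>2 = (1 / 2) ^ n" unfolding v_def by simp
    finally show ?thesis by (simp only: divide_inverse real_scaleR_def mult_ac)
  qed
  then show "\<exists>M. \<forall>n\<ge>M. norm (norm ((1 / sqrt (fact n)) *\<^sub>R sp (replicate n f)))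
      \<le> ((2 * ?N) ^ n /\<^sub>R fact n + (1 / 2) ^ n) / 2"
    by simp
qed

lemma exp_vector_sums:
  "f \<in> L2 \<Longrightarrow> (\<lambda>n. (1 / sqrt (fact n)) *\<^sub>R sp (replicate n f)) sums exp_vector sp f"
  unfolding exp_vector_def
  by (rule summable_sums[OF summable_norm_cancel[OF summable_norm_exp_vector]])

lemma cinner_exp_vector:
  assumes f: "f \<in> L2" and g: "g \<in> L2"
  shows "cinner (exp_vector sp f) (exp_vector sp g) = exp (L2_inner f g)"
proof -
  let ?a = "\<lambda>f n. (1 / sqrt (fact n)) *\<^sub>R sp (replicate n f)"
  have "cinner (?a f n) (exp_vector sp g) = L2_inner f g ^ n /\<^sub>R fact n" for n
  proof -
    have *: "cinner (?a f n) (?a g m) = (if m = n then L2_inner f g ^ n /\<^sub>R fact n else 0)" for m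
    proof -
      have "cinner (?a f n) (?a g n) = (1 / sqrt (fact n) * (1 / sqrt (fact n))) *\<^sub>R L2_inner f g ^ n"
        by (simp only: cinner_scaleR_left cinner_scaleR_right cinner_sp_replicate[OF f g] if_True simp_thms scaleR_scaleR)
      also have "1 / sqrt (fact n) * (1 / sqrt (fact n)) = inverse (fact n :: real)"
        by (simp add: inverse_eq_divide)
      finally show ?thesis
        by (simp add: cinner_scaleR_left cinner_scaleR_right cinner_sp_replicate[OF f g])
    qed
    have "(\<lambda>m. cinner (?a f n) (?a g m)) sums cinner (?a f n) (exp_vector sp g)"
      by (rule bounded_linear.sums[OF bounded_bilinear.bounded_linear_right[OF bounded_bilinear_cinner]
            exp_vector_sums[OF g]])
    moreover have "(\<lambda>m. cinner (?a f n) (?a g m)) sums (L2_inner f g ^ n /\<^sub>R fact n)"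
      unfolding * by (rule sums_single)
    ultimately show ?thesis by (rule sums_unique2)
  qed
  then have "(\<lambda>n. L2_inner f g ^ n /\<^sub>R fact n) sums cinner (exp_vector sp f) (exp_vector sp g)"
    using bounded_linear.sums[OF bounded_bilinear.bounded_linear_left[OF bounded_bilinear_cinner]
        exp_vector_sums[OF f], of "exp_vector sp g"] by simp
  then show ?thesis using exp_converges sums_unique2 by blast
qed

end

text \<open>A substitute for differentiating at 0: once the lower coefficients are known to lie in
  \<open>M\<close>, subtracting them and dividing by \<open>z ^ n\<close> leaves \<open>R z\<close>
  in \<open>M\<close>, and \<open>R z\<close> tends to \<open>a n\<close> as \<open>z\<close> tends
  to 0.\<close>

lemma closed_subspace_powser_coeff:
  fixes a :: "nat \<Rightarrow> 'h::complex_hilbert"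
  assumes M: "csubspace M" "closed M" and sum: "summable (\<lambda>n. norm (a n))"
    and mem: "\<And>z :: real. 0 < z \<Longrightarrow> z \<le> 1 \<Longrightarrow> (\<Sum>n. z ^ n *\<^sub>R a n) \<in> M"
  shows "a n \<in> M"
proof (induction n rule: less_induct)
  case (less n)
  have summ: "summable (\<lambda>k. z ^ k *\<^sub>R a (k + m))" if "0 \<le> z" "z \<le> 1" for z :: real and m
  proof (rule summable_norm_cancel, rule summable_comparison_test)
    show "summable (\<lambda>k. norm (a (k + m)))" using sum by (subst summable_iff_shift)
    show "\<exists>N. \<forall>k\<ge>N. norm (norm (z ^ k *\<^sub>R a (k + m))) \<le> norm (a (k + m))"
      using that by (auto simp: power_le_one mult_left_le_one_le)
  qed
  define C where "C = (\<Sum>k. norm (a (k + Suc n)))"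
  define R where "R z = (\<Sum>k. z ^ k *\<^sub>R a (k + n))" for z :: real
  have "R z \<in> M" if z: "0 < z" "z \<le> 1" for z
  proof -
    have sz: "summable (\<lambda>k. z ^ k *\<^sub>R a k)" using summ[of z 0] z by simp
    have "(\<Sum>k. z ^ k *\<^sub>R a k) = (\<Sum>k. z ^ (k + n) *\<^sub>R a (k + n)) + (\<Sum>k<n. z ^ k *\<^sub>R a k)"
      by (rule suminf_split_initial_segment[OF sz])
    also have "(\<Sum>k. z ^ (k + n) *\<^sub>R a (k + n)) = (\<Sum>k. z ^ n *\<^sub>R (z ^ k *\<^sub>R a (k + n)))"
      by (simp add: power_add mult.commute)
    also have "\<dots> = z ^ n *\<^sub>R R z"
      unfolding R_def using summ[of z n] z
      by (intro bounded_linear.suminf[OF bounded_linear_scaleR_right, symmetric]) auto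
    finally have "z ^ n *\<^sub>R R z = (\<Sum>k. z ^ k *\<^sub>R a k) - (\<Sum>k<n. z ^ k *\<^sub>R a k)" by simp
    also have "\<dots> \<in> M"
      using mem[OF z] less by (intro complex_vector.subspace_diff[OF M(1)] complex_vector.subspace_sum[OF M(1)])
        (auto simp: scaleR_scaleC intro: complex_vector.subspace_scale[OF M(1)])
    finally have "of_real (inverse (z ^ n)) *\<^sub>C (z ^ n *\<^sub>R R z) \<in> M"
      by (rule complex_vector.subspace_scale[OF M(1)])
    moreover have "of_real (inverse (z ^ n)) *\<^sub>C (z ^ n *\<^sub>R R z) = R z"
      using z by (simp only: scaleR_scaleC[symmetric]) simp
    ultimately show ?thesis by simp
  qed
  moreover have "norm (R z - a n) \<le> z * C" if z: "0 < z" "z \<le> 1" for z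
  proof -
    have s1: "summable (\<lambda>k. z ^ k *\<^sub>R a (k + n))" using summ[of z n] z by simp
    have s2: "summable (\<lambda>k. norm (a (k + Suc n)))"
      using sum by (subst summable_iff_shift)
    have le: "norm (z ^ k *\<^sub>R a (k + Suc n)) \<le> norm (a (k + Suc n))" for k
      using z by (auto simp: power_le_one mult_left_le_one_le)
    have s3: "summable (\<lambda>k. norm (z ^ k *\<^sub>R a (k + Suc n)))"
      by (rule summable_comparison_test'[OF s2, of 0]) (use le in simp)
    have "R z - a n = (\<Sum>k. z ^ Suc k *\<^sub>R a (Suc k + n))"
      unfolding R_def using suminf_split_head[OF s1] by simp
    also have "\<dots> = z *\<^sub>R (\<Sum>k. z ^ k *\<^sub>R a (k + Suc n))"
      using summ[of z "Suc n"] z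
      by (subst bounded_linear.suminf[OF bounded_linear_scaleR_right]) auto
    also have "norm \<dots> = z * norm (\<Sum>k. z ^ k *\<^sub>R a (k + Suc n))"
      using z by simp
    also have "\<dots> \<le> z * (\<Sum>k. norm (z ^ k *\<^sub>R a (k + Suc n)))"
      using z by (intro mult_left_mono summable_norm s3) auto
    also have "\<dots> \<le> z * C"
      unfolding C_def using z by (intro mult_left_mono suminf_le le s2 s3) auto
    finally show ?thesis .
  qed
  ultimately have *: "\<forall>m. R (inverse (real (Suc m))) \<in> M"
    "\<forall>m. norm (R (inverse (real (Suc m))) - a n) \<le> inverse (real (Suc m)) * C"
    by (auto simp: inverse_le_1_iff)
  have "(\<lambda>m. R (inverse (real (Suc m))) - a n) \<longlonglongrightarrow> 0"
  proof (rule Lim_null_comparison)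
    show "\<forall>\<^sub>F m in sequentially. norm (R (inverse (real (Suc m))) - a n) \<le> inverse (real (Suc m)) * C"
      using *(2) by simp
    show "(\<lambda>m. inverse (real (Suc m)) * C) \<longlonglongrightarrow> 0"
      using tendsto_mult_right[OF LIMSEQ_inverse_real_of_nat, of C] by simp
  qed
  then have lim: "(\<lambda>m. R (inverse (real (Suc m)))) \<longlonglongrightarrow> a n"
    by (simp add: LIM_zero_iff)
  show ?case
    by (rule closed_sequentially[OF M(2) _ lim]) (use *(1) in blast)
qed

context L2_fock
begin

text \<open>The trailing list \<open>gs\<close> collects the entries whose scalar has already been
  pulled out; by symmetry they can be moved there, which exposes the next entry at the head.\<close>

lemma sp_replicate_scale:
  assumes f: "f \<in> L2" and gs: "gs \<in> lists L2"
  shows "sp (replicate n (\<lambda>t. c *\<^sub>C f t) @ gs) = c ^ n *\<^sub>C sp (replicate n f @ gs)"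
  using gs
proof (induction n arbitrary: gs)
  case (Suc n)
  let ?cf = "\<lambda>t. c *\<^sub>C f t"
  have mem: "replicate m h @ gs \<in> lists L2" if "h \<in> L2" for m and h :: "real \<Rightarrow> 'k"
    using that Suc.prems by (auto simp: in_lists_conv_set)
  have zero: "sp ((\<lambda>t. 0) # fs) = 0" if "fs \<in> lists L2" for fs
    using sp_head_linear[OF L2_zero L2_zero that, of "- 1"]
    by (simp add: uminus_scaleC[symmetric])
  have "sp (?cf # (replicate n ?cf @ gs)) = c *\<^sub>C sp (f # (replicate n ?cf @ gs))"
    using sp_head_linear[OF L2_zero f mem[OF L2_scaleC[OF f]], of c n c] zero[OF mem[OF L2_scaleC[OF f]], of n c]
    by simp
  also have "sp (f # (replicate n ?cf @ gs)) = sp (replicate n ?cf @ (f # gs))"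
    using f Suc.prems L2_scaleC[OF f, of c] by (intro sp_mset) (auto simp: in_lists_conv_set)
  also have "\<dots> = c ^ n *\<^sub>C sp (replicate n f @ (f # gs))"
    using f Suc.prems by (intro Suc.IH) simp
  also have "replicate n f @ (f # gs) = replicate (Suc n) f @ gs"
    by (simp add: replicate_app_Cons_same)
  finally show ?case by (simp add: scaleC_scaleC)
qed (simp add: scaleC_one)

text \<open>This is the binomial expansion of the n-th symmetric power of g + z h, with its two
  lowest coefficients identified: the linear one carries the polarization, and the constant one is
  needed to compute it recursively.\<close>

lemma sp_replicate_expansion:
  assumes g: "g \<in> L2" and h: "h \<in> L2" and fs: "fs \<in> lists L2"
  shows "\<exists>a. (\<forall>k>n. a k = 0) \<and> a 0 = sp (replicate n g @ fs) \<and>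
    a 1 = real n *\<^sub>R sp (h # replicate (n - 1) g @ fs) \<and>
    (\<forall>z. sp (replicate n (\<lambda>t. g t + of_real z *\<^sub>C h t) @ fs) = (\<Sum>k\<le>n. z ^ k *\<^sub>R a k))"
  using fs
proof (induction n arbitrary: fs)
  case 0
  show ?case by (rule exI[of _ "\<lambda>k. if k = 0 then sp fs else 0"]) simp
next
  case (Suc n)
  have mem: "replicate m x @ fs' \<in> lists L2" if "x \<in> L2" "fs' \<in> lists L2" for m and x :: "real \<Rightarrow> 'k" and fs'
    using that by (auto simp: in_lists_conv_set)
  have gfs: "g # fs \<in> lists L2" and hfs: "h # fs \<in> lists L2" using g h Suc.prems by auto
  obtain a where a: "\<forall>k>n. a k = 0" "a 0 = sp (replicate n g @ (g # fs))"
      "a 1 = real n *\<^sub>R sp (h # replicate (n - 1) g @ (g # fs))"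
      "\<And>z. sp (replicate n (\<lambda>t. g t + of_real z *\<^sub>C h t) @ (g # fs)) = (\<Sum>k\<le>n. z ^ k *\<^sub>R a k)"
    using Suc.IH[OF gfs] by blast
  obtain b where b: "\<forall>k>n. b k = 0" "b 0 = sp (replicate n g @ (h # fs))"
      "\<And>z. sp (replicate n (\<lambda>t. g t + of_real z *\<^sub>C h t) @ (h # fs)) = (\<Sum>k\<le>n. z ^ k *\<^sub>R b k)"
    using Suc.IH[OF hfs] by blast
  \<comment> \<open>Pascal's rule: \<open>a\<close> belongs to taking \<open>g\<close> and
    \<open>b\<close> to taking \<open>h\<close> in the split-off factor, the latter raising the
    power of \<open>z\<close> by one.\<close>
  let ?c = "\<lambda>k. a k + (if k = 0 then 0 else b (k - 1))"
  show ?case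
  proof (intro exI[of _ ?c] conjI allI impI)
    show "?c k = 0" if "k > Suc n" for k using a(1) b(1) that by simp
    show "?c 0 = sp (replicate (Suc n) g @ fs)"
      by (simp add: a(2) replicate_app_Cons_same)
    have "sp (h # replicate (n - 1) g @ (g # fs)) = sp (h # replicate n g @ fs)" if "n > 0"
      using that by (cases n) (simp_all add: replicate_app_Cons_same)
    moreover have "sp (replicate n g @ (h # fs)) = sp (h # replicate n g @ fs)"
      using mem[OF g hfs] by (intro sp_mset) (auto simp: g h Suc.prems in_lists_conv_set)
    ultimately show "?c 1 = real (Suc n) *\<^sub>R sp (h # replicate (Suc n - 1) g @ fs)"
      using a(3) b(2) by (cases "n = 0") (simp_all add: algebra_simps)
    fix z :: real
    let ?gh = "\<lambda>t. g t + of_real z *\<^sub>C h t"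
    have gh: "?gh \<in> L2" by (intro L2_add g L2_scaleC h)
    have swap: "sp (x # replicate n ?gh @ fs) = sp (replicate n ?gh @ (x # fs))" if "x \<in> L2" for x
      using mem[OF gh, of "x # fs" n] that Suc.prems by (intro sp_mset) auto
    have "sp (replicate (Suc n) ?gh @ fs) = sp (?gh # replicate n ?gh @ fs)" by simp
    also have "\<dots> = sp (g # replicate n ?gh @ fs) + of_real z *\<^sub>C sp (h # replicate n ?gh @ fs)"
      by (rule sp_head_linear[OF g h mem[OF gh Suc.prems]])
    also have "\<dots> = (\<Sum>k\<le>n. z ^ k *\<^sub>R a k) + z *\<^sub>R (\<Sum>k\<le>n. z ^ k *\<^sub>R b k)"
      by (simp only: swap[OF g] swap[OF h] a(4) b(3) scaleR_scaleC[of z])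
    also have "z *\<^sub>R (\<Sum>k\<le>n. z ^ k *\<^sub>R b k) = (\<Sum>k\<le>n. z ^ Suc k *\<^sub>R b k)"
      by (simp add: scaleR_sum_right)
    also have "\<dots> = (\<Sum>k\<le>Suc n. z ^ k *\<^sub>R (if k = 0 then 0 else b (k - 1)))"
      by (subst sum.atMost_Suc_shift) simp
    also have "(\<Sum>k\<le>n. z ^ k *\<^sub>R a k) = (\<Sum>k\<le>Suc n. z ^ k *\<^sub>R a k)"
      using a(1) by simp
    finally show "sp (replicate (Suc n) ?gh @ fs) = (\<Sum>k\<le>Suc n. z ^ k *\<^sub>R ?c k)"
      by (simp only: scaleR_add_right sum.distrib)
  qed
qed

end

section \<open>Totality of the exponential vectors of step functions\<close>

locale step_fock = L2_fock sp
  for sp :: "(real \<Rightarrow> 'k::complex_hilbert) list \<Rightarrow> 'h::complex_hilbert" +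
  fixes \<iota> :: "'d::complex_inner \<Rightarrow> 'k"
  assumes completion: "is_completion \<iota>"
begin

definition E :: "(real \<Rightarrow> 'd) \<Rightarrow> 'h"
  where "E f = exp_vector sp (\<lambda>\<tau>. \<iota> (f \<tau>))"

definition emb :: "(real \<Rightarrow> 'd) \<Rightarrow> real \<Rightarrow> 'k"
  where "emb f = (\<lambda>\<tau>. \<iota> (f \<tau>))"

lemma emb_L2: "f \<in> step_functions \<Longrightarrow> emb f \<in> L2"
  unfolding emb_def by (rule L2_step[OF completion])

text \<open>The exponential vector of z f is a power series in \<open>z\<close> whose coefficients
  are multiples of the particle components of \<open>E f\<close>; its values lie in the closed span,
  hence so do its coefficients.\<close>

lemma sp_replicate_in_span:
  assumes f: "f \<in> step_functions"
  shows "sp (replicate n (emb f)) \<in> closure (cspan (E ` step_functions))"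
proof -
  let ?M = "closure (cspan (E ` step_functions))"
  have M: "csubspace ?M" by (rule csubspace_closure_cspan)
  let ?a = "\<lambda>n. (1 / sqrt (fact n)) *\<^sub>R sp (replicate n (emb f))"
  have "?a n \<in> ?M"
  proof (rule closed_subspace_powser_coeff[OF M closed_closure summable_norm_exp_vector[OF emb_L2[OF f]]])
    fix z :: real
    have zf: "(\<lambda>\<tau>. of_real z *\<^sub>C f \<tau>) \<in> step_functions" by (rule step_functions_scaleC[OF f])
    have emb: "emb (\<lambda>\<tau>. of_real z *\<^sub>C f \<tau>) = (\<lambda>t. of_real z *\<^sub>C emb f t)"
      by (simp add: emb_def completion_simps[OF completion])
    have "sp (replicate n (emb (\<lambda>\<tau>. of_real z *\<^sub>C f \<tau>))) = z ^ n *\<^sub>R sp (replicate n (emb f))" for n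
      using sp_replicate_scale[OF emb_L2[OF f], of "[]" n "of_real z"]
      by (simp add: emb scaleR_scaleC)
    then have "E (\<lambda>\<tau>. of_real z *\<^sub>C f \<tau>) = (\<Sum>n. z ^ n *\<^sub>R ?a n)"
      by (simp add: E_def exp_vector_def emb_def[symmetric] mult.commute)
    moreover have "E (\<lambda>\<tau>. of_real z *\<^sub>C f \<tau>) \<in> ?M"
      by (rule subsetD[OF closure_cspan_superset imageI[OF zf]])
    ultimately show "(\<Sum>n. z ^ n *\<^sub>R ?a n) \<in> ?M" by simp
  qed
  then have "of_real (sqrt (fact n)) *\<^sub>C ?a n \<in> ?M"
    by (rule complex_vector.subspace_scale[OF M])
  then show ?thesis
    unfolding scaleR_scaleC[symmetric] by simp
qed

text \<open>Polarization: the symmetric tensor with one factor \<open>h\<close> and \<open>m\<close>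
  factors \<open>g\<close> is, up to the scalar m + 1, the linear coefficient in \<open>z\<close> of
  the power m + 1 of g + z h. For each \<open>z\<close> the induction hypothesis applies to that
  power, so the entries of \<open>hs\<close> are absorbed one at a time.\<close>

lemma sp_step_in_span:
  assumes "hs \<in> lists (emb ` step_functions)" "g \<in> step_functions"
  shows "sp (hs @ replicate m (emb g)) \<in> closure (cspan (E ` step_functions))"
  using assms
proof (induction hs arbitrary: g m rule: list.induct)
  case Nil
  then show ?case by (simp add: sp_replicate_in_span)
next
  case (Cons x hs)
  let ?M = "closure (cspan (E ` step_functions))"
  have M: "csubspace ?M" by (rule csubspace_closure_cspan)
  obtain h where h: "h \<in> step_functions" "x = emb h" using Cons.prems by auto
  have hs: "hs \<in> lists L2" using Cons.prems emb_L2 by (auto simp: in_lists_conv_set)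
  have g: "emb g \<in> L2" and hL: "emb h \<in> L2" using emb_L2 h Cons.prems by auto
  obtain a where a: "\<forall>k>Suc m. a k = 0"
      "a 1 = real (Suc m) *\<^sub>R sp (emb h # replicate (Suc m - 1) (emb g) @ hs)"
      "\<And>z. sp (replicate (Suc m) (\<lambda>t. emb g t + of_real z *\<^sub>C emb h t) @ hs) = (\<Sum>k\<le>Suc m. z ^ k *\<^sub>R a k)"
    using sp_replicate_expansion[OF g hL hs, of "Suc m"] by blast
  have "a 1 \<in> ?M"
  proof (rule closed_subspace_powser_coeff[OF M closed_closure])
    show "summable (\<lambda>n. norm (a n))"
      using a(1) by (intro summable_finite[of "{..Suc m}"]) auto
    fix z :: real
    let ?gh = "\<lambda>t. g t + of_real z *\<^sub>C h t"
    have gh: "?gh \<in> step_functions"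
      by (intro step_functions_add Cons.prems step_functions_scaleC h)
    have emb: "emb ?gh = (\<lambda>t. emb g t + of_real z *\<^sub>C emb h t)"
      by (simp add: emb_def completion_simps[OF completion])
    have "(\<Sum>n. z ^ n *\<^sub>R a n) = (\<Sum>k\<le>Suc m. z ^ k *\<^sub>R a k)"
      using a(1) by (intro suminf_finite) auto
    also have "\<dots> = sp (replicate (Suc m) (emb ?gh) @ hs)" by (simp only: a(3) emb)
    also have "\<dots> = sp (hs @ replicate (Suc m) (emb ?gh))"
      using hs emb_L2[OF gh] by (intro sp_mset) (auto simp: in_lists_conv_set)
    also have "\<dots> \<in> ?M"
      using Cons.prems gh by (intro Cons.IH) auto
    finally show "(\<Sum>n. z ^ n *\<^sub>R a n) \<in> ?M" .
  qed
  then have "of_real (inverse (real (Suc m))) *\<^sub>C a 1 \<in> ?M"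
    by (rule complex_vector.subspace_scale[OF M])
  moreover have "of_real (inverse (real (Suc m))) *\<^sub>C a 1 = sp (emb h # replicate m (emb g) @ hs)"
    unfolding scaleR_scaleC[symmetric] a(2) by simp
  moreover have "sp (emb h # replicate m (emb g) @ hs) = sp ((x # hs) @ replicate m (emb g))"
    using hs g hL h(2) by (intro sp_mset) (auto simp: in_lists_conv_set)
  ultimately show ?case by simp
qed

text \<open>The entries are replaced one at a time by step functions. By multilinearity and
  \<open>norm_sp_le\<close> the squared error is at most the squared norm of the replaced difference
  times the fixed product \<open>P\<close> over the remaining entries.\<close>

lemma sp_in_span:
  assumes "fs \<in> lists L2" "hs \<in> lists (emb ` step_functions)"
  shows "sp (fs @ hs) \<in> closure (cspan (E ` step_functions))"
  using assms
proof (induction fs arbitrary: hs rule: list.induct)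
  case Nil
  show ?case using sp_step_in_span[OF Nil.prems(2) step_functions_zero, of 0] by simp
next
  case (Cons f fs)
  let ?M = "closure (cspan (E ` step_functions))"
  let ?r = "fs @ hs"
  have "hs \<in> lists L2" using Cons.prems(2) emb_L2 by (auto simp: in_lists_conv_set)
  then have r: "?r \<in> lists L2" and f: "f \<in> L2" using Cons.prems(1) by simp_all
  define P where "P = (\<Prod>f\<leftarrow>?r. L2_norm_sq f)"
  have P: "P \<ge> 0" unfolding P_def by (rule order_trans[OF zero_le_power2 norm_sp_le[OF r]])
  have "sp (f # ?r) \<in> closure ?M"
    unfolding closure_approachable
  proof (intro allI impI)
    fix e :: real assume e: "e > 0"
    then have "e\<^sup>2 / (P + 1) > 0" using P by simp
    then obtain h where h: "h \<in> step_functions" "L2_norm_sq (\<lambda>t. f t - \<iota> (h t)) < e\<^sup>2 / (P + 1)"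
      using step_functions_dense_L2[OF completion f] unfolding step_approx_def by blast
    have hL: "emb h \<in> L2" by (rule emb_L2[OF h(1)])
    let ?d = "\<lambda>t. f t + (- 1) *\<^sub>C emb h t"
    have d: "?d \<in> L2" by (intro L2_add f L2_scaleC hL)
    have "sp (f # ?r) - sp (emb h # ?r) = sp (?d # ?r)"
      unfolding sp_head_linear[OF f hL r] by (simp add: uminus_scaleC[symmetric])
    then have "(dist (sp (emb h # ?r)) (sp (f # ?r)))\<^sup>2 = (norm (sp (?d # ?r)))\<^sup>2"
      by (simp add: dist_norm norm_minus_commute)
    also have "\<dots> \<le> L2_norm_sq ?d * P"
      using norm_sp_le[of "?d # ?r"] d r unfolding P_def by simp
    also have "L2_norm_sq ?d = L2_norm_sq (\<lambda>t. f t - \<iota> (h t))"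
      by (simp add: emb_def uminus_scaleC[symmetric])
    also have "\<dots> * P \<le> e\<^sup>2 / (P + 1) * P"
      using h(2) P by (intro mult_right_mono) auto
    also have "\<dots> < e\<^sup>2" using e P by (simp add: field_simps)
    finally have "dist (sp (emb h # ?r)) (sp (f # ?r)) < e"
      by (rule power2_less_imp_less) (use e in simp)
    moreover have "sp (emb h # ?r) = sp (fs @ (emb h # hs))"
      using hL r by (intro sp_mset) auto
    moreover have "sp (fs @ (emb h # hs)) \<in> ?M"
      using Cons.prems h(1) by (intro Cons.IH) auto
    ultimately show "\<exists>y\<in>?M. dist y (sp (f # ?r)) < e" by auto
  qed
  then show ?case by simp
qed

theorem exp_vectors_total: "closure (cspan (E ` step_functions)) = UNIV"
proof -
  have "sp ` lists L2 \<subseteq> closure (cspan (E ` step_functions))"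
    using sp_in_span[of _ "[]"] by auto
  then have "closure (cspan (sp ` lists L2)) \<subseteq> closure (cspan (E ` step_functions))"
    by (intro closure_cspan_subset csubspace_closure_cspan closed_closure)
  then show ?thesis using sp_total by auto
qed

end

section \<open>Inner products of exponential vectors\<close>

context step_fock
begin

lemma cinner_E: "f \<in> step_functions \<Longrightarrow> g \<in> step_functions \<Longrightarrow>
    cinner (E f) (E g) = exp (L2_inner (emb f) (emb g))"
  using cinner_exp_vector[OF emb_L2 emb_L2, of f g] by (simp add: E_def emb_def)

text \<open>The inner product of the functions splits into the parts before and after
  \<open>t\<close>, and the exponential turns the sum into a product. This is the scalar form of the
  tensor factorisation of the Fock space at time \<open>t\<close>.\<close>

lemma E_factor:
  assumes f: "f \<in> step_functions" and g: "g \<in> step_functions" and t: "0 \<le> t"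
  shows "cinner (E f) (E g) =
    cinner (E (before t f)) (E (before t g)) * cinner (E (after t f)) (E (after t g))"
proof -
  note mem = step_functions_before[OF f t] step_functions_before[OF g t]
    step_functions_after[OF f] step_functions_after[OF g]
  have "cinner (emb f \<tau>) (emb g \<tau>) = cinner (emb (before t f) \<tau>) (emb (before t g) \<tau>) +
      cinner (emb (after t f) \<tau>) (emb (after t g) \<tau>)" for \<tau>
    by (simp add: emb_def before_def after_def completion_simps[OF completion])
  then have "L2_inner (emb f) (emb g) = L2_inner (emb (before t f)) (emb (before t g)) +
      L2_inner (emb (after t f)) (emb (after t g))"
    unfolding L2_inner_def
    by (simp add: Bochner_Integration.integral_add[OF integrable_cinner integrable_cinner] emb_L2 mem)
  then show ?thesis by (simp add: cinner_E f g mem exp_add)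
qed

lemma vacuum_eq: "vacuum sp = E (\<lambda>_. 0)"
proof -
  have "sp (replicate n (\<lambda>_. 0)) = 0" if "n > 0" for n
    using norm_sp_replicate[OF L2_zero, of n] that by (simp add: L2_norm_sq_def zero_power)
  then have "(\<Sum>n. (1 / sqrt (fact n)) *\<^sub>R sp (replicate n (\<lambda>_. 0))) =
      (\<Sum>n\<in>{0}. (1 / sqrt (fact n)) *\<^sub>R sp (replicate n (\<lambda>_. 0)))"
    by (intro suminf_finite) auto
  then show ?thesis
    by (simp add: vacuum_def E_def exp_vector_def completion_simps[OF completion])
qed

lemma cinner_vacuum: "f \<in> step_functions \<Longrightarrow> cinner (E f) (E (\<lambda>_. 0)) = 1"
  by (simp add: cinner_E step_functions_zero emb_def completion_simps[OF completion] L2_inner_def)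

lemma cinner_E_piece:
  assumes "0 \<le> s" "s \<le> t"
  shows "cinner (E (piece {s..<t} x)) (E (piece {s..<t} x)) = exp (of_real ((t - s) * (norm x)\<^sup>2))"
proof -
  obtain N where "t \<le> real N" using real_arch_simple by blast
  then have "{s..<t} \<subseteq> {..<real N}" by auto
  then have fin: "emeasure half_line {s..<t} < \<infinity>"
    using bounded_half_line(1) Ico_half_line[OF assms(1)] by blast
  have emb: "emb (piece {s..<t} x) = piece {s..<t} (\<iota> x)"
    by (auto simp: emb_def piece_def completion_simps[OF completion])
  have "measure half_line {s..<t} = t - s"
    using assms by (subst measure_restrict_space) (auto simp: measure_completion)
  then show ?thesis
    using assms L2_norm_sq_piece[OF Ico_half_line[OF assms(1)] fin, of "\<iota> x"]
    by (simp add: cinner_E step_functions_piece emb L2_inner_same completion_simps[OF completion])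
qed

end

section \<open>Slices of the comultiplication\<close>

lemma clinear_simps:
  assumes "clinear f"
  shows "f (x + y) = f x + f y" "f (c *\<^sub>C x) = c *\<^sub>C f x" "f 0 = 0" "f (x - y) = f x - f y"
    "f (sum g S) = (\<Sum>i\<in>S. f (g i))"
proof -
  interpret Vector_Spaces.linear scaleC scaleC f by (rule assms)
  show "f (x + y) = f x + f y" "f (c *\<^sub>C x) = c *\<^sub>C f x" "f 0 = 0" "f (x - y) = f x - f y"
    "f (sum g S) = (\<Sum>i\<in>S. f (g i))"
    by (rule add scale zero diff sum)+
qed

lemma scaleC_complex: "c *\<^sub>C (x :: complex) = c * x"
  by (simp add: scaleC_complex_def)

context involutive_bialgebra
begin

lemma comult_linear: "clinear \<Delta>" and counit_linear: "clinear \<epsilon>"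
  using comult_hom counit_hom by (simp_all add: unital_star_hom_def)

text \<open>This is (id \<otimes> F) \<circ> \<Delta>. It turns convolution with \<open>F\<close>
  from the right into composition, so that the convolution equation becomes linear in the left-hand
  functional alone.\<close>

definition slice :: "('b \<Rightarrow> complex) \<Rightarrow> 'b \<Rightarrow> 'b"
  where "slice F b = tensor_lift (\<lambda>x y. F y *\<^sub>C x) (\<Delta> b)"

lemma cbilinear_slice: "clinear F \<Longrightarrow> cbilinear (\<lambda>x y. F y *\<^sub>C x)"
  by (rule cbilinearI)
    (simp_all add: clinear_simps scaleC_add_left scaleC_add_right scaleC_scaleC scaleC_complex mult.commute)

lemma cbilinear_mult: "clinear F \<Longrightarrow> clinear G \<Longrightarrow> cbilinear (\<lambda>x y. F x * G y :: complex)"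
  by (rule cbilinearI) (simp_all add: clinear_simps scaleC_complex algebra_simps)

lemma conv_slice:
  assumes m: "clinear m" and F: "clinear F"
  shows "conv \<Delta> m F b = m (slice F b)"
proof -
  have "tensor_lift (\<lambda>x y. m x * F y) t = m (tensor_lift (\<lambda>x y. F y *\<^sub>C x) t)" for t
  proof (induction t rule: tensor_induct)
    case zero
    show ?case
      by (simp add: tensor_lift_zero cbilinear_slice cbilinear_mult m F clinear_simps[OF m])
  next
    case (pure a b)
    show ?case
      by (simp add: tensor_lift_pure cbilinear_slice cbilinear_mult m F clinear_simps[OF m] scaleC_complex)
  next
    case (add x y)
    then show ?case
      by (simp add: tensor_lift_add cbilinear_slice cbilinear_mult m F clinear_simps[OF m])
  qed
  then show ?thesis by (simp add: conv_def slice_def)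
qed

lemma slice_linear: "clinear F \<Longrightarrow> clinear (slice F)"
  by (rule clinearI)
    (simp_all add: slice_def clinear_simps[OF comult_linear] tensor_lift_add tensor_lift_scaleC cbilinear_slice)

lemma conv_linear: "clinear F \<Longrightarrow> clinear G \<Longrightarrow> clinear (conv \<Delta> F G)"
  by (rule clinearI)
    (simp_all add: conv_def clinear_simps[OF comult_linear] tensor_lift_add tensor_lift_scaleC cbilinear_mult)

lemma slice_counit: "slice \<epsilon> b = b"
  using counit_right by (simp add: slice_def)

lemma counit_slice:
  assumes F: "clinear F"
  shows "\<epsilon> (slice F b) = F b"
proof -
  have "tensor_lift (\<lambda>x y. \<epsilon> x * F y) t = F (tensor_lift (\<lambda>x y. \<epsilon> x *\<^sub>C y) t)" for t
  proof -
    have bil: "cbilinear (\<lambda>x y. \<epsilon> x *\<^sub>C y)"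
      by (rule cbilinearI)
        (simp_all add: clinear_simps[OF counit_linear] scaleC_add_left scaleC_add_right scaleC_scaleC
          scaleC_complex mult.commute)
    note bil' = cbilinear_mult[OF counit_linear F]
    show ?thesis
    proof (induction t rule: tensor_induct)
      case zero
      show ?case by (simp add: tensor_lift_zero bil bil' clinear_simps[OF F])
    next
      case (pure a b)
      show ?case by (simp add: tensor_lift_pure bil bil' clinear_simps[OF F] scaleC_complex)
    next
      case (add x y)
      then show ?case by (simp add: tensor_lift_add bil bil' clinear_simps[OF F])
    qed
  qed
  then have "conv \<Delta> \<epsilon> F b = F b" by (simp add: conv_def counit_left)
  then show ?thesis by (simp add: conv_slice[OF counit_linear F])
qed

text \<open>Coassociativity evaluated by id \<otimes> G \<otimes> F: \<open>\<Theta>\<close> is this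
  map on the right-bracketed triple tensor product, and the two sides are its values on the two
  iterated comultiplications.\<close>

lemma slice_slice:
  assumes F: "clinear F" and G: "clinear G"
  shows "slice G (slice F b) = slice (conv \<Delta> G F) b"
proof -
  define H where "H = tensor_lift (\<lambda>u v. G u * F v)"
  have bGF: "cbilinear (\<lambda>u v. G u * F v)" by (rule cbilinear_mult[OF G F])
  have H: "clinear H"
    unfolding H_def by (rule clinearI) (simp_all add: tensor_lift_add tensor_lift_scaleC bGF)
  define \<Theta> where "\<Theta> = tensor_lift (\<lambda>x y. H y *\<^sub>C (x :: 'b))"
  have bH: "cbilinear (\<lambda>x y. H y *\<^sub>C (x :: 'b))" by (rule cbilinear_slice[OF H])
  have \<Theta>_add: "\<Theta> (x + y) = \<Theta> x + \<Theta> y" and \<Theta>_zero: "\<Theta> 0 = 0" for x y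
    by (simp_all add: \<Theta>_def tensor_lift_add tensor_lift_zero bH)
  have \<Theta>_pure: "\<Theta> (x \<otimes> w) = H w *\<^sub>C x" for x w
    unfolding \<Theta>_def by (rule tensor_lift_pure[OF bH])
  have H_pure: "H (u \<otimes> v) = G u * F v" for u v
    unfolding H_def by (rule tensor_lift_pure[OF bGF])
  have b1: "cbilinear (\<lambda>a b. a \<otimes> b \<otimes> (c :: 'b))" for c :: 'b
    by (rule cbilinearI) (simp_all add: tensor_pure_add_left tensor_pure_add_right
        tensor_pure_scaleC_left tensor_pure_scaleC_right)
  have b2: "cbilinear (\<lambda>x c. tensor_lift (\<lambda>a b. a \<otimes> b \<otimes> c) x :: ('b, ('b, 'b) tensor) tensor)"
  proof (rule cbilinearI)
    fix x :: "('b, 'b) tensor" and c c' :: 'b and k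
    show "tensor_lift (\<lambda>a b. a \<otimes> b \<otimes> (c + c')) x =
        tensor_lift (\<lambda>a b. a \<otimes> b \<otimes> c) x + tensor_lift (\<lambda>a b. a \<otimes> b \<otimes> c') x"
      by (simp add: tensor_pure_add_right tensor_lift_fun_add)
    show "tensor_lift (\<lambda>a b. a \<otimes> b \<otimes> k *\<^sub>C c) x = k *\<^sub>C tensor_lift (\<lambda>a b. a \<otimes> b \<otimes> c) x"
      by (simp add: tensor_pure_scaleC_right tensor_lift_fun_scaleC)
  qed (simp_all add: tensor_lift_add tensor_lift_scaleC b1)
  have b3: "cbilinear (\<lambda>a b. \<Delta> a \<otimes> (b :: 'b))"
    by (rule cbilinearI) (simp_all add: clinear_simps[OF comult_linear] tensor_pure_add_left
        tensor_pure_add_right tensor_pure_scaleC_left tensor_pure_scaleC_right)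
  have b4: "cbilinear (\<lambda>a b. (a :: 'b) \<otimes> \<Delta> b)"
    by (rule cbilinearI) (simp_all add: clinear_simps[OF comult_linear] tensor_pure_add_left
        tensor_pure_add_right tensor_pure_scaleC_left tensor_pure_scaleC_right)
  note bF = cbilinear_slice[OF F] and bG = cbilinear_slice[OF G]
  have assoc: "\<Theta> (tensor_lift (\<lambda>a b. a \<otimes> b \<otimes> y) w) = F y *\<^sub>C tensor_lift (\<lambda>x y. G y *\<^sub>C x) w" for y w
  proof (induction w rule: tensor_induct)
    case zero
    show ?case by (simp add: tensor_lift_zero b1 bG \<Theta>_zero)
  next
    case (pure a b)
    show ?case
      by (simp add: tensor_lift_pure b1 bG \<Theta>_pure H_pure scaleC_scaleC mult.commute)
  next
    case (add u v)
    then show ?case by (simp add: tensor_lift_add b1 bG \<Theta>_add scaleC_add_right)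
  qed
  have left: "\<Theta> (tensor_assoc (tensor_map \<Delta> (\<lambda>x. x) t)) = slice G (tensor_lift (\<lambda>x y. F y *\<^sub>C x) t)" for t
  proof (induction t rule: tensor_induct)
    case zero
    show ?case
      by (simp add: tensor_map_def tensor_assoc_def tensor_lift_zero b2 b3 bF \<Theta>_zero
          clinear_simps[OF slice_linear[OF G]])
  next
    case (pure a b)
    show ?case
      by (simp add: tensor_map_def tensor_assoc_def tensor_lift_pure b2 b3 bF assoc
          clinear_simps[OF slice_linear[OF G]]) (simp add: slice_def)
  next
    case (add u v)
    then show ?case
      by (simp add: tensor_map_def tensor_assoc_def tensor_lift_add b2 b3 bF \<Theta>_add
          clinear_simps[OF slice_linear[OF G]])
  qed
  note bC = cbilinear_slice[OF conv_linear[OF G F]]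
  have right: "\<Theta> (tensor_map (\<lambda>x. x) \<Delta> t) = tensor_lift (\<lambda>x y. conv \<Delta> G F y *\<^sub>C x) t" for t
  proof (induction t rule: tensor_induct)
    case zero
    show ?case by (simp add: tensor_map_def tensor_lift_zero b4 bC \<Theta>_zero)
  next
    case (pure a b)
    show ?case by (simp add: tensor_map_def tensor_lift_pure b4 bC \<Theta>_pure) (simp add: H_def conv_def)
  next
    case (add u v)
    then show ?case by (simp add: tensor_map_def tensor_lift_add b4 bC \<Theta>_add)
  qed
  show ?thesis
    using left[of "\<Delta> b"] right[of "\<Delta> b"] coassoc[of b] by (simp add: slice_def)
qed

text \<open>The left legs of \<open>\<Delta> b\<close> span a finite-dimensional space that contains
  all slices of \<open>b\<close>. By \<open>slice_slice\<close> these slices are stable under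
  further slicing, and \<open>b\<close> is its own slice by the counit: this is the finiteness
  theorem for comodules. It turns the equation for the matrix elements into a finite system.\<close>

lemma finite_slice_invariant:
  "\<exists>B. finite B \<and> b \<in> B \<and> (\<forall>v\<in>B. \<forall>F. clinear F \<longrightarrow> slice F v \<in> cspan B)"
proof -
  define C where "C = {slice F b | F. clinear F}"
  obtain xs where xs: "\<Delta> b = abs_tensor xs" by (metis Quotient_tensor Quotient_abs_rep)
  have "C \<subseteq> cspan (fst ` set xs)"
  proof
    fix v assume "v \<in> C"
    then obtain F where F: "clinear F" "v = slice F b" by (auto simp: C_def)
    have "v = (\<Sum>(x, y)\<leftarrow>xs. F y *\<^sub>C x)"
      by (simp add: F slice_def xs tensor_lift_abs cbilinear_slice)
    \<comment> \<open>The list \<open>ys\<close> is kept apart from \<open>xs\<close>, so that the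
      span stays fixed during the induction on \<open>xs\<close>.\<close>
    also have "\<dots> \<in> cspan (fst ` set ys)" if "set xs \<subseteq> set ys" for ys :: "('b \<times> 'b) list"
      using that
    proof (induction xs)
      case (Cons p xs)
      have "F (snd p) *\<^sub>C fst p \<in> cspan (fst ` set ys)"
        using Cons.prems by (intro complex_vector.span_scale complex_vector.span_base) auto
      then show ?case
        using Cons by (auto simp: case_prod_beta intro: complex_vector.span_add)
    qed (simp add: complex_vector.span_zero)
    finally show "v \<in> cspan (fst ` set xs)" by simp
  qed
  moreover obtain B0 where B0: "B0 \<subseteq> C" "\<not> complex_vector.dependent B0" "C \<subseteq> cspan B0"
    using complex_vector.maximal_independent_subset[of C] by blast
  ultimately have fin: "finite B0"
    using complex_vector.independent_span_bound[of "fst ` set xs" B0] by auto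
  have C_inv: "slice G v \<in> C" if v: "v \<in> C" and G: "clinear G" for v G
    using v slice_slice[OF _ G] conv_linear[OF G] unfolding C_def by blast
  have b: "b \<in> C"
    using counit_linear slice_counit unfolding C_def by (metis (mono_tags, lifting) mem_Collect_eq)
  have "cspan B0 \<subseteq> cspan (insert b B0)" by (intro complex_vector.span_mono) auto
  with B0 C_inv b have "slice F v \<in> cspan (insert b B0)" if "v \<in> insert b B0" "clinear F" for v F
    using that by blast
  with fin show ?thesis by (intro exI[of _ "insert b B0"]) auto
qed

text \<open>The coefficients of \<open>slice F v\<close> with respect to \<open>B\<close> are fixed
  first, so the constant does not depend on \<open>m\<close>. The functionals inserted later are
  matrix elements at varying times, whence the need for uniformity.\<close>

lemma slice_bound:
  assumes B: "finite B" and v: "slice F v \<in> cspan B"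
  shows "\<exists>K\<ge>0. \<forall>m. clinear m \<longrightarrow> norm (m (slice F v) :: complex) \<le> K * (\<Sum>w\<in>B. norm (m w))"
proof -
  obtain u where u: "slice F v = (\<Sum>w\<in>B. u w *\<^sub>C w)"
    using v complex_vector.span_finite[OF B] by auto
  let ?K = "\<Sum>w\<in>B. norm (u w)"
  have "norm (m (slice F v)) \<le> ?K * (\<Sum>w\<in>B. norm (m w))" if m: "clinear m" for m :: "'b \<Rightarrow> complex"
  proof -
    have "norm (m (slice F v)) = norm (\<Sum>w\<in>B. u w * m w)"
      by (simp add: u clinear_simps[OF m] scaleC_complex)
    also have "\<dots> \<le> (\<Sum>w\<in>B. norm (u w * m w))" by (rule norm_sum)
    also have "\<dots> \<le> (\<Sum>w\<in>B. ?K * norm (m w))"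
      unfolding norm_mult using B by (intro sum_mono mult_right_mono member_le_sum) auto
    finally show ?thesis by (simp add: sum_distrib_left)
  qed
  then show ?thesis by (intro exI[of _ ?K]) (auto intro: sum_nonneg)
qed

text \<open>A step function takes finitely many values, so a single constant serves for its
  coefficient functionals at all times.\<close>

lemma slice_bound_finite:
  assumes B: "finite B" "\<And>v F. v \<in> B \<Longrightarrow> clinear F \<Longrightarrow> slice F v \<in> cspan B"
    and \<F>: "finite \<F>" "\<And>F. F \<in> \<F> \<Longrightarrow> clinear F"
  shows "\<exists>K\<ge>0. \<forall>F\<in>\<F>. \<forall>v\<in>B. \<forall>m. clinear m \<longrightarrow>
    norm (m (slice F v) :: complex) \<le> K * (\<Sum>w\<in>B. norm (m w))"
proof -
  define P where "P F v k \<longleftrightarrow> k \<ge> 0 \<and> (\<forall>m. clinear m \<longrightarrow>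
      norm (m (slice F v) :: complex) \<le> k * (\<Sum>w\<in>B. norm (m w)))" for F v k
  define K where "K F v = (SOME k. P F v k)" for F v
  have "P F v (K F v)" if "F \<in> \<F>" "v \<in> B" for F v
    unfolding K_def
  proof (rule someI_ex)
    show "\<exists>k. P F v k"
      using slice_bound[OF B(1) B(2)[OF that(2) \<F>(2)[OF that(1)]]] unfolding P_def by blast
  qed
  then have K: "\<And>F v. F \<in> \<F> \<Longrightarrow> v \<in> B \<Longrightarrow> K F v \<ge> 0"
    "\<And>F v m. F \<in> \<F> \<Longrightarrow> v \<in> B \<Longrightarrow> clinear m \<Longrightarrow>
      norm (m (slice F v) :: complex) \<le> K F v * (\<Sum>w\<in>B. norm (m w))"
    unfolding P_def by blast+
  let ?K = "\<Sum>(F, v)\<in>\<F> \<times> B. K F v"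
  show ?thesis
  proof (intro exI[of _ ?K] conjI ballI allI impI)
    show "?K \<ge> 0" using K(1) by (intro sum_nonneg) auto
    fix F v and m :: "'b \<Rightarrow> complex"
    assume F: "F \<in> \<F>" and v: "v \<in> B" and m: "clinear m"
    have "K F v = (case (F, v) of (F, v) \<Rightarrow> K F v)" by simp
    also have "\<dots> \<le> ?K"
      using F v B(1) \<F>(1) K(1) by (intro member_le_sum) auto
    finally have "K F v * (\<Sum>w\<in>B. norm (m w)) \<le> ?K * (\<Sum>w\<in>B. norm (m w))"
      by (rule mult_right_mono) (simp add: sum_nonneg)
    with K(2)[OF F v m] show "norm (m (slice F v)) \<le> ?K * (\<Sum>w\<in>B. norm (m w))" by linarith
  qed
qed

end

text \<open>A short-interval form of Gronwall: since (q - p) * K * card B is at most 1/2, the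
  maximum of the sum can be absorbed into the left side. Continuity of \<open>u\<close>, which makes
  the maximum exist, is read off from the integral form.\<close>

lemma integral_equation_bound:
  fixes u a :: "'i \<Rightarrow> real \<Rightarrow> complex"
  assumes B: "finite B" and pq: "(p :: real) \<le> q" and K: "0 \<le> K" "(q - p) * K * card B \<le> 1 / 2"
    and int: "\<And>v t. v \<in> B \<Longrightarrow> t \<in> {p..q} \<Longrightarrow> (h v has_integral u v t - c v) {p..t}"
    and bd: "\<And>v t. v \<in> B \<Longrightarrow> t \<in> {p..q} \<Longrightarrow> norm (h v t) \<le> K * (\<Sum>w\<in>B. norm (u w t))"
    and t: "t \<in> {p..q}"
  shows "(\<Sum>w\<in>B. norm (u w t)) \<le> 2 * (\<Sum>w\<in>B. norm (c w))"
proof -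
  let ?U = "\<lambda>t. \<Sum>w\<in>B. norm (u w t)"
  have "continuous_on {p..q} (u v)" if v: "v \<in> B" for v
  proof -
    have "h v integrable_on {p..q}" using int[OF v, of q] pq by auto
    then have "continuous_on {p..q} (\<lambda>t. c v + integral {p..t} (h v))"
      by (intro continuous_intros indefinite_integral_continuous_1)
    moreover have "c v + integral {p..t} (h v) = u v t" if "t \<in> {p..q}" for t
      using integral_unique[OF int[OF v that]] by simp
    ultimately show ?thesis using continuous_on_cong[OF refl] by (metis (no_types, lifting))
  qed
  then have cont: "continuous_on {p..q} ?U" by (intro continuous_intros)
  obtain r where r: "r \<in> {p..q}" "\<And>t. t \<in> {p..q} \<Longrightarrow> ?U t \<le> ?U r"
    using continuous_attains_sup[OF compact_Icc _ cont] pq by auto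
  have U0: "?U r \<ge> 0" by (intro sum_nonneg) simp
  have each: "norm (u v r) \<le> norm (c v) + K * ?U r * (q - p)" if v: "v \<in> B" for v
  proof -
    have "norm (u v r - c v) \<le> K * ?U r * Sigma_Algebra.measure lborel {p..r}"
    proof (rule has_integral_bound_real)
      show "0 \<le> K * ?U r" using K U0 by simp
      show "(h v has_integral u v r - c v) {p..r}" by (rule int[OF v r(1)])
      show "norm (h v t) \<le> K * ?U r" if "t \<in> {p..r} - {}" for t
      proof -
        have t: "t \<in> {p..q}" using that r(1) by auto
        show ?thesis
          using bd[OF v t] mult_left_mono[OF r(2)[OF t] K(1)] by linarith
      qed
    qed simp
    also have "Sigma_Algebra.measure lborel {p..r} = r - p" using r by simp
    also have "K * ?U r * (r - p) \<le> K * ?U r * (q - p)"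
      using r K U0 by (intro mult_left_mono) auto
    finally show ?thesis using norm_triangle_ineq2[of "u v r" "c v"] by linarith
  qed
  have "?U r \<le> (\<Sum>v\<in>B. norm (c v) + K * ?U r * (q - p))" by (rule sum_mono) (rule each)
  also have "\<dots> = (\<Sum>v\<in>B. norm (c v)) + (q - p) * K * card B * ?U r"
    by (simp add: sum.distrib)
  also have "\<dots> \<le> (\<Sum>v\<in>B. norm (c v)) + 1 / 2 * ?U r"
    using K(2) U0 by (intro add_left_mono mult_right_mono) auto
  finally show ?thesis using r(2)[OF t] by linarith
qed

section \<open>Matrix elements of the solution\<close>

lemma step_functions_neg:
  assumes "f \<in> step_functions" "\<tau> < 0"
  shows "f \<tau> = 0"
  using assms(1)
proof (induction rule: step_functions_induct)
  case (add f a b x)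
  then show ?case using assms(2) by (simp add: piece_def)
qed simp

lemma before_zero [simp]: "before t (\<lambda>_. 0) = (\<lambda>_. 0)"
  and after_zero [simp]: "after t (\<lambda>_. 0) = (\<lambda>_. 0)"
  and before_after [simp]: "before t (after t f) = (\<lambda>_. 0)"
  by (auto simp: before_def after_def)

lemma after_after: "s \<le> t \<Longrightarrow> after t (after s f) = after t f"
  by (auto simp: after_def)

text \<open>The Fock space enters the dynamical argument through the properties of exponential
  vectors listed here, which separates the approximation from the construction of the space.\<close>

locale qsde_exp_system =
  involutive_bialgebra \<Delta> \<epsilon> + tr: schuermann_triple \<epsilon> \<rho> \<eta> L + qs: qsde_solution \<Delta> \<epsilon> \<rho> \<eta> L E \<D> j
  for \<Delta> :: "'b::complex_star_algebra \<Rightarrow> ('b, 'b) tensor" and \<epsilon> :: "'b \<Rightarrow> complex"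
    and \<rho> :: "'b \<Rightarrow> 'd::complex_inner \<Rightarrow> 'd" and \<eta> :: "'b \<Rightarrow> 'd" and L :: "'b \<Rightarrow> complex"
    and E :: "(real \<Rightarrow> 'd) \<Rightarrow> 'h::complex_hilbert" and \<D> :: "'h set"
    and j :: "real \<Rightarrow> real \<Rightarrow> 'b \<Rightarrow> 'h \<Rightarrow> 'h" +
  assumes E_total: "closure (cspan (E ` step_functions)) = UNIV"
    and E_factor: "f \<in> step_functions \<Longrightarrow> g \<in> step_functions \<Longrightarrow> 0 \<le> t \<Longrightarrow>
      cinner (E f) (E g) =
        cinner (E (before t f)) (E (before t g)) * cinner (E (after t f)) (E (after t g))"
    and E_vacuum: "f \<in> step_functions \<Longrightarrow> cinner (E f) (E (\<lambda>_. 0)) = 1"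
    and E_piece: "0 \<le> s \<Longrightarrow> s \<le> t \<Longrightarrow>
      cinner (E (piece {s..<t} x)) (E (piece {s..<t} x)) = exp (of_real ((t - s) * (norm x)\<^sup>2))"
    and \<eta>_surj: "surj \<eta>"
begin

abbreviation \<Omega> :: 'h where "\<Omega> \<equiv> E (\<lambda>_. 0)"

lemma vacuum_in_domain: "\<Omega> \<in> \<D>"
  by (rule qs.exp_in_domain[OF step_functions_zero])

lemma
  assumes "0 \<le> s" "s \<le> t"
  shows op_domain: "x \<in> \<D> \<Longrightarrow> j s t b x \<in> \<D>"
    and op_add: "x \<in> \<D> \<Longrightarrow> j s t (a + b) x = j s t a x + j s t b x"
    and op_scaleC: "x \<in> \<D> \<Longrightarrow> j s t (c *\<^sub>C b) x = c *\<^sub>C j s t b x"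
    and op_one: "x \<in> \<D> \<Longrightarrow> j s t 1 x = x"
    and op_mult: "x \<in> \<D> \<Longrightarrow> j s t (a * b) x = j s t a (j s t b x)"
    and op_star: "x \<in> \<D> \<Longrightarrow> y \<in> \<D> \<Longrightarrow> cinner (j s t (star b) x) y = cinner x (j s t b y)"
  using qs.rep[OF assms] by (simp_all add: star_representation_def adjointable_def)

definition mat :: "(real \<Rightarrow> 'd) \<Rightarrow> real \<Rightarrow> real \<Rightarrow> 'b \<Rightarrow> complex"
  where "mat f s t b = cinner (E f) (j s t b \<Omega>)"

text \<open>This is the coefficient of the equation when the right-hand exponential vector is the
  vacuum; time enters through the value \<open>x\<close> of the left-hand step function.\<close>

definition func :: "'d \<Rightarrow> 'b \<Rightarrow> complex"
  where "func x b = cinner x (\<eta> b) + L b"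

lemma mat_linear: "0 \<le> s \<Longrightarrow> s \<le> t \<Longrightarrow> clinear (mat f s t)"
  by (rule clinearI)
    (simp_all add: mat_def op_add op_scaleC vacuum_in_domain cinner_add_right cinner_scaleC_right scaleC_complex)

lemma func_linear: "clinear (func x)"
  by (rule clinearI)
    (simp_all add: func_def clinear_simps[OF tr.cocycle_linear] clinear_simps[OF tr.generator_linear]
      cinner_add_right cinner_scaleC_right scaleC_complex algebra_simps)

lemma qsde_coeff_vacuum: "qsde_coeff \<epsilon> \<rho> \<eta> L f (\<lambda>_. 0) \<tau> = func (f \<tau>)"
proof
  fix b
  have "\<rho> b (0 *\<^sub>C 0) = 0 *\<^sub>C \<rho> b 0"
    using tr.rep by (simp only: star_representation_def adjointable_def) blast
  then have "\<rho> b 0 = 0" by simp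
  then show "qsde_coeff \<epsilon> \<rho> \<eta> L f (\<lambda>_. 0) \<tau> b = func (f \<tau>) b"
    by (simp add: qsde_coeff_def func_def)
qed

lemma mat_integral:
  assumes "0 \<le> s" "s \<le> t" "f \<in> step_functions"
  shows "((\<lambda>\<tau>. mat f s \<tau> (slice (func (f \<tau>)) b)) has_integral mat f s t b - \<epsilon> b) {s..t}"
proof -
  have "((\<lambda>\<tau>. conv \<Delta> (mat f s \<tau>) (func (f \<tau>)) b) has_integral mat f s t b - \<epsilon> b) {s..t}"
    using qs.qsde[OF assms step_functions_zero, of b] E_vacuum[OF assms(3)]
    by (simp add: qsde_coeff_vacuum mat_def[abs_def])
  then show ?thesis
  proof (rule has_integral_eq[rotated])
    fix \<tau> assume "\<tau> \<in> {s..t}"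
    then show "conv \<Delta> (mat f s \<tau>) (func (f \<tau>)) b = mat f s \<tau> (slice (func (f \<tau>)) b)"
      using assms(1) by (intro conv_slice mat_linear func_linear) auto
  qed
qed

text \<open>The difference of the two solutions satisfies a homogeneous integral equation in the
  finitely many unknowns indexed by \<open>B\<close>. It starts from 0 at time \<open>s\<close> and
  is shown to vanish on successive intervals of length \<open>\<delta>\<close>. Values of the
  functions before \<open>s\<close> do not enter: this is adaptedness at the left end point.\<close>

lemma mat_unique:
  assumes st: "0 \<le> s" "s \<le> t" and f: "f \<in> step_functions" and g: "g \<in> step_functions"
    and eq: "\<And>\<tau>. \<tau> \<in> {s..t} \<Longrightarrow> g \<tau> = f \<tau>"
  shows "mat f s t b = mat g s t b"
proof -
  obtain B where B: "finite B" "b \<in> B" "\<And>v F. v \<in> B \<Longrightarrow> clinear F \<Longrightarrow> slice F v \<in> cspan B"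
    using finite_slice_invariant[of b] by blast
  have "finite (func ` range f)" using step_functions_finite_range[OF f] by simp
  moreover have "clinear F" if "F \<in> func ` range f" for F using that func_linear by blast
  ultimately obtain K where K: "K \<ge> 0" "\<And>\<tau> v m. v \<in> B \<Longrightarrow> clinear m \<Longrightarrow>
      norm (m (slice (func (f \<tau>)) v) :: complex) \<le> K * (\<Sum>w\<in>B. norm (m w))"
    using slice_bound_finite[OF B(1,3), of "func ` range f"] by (auto simp: image_iff)
  define d where "d v \<tau> = mat f s \<tau> v - mat g s \<tau> v" for v \<tau>
  define h where "h v \<tau> = d (slice (func (f \<tau>)) v) \<tau>" for v \<tau>
  have int: "(h v has_integral d v r) {s..r}" if r: "r \<in> {s..t}" for v r
  proof -
    have "s \<le> r" using r by simp
    have "((\<lambda>\<tau>. mat g s \<tau> (slice (func (f \<tau>)) v)) has_integral mat g s r v - \<epsilon> v) {s..r}"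
    proof (rule has_integral_eq[OF _ mat_integral[OF st(1) \<open>s \<le> r\<close> g]])
      fix \<tau> assume "\<tau> \<in> {s..r}"
      then have "g \<tau> = f \<tau>" using r by (intro eq) auto
      then show "mat g s \<tau> (slice (func (g \<tau>)) v) = mat g s \<tau> (slice (func (f \<tau>)) v)" by simp
    qed
    from has_integral_diff[OF mat_integral[OF st(1) \<open>s \<le> r\<close> f, of v] this]
    show ?thesis by (simp add: h_def[abs_def] d_def)
  qed
  have bd: "norm (h v \<tau>) \<le> K * (\<Sum>w\<in>B. norm (d w \<tau>))" if "v \<in> B" "\<tau> \<in> {s..t}" for v \<tau>
  proof -
    have "s \<le> \<tau>" using that by simp
    have "clinear (\<lambda>v. d v \<tau>)"
      unfolding d_def
      by (rule clinearI)
        (simp_all add: clinear_simps[OF mat_linear[OF st(1) \<open>s \<le> \<tau>\<close>]] scaleC_complex algebra_simps)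
    from K(2)[OF that(1) this] show ?thesis by (simp add: h_def)
  qed
  \<comment> \<open>A length for which \<open>integral_equation_bound\<close> applies. It depends on
    \<open>K\<close> and \<open>B\<close> but not on the starting point, so finitely many steps
    reach \<open>t\<close>.\<close>
  define \<delta> where "\<delta> = 1 / (2 * (K * card B + 1))"
  have KB: "0 \<le> K * card B" using K by simp
  then have \<delta>: "\<delta> > 0" "\<delta> * (K * card B) \<le> 1 / 2"
    by (auto simp: \<delta>_def field_simps)
  have zero: "\<forall>r\<in>{s..t}. r \<le> s + real n * \<delta> \<longrightarrow> (\<forall>v\<in>B. d v r = 0)" for n
  proof (induction n)
    case 0
    have "d v s = 0" for v
      using qs.initial[OF st(1) vacuum_in_domain] f g
      by (simp add: d_def mat_def cinner_scaleC_right E_vacuum)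
    then show ?case by auto
  next
    case (Suc n)
    show ?case
    proof (intro ballI impI)
      fix q v assume q: "q \<in> {s..t}" "q \<le> s + real (Suc n) * \<delta>" and v: "v \<in> B"
      show "d v q = 0"
      proof (cases "q \<le> s + real n * \<delta>")
        case True
        then show ?thesis using Suc q v by blast
      next
        case False
        define p where "p = s + real n * \<delta>"
        have p: "p \<in> {s..t}" "p \<le> q" using False q \<delta>(1) by (auto simp: p_def)
        have dp: "d v p = 0" if "v \<in> B" for v using Suc p that by (simp add: p_def)
        have "(\<Sum>w\<in>B. norm (d w q)) \<le> 2 * (\<Sum>w\<in>B. norm (d w p))"
        proof (rule integral_equation_bound[OF B(1) p(2) K(1), of "h"])
          have "(q - p) * (K * card B) \<le> \<delta> * (K * card B)"
            using q(2) KB by (intro mult_right_mono) (auto simp: p_def algebra_simps)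
          with \<delta>(2) show "(q - p) * K * card B \<le> 1 / 2" by (simp add: mult.assoc)
          show "(h v has_integral d v r - d v p) {p..r}" if "v \<in> B" "r \<in> {p..q}" for v r
          proof -
            have r: "r \<in> {s..t}" "s \<le> p" "p \<le> r" using that p q by auto
            have i: "h v integrable_on {s..r}" using int[OF r(1)] by blast
            then have ip: "h v integrable_on {p..r}"
              by (rule integrable_on_subinterval) (use r in auto)
            have "integral {s..p} (h v) + integral {p..r} (h v) = integral {s..r} (h v)"
              by (rule Henstock_Kurzweil_Integration.integral_combine[OF r(2,3) i])
            then have "integral {p..r} (h v) = d v r - d v p"
              using integral_unique[OF int[OF r(1), of v]] integral_unique[OF int[OF p(1), of v]]
              by (simp add: algebra_simps)
            then show ?thesis using integrable_integral[OF ip] by simp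
          qed
          show "norm (h v r) \<le> K * (\<Sum>w\<in>B. norm (d w r))" if "v \<in> B" "r \<in> {p..q}" for v r
            using that p q by (intro bd) auto
        qed (use p in auto)
        also have "\<dots> = 0" by (simp add: dp)
        finally have "(\<Sum>w\<in>B. norm (d w q)) = 0" using sum_nonneg[of B "\<lambda>w. norm (d w q)"] by simp
        then show ?thesis using B(1) v by (simp add: sum_nonneg_eq_0_iff)
      qed
    qed
  qed
  obtain n where "t - s \<le> real n * \<delta>"
    using real_arch_simple[of "(t - s) / \<delta>"] \<delta>(1) by (auto simp: field_simps)
  then have "d b t = 0" using zero[of n] st B(2) by simp
  then show ?thesis by (simp add: d_def)
qed

lemma mat_before:
  assumes "0 \<le> s" "s \<le> t" "f \<in> step_functions"
  shows "mat f s t b = mat (before t f) s t b"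
  using qs.adapted[OF assms step_functions_zero, of b] E_vacuum[OF step_functions_after[OF assms(3)]]
  by (simp add: mat_def)

text \<open>Adaptedness replaces both functions by their restrictions to times before
  \<open>t\<close>. These agree at the end point \<open>t\<close> as well, which the closed interval
  in \<open>mat_unique\<close> demands.\<close>

lemma mat_local:
  assumes st: "0 \<le> s" "s \<le> t" and f: "f \<in> step_functions" and g: "g \<in> step_functions"
    and eq: "\<And>\<tau>. \<tau> \<in> {s..<t} \<Longrightarrow> f \<tau> = g \<tau>"
  shows "mat f s t b = mat g s t b"
proof -
  have t: "0 \<le> t" using st by simp
  have "mat (before t f) s t b = mat (before t g) s t b"
    using eq by (intro mat_unique[OF st] step_functions_before f g t) (auto simp: before_def)
  then show ?thesis using mat_before[OF st] f g by metis
qed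

text \<open>The integral equation is inserted into itself once. The remainder is a double integral
  of matrix elements of the twice sliced \<open>b\<close>, bounded on short intervals. The constants
  are independent of \<open>s\<close>, so the expansion serves all increments at once.\<close>

lemma mat_expansion:
  "\<exists>C\<ge>0. \<exists>\<delta>>0. \<forall>s t. 0 \<le> s \<longrightarrow> s \<le> t \<longrightarrow> t \<le> s + \<delta> \<longrightarrow>
    norm (mat (piece {s..<t} x) s t b - \<epsilon> b - of_real (t - s) * func x b) \<le> C * (t - s)\<^sup>2"
proof -
  let ?F = "func x"
  note F = func_linear[of x]
  obtain B where B: "finite B" "b \<in> B" "\<And>v F. v \<in> B \<Longrightarrow> clinear F \<Longrightarrow> slice F v \<in> cspan B"
    using finite_slice_invariant[of b] by blast
  obtain K where K: "K \<ge> 0" "\<And>v m. v \<in> B \<Longrightarrow> clinear m \<Longrightarrow>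
      norm (m (slice ?F v) :: complex) \<le> K * (\<Sum>w\<in>B. norm (m w))"
    using slice_bound_finite[OF B(1,3), of "{?F}"] F by auto
  obtain K' where K': "K' \<ge> 0" "\<And>m. clinear m \<Longrightarrow>
      norm (m (slice (conv \<Delta> ?F ?F) b) :: complex) \<le> K' * (\<Sum>w\<in>B. norm (m w))"
    using slice_bound[OF B(1) B(3)[OF B(2) conv_linear[OF F F]]] by blast
  define A where "A = (\<Sum>w\<in>B. norm (\<epsilon> w))"
  \<comment> \<open>\<open>2 * A\<close> bounds the matrix elements over \<open>B\<close> on a short
    interval by their initial values \<open>\<epsilon> w\<close>, through
    \<open>integral_equation_bound\<close>.\<close>
  define C where "C = K' * (2 * A)"
  have C: "C \<ge> 0" using K'(1) by (simp add: C_def A_def sum_nonneg)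
  define \<delta> where "\<delta> = 1 / (2 * (K * card B + 1))"
  have KB: "0 \<le> K * card B" using K by simp
  then have \<delta>: "\<delta> > 0" "\<delta> * (K * card B) \<le> 1 / 2" "\<delta> < 1"
    by (auto simp: \<delta>_def field_simps)
  have "norm (mat (piece {s..<t} x) s t b - \<epsilon> b - of_real (t - s) * ?F b) \<le> C * (t - s)\<^sup>2"
    if s: "0 \<le> s" and st: "s \<le> t" and td: "t \<le> s + \<delta>" for s t
  proof -
    \<comment> \<open>A longer interval than \<open>{s..<t}\<close>, so that the function is
      constantly \<open>x\<close> up to and including \<open>t\<close>; locality restores the
      original interval at the end.\<close>
    let ?f = "piece {s..<s + 1} x"
    have f: "?f \<in> step_functions" using s by (intro step_functions_piece) auto
    have fx: "?f \<tau> = x" if "\<tau> \<in> {s..t}" for \<tau> using that td \<delta>(3) by (auto simp: piece_def)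
    have int: "((\<lambda>\<tau>. mat ?f s \<tau> (slice ?F v)) has_integral mat ?f s r v - \<epsilon> v) {s..r}"
      if r: "r \<in> {s..t}" for v r
    proof (rule has_integral_eq[OF _ mat_integral[OF s _ f]])
      fix \<tau> assume "\<tau> \<in> {s..r}"
      with r have "?f \<tau> = x" by (intro fx) auto
      then show "mat ?f s \<tau> (slice (func (?f \<tau>)) v) = mat ?f s \<tau> (slice ?F v)" by simp
    qed (use r in simp)
    have lin: "clinear (mat ?f s r)" if "r \<in> {s..t}" for r
      using that by (intro mat_linear s) simp
    have small: "(\<Sum>w\<in>B. norm (mat ?f s r w)) \<le> 2 * A" if r: "r \<in> {s..t}" for r
      unfolding A_def
    proof (rule integral_equation_bound[OF B(1) st K(1) _ _ _ r])
      have "(t - s) * (K * card B) \<le> \<delta> * (K * card B)"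
        using td KB by (intro mult_right_mono) auto
      with \<delta>(2) show "(t - s) * K * card B \<le> 1 / 2" by (simp add: mult.assoc)
    qed (use int K(2) lin in auto)
    have second: "norm (mat ?f s r (slice ?F (slice ?F b))) \<le> C" if r: "r \<in> {s..t}" for r
    proof -
      have "norm (mat ?f s r (slice ?F (slice ?F b))) \<le> K' * (\<Sum>w\<in>B. norm (mat ?f s r w))"
        using K'(2)[OF lin[OF r]] by (simp add: slice_slice[OF F F])
      also have "\<dots> \<le> C"
        unfolding C_def using small[OF r] K'(1) by (intro mult_left_mono) auto
      finally show ?thesis .
    qed
    have bound: "norm i \<le> M * (r - s)" if "(h has_integral i) {s..r}" "s \<le> r" "0 \<le> M"
      "\<And>\<tau>. \<tau> \<in> {s..r} \<Longrightarrow> norm (h \<tau>) \<le> M" for h :: "real \<Rightarrow> complex" and i M r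
      using has_integral_bound_real[OF that(3) finite.emptyI that(1)] that by simp
    \<comment> \<open>The equation for \<open>slice ?F b\<close>, whose initial value is
      \<open>?F b\<close> by \<open>counit_slice\<close>, yields one factor t - s; the final
      integration yields the second.\<close>
    have first: "norm (mat ?f s r (slice ?F b) - ?F b) \<le> C * (t - s)" if r: "r \<in> {s..t}" for r
    proof -
      have "norm (mat ?f s r (slice ?F b) - \<epsilon> (slice ?F b)) \<le> C * (r - s)"
        by (rule bound[OF int[OF r] _ C second]) (use r in auto)
      also have "\<dots> \<le> C * (t - s)" using r C by (intro mult_left_mono) auto
      finally show ?thesis by (simp add: counit_slice[OF F])
    qed
    have "((\<lambda>\<tau>. mat ?f s \<tau> (slice ?F b) - ?F b) has_integral mat ?f s t b - \<epsilon> b - of_real (t - s) * ?F b) {s..t}"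
      using has_integral_diff[OF int has_integral_const_real[of "?F b" s t]] st
      by (simp add: scaleR_conv_of_real)
    then have "norm (mat ?f s t b - \<epsilon> b - of_real (t - s) * ?F b) \<le> C * (t - s) * (t - s)"
      by (rule bound[OF _ st]) (use C st first in auto)
    moreover have "mat ?f s t b = mat (piece {s..<t} x) s t b"
      using s st td \<delta>(3) by (intro mat_local f step_functions_piece) (auto simp: piece_def)
    ultimately show ?thesis by (simp add: power2_eq_square)
  qed
  with C \<delta>(1) show ?thesis by blast
qed

end

section \<open>Products of increments applied to the vacuum\<close>

lemma star_one: "star (1 :: 'a::complex_star_algebra) = 1"
  using star_mult[of "1 :: 'a" "star 1"] by (simp add: star_star)

lemma norm_triangle3: "norm (x + y + z) \<le> norm x + norm y + norm (z :: 'a::real_normed_vector)"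
  using norm_triangle_ineq[of "x + y" z] norm_triangle_ineq[of x y] by linarith

text \<open>Relative errors compose multiplicatively: with a bound 1 + C \<delta>^2 per increment, n
  increments give (1 + C \<delta>^2)^n - 1.\<close>

lemma norm_mult_minus_one_le:
  fixes a b :: "'a::real_normed_algebra_1"
  assumes "norm (a - 1) \<le> A - 1" "norm (b - 1) \<le> B - 1"
  shows "norm (a * b - 1) \<le> A * B - 1"
proof -
  have A: "A \<ge> 1" using order_trans[OF norm_ge_zero assms(1)] by simp
  have mult: "norm ((a - 1) * (b - 1)) \<le> (A - 1) * (B - 1)"
    by (rule order_trans[OF norm_mult_ineq mult_mono]) (use assms A in auto)
  have "a * b - 1 = (a - 1) * (b - 1) + (a - 1) + (b - 1)" by (simp add: algebra_simps)
  also have "norm \<dots> \<le> norm ((a - 1) * (b - 1)) + norm (a - 1) + norm (b - 1)"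
    by (rule norm_triangle3)
  also have "\<dots> \<le> (A - 1) * (B - 1) + (A - 1) + (B - 1)"
    using assms mult by linarith
  finally show ?thesis by (simp add: algebra_simps)
qed

text \<open>Converts a first-order expansion into a relative error against the exponential. The
  exponential is at least 1, so dividing by it does not enlarge the error, and
  \<open>k\<^sup>2\<close> accounts for its second-order remainder.\<close>

lemma norm_div_exp_minus_one_le:
  fixes z :: complex
  assumes z: "norm (z - (1 + of_real (\<delta> * k))) \<le> C * \<delta>\<^sup>2" and k: "0 \<le> k" and \<delta>: "0 \<le> \<delta>" "\<delta> * k \<le> 1"
  shows "norm (z / of_real (exp (\<delta> * k)) - 1) \<le> (C + k\<^sup>2) * \<delta>\<^sup>2"
proof -
  let ?e = "exp (\<delta> * k)"
  have dk: "0 \<le> \<delta> * k" using k \<delta> by simp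
  have e: "1 + \<delta> * k \<le> ?e" "?e \<le> 1 + \<delta> * k + (\<delta> * k)\<^sup>2"
    using exp_ge_add_one_self[of "\<delta> * k"] exp_bound[OF dk \<delta>(2)] by auto
  have "norm (z - of_real ?e) \<le> norm (z - (1 + of_real (\<delta> * k))) + norm (of_real (1 + \<delta> * k - ?e) :: complex)"
    by (rule order_trans[OF _ norm_triangle_ineq]) (simp add: algebra_simps)
  also have "norm (of_real (1 + \<delta> * k - ?e) :: complex) \<le> (\<delta> * k)\<^sup>2"
    unfolding norm_of_real using e by linarith
  finally have "norm (z - of_real ?e) \<le> (C + k\<^sup>2) * \<delta>\<^sup>2"
    using z by (simp add: algebra_simps)
  moreover have "z / of_real ?e - 1 = (z - of_real ?e) / of_real ?e" by (simp add: field_simps)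
  moreover have "norm ((z - of_real ?e) / of_real ?e) \<le> norm (z - of_real ?e)"
    using dk e(1) by (simp add: norm_divide divide_le_eq mult_le_cancel_left1)
  ultimately show ?thesis by simp
qed

section \<open>Vectors of the future and factorisation of matrix elements\<close>

context qsde_exp_system
begin

text \<open>In the factorisation of the Fock space at time \<open>t\<close> these are the vectors
  vacuum \<otimes> w. The factorisation itself is not constructed; membership is expressed by inner
  products with exponential vectors, whose part before \<open>t\<close> pairs to 1 with the
  vacuum.\<close>

definition future :: "real \<Rightarrow> 'h set"
  where "future t = {w. \<forall>f\<in>step_functions. cinner (E f) w = cinner (E (after t f)) w}"

lemma futureD: "w \<in> future t \<Longrightarrow> f \<in> step_functions \<Longrightarrow> cinner (E f) w = cinner (E (after t f)) w"
  by (simp add: future_def)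

lemma csubspace_future: "csubspace (future t)"
  by (rule complex_vector.subspaceI) (auto simp: future_def cinner_add_right cinner_scaleC_right)

lemma cinner_after:
  assumes "0 \<le> t" "f \<in> step_functions" "g \<in> step_functions"
  shows "cinner (E g) (E (after t f)) = cinner (E (after t g)) (E (after t f))"
  using E_factor[OF assms(3) step_functions_after[OF assms(2)] assms(1), of t]
    E_vacuum[OF step_functions_before[OF assms(3,1)]]
  by (simp add: after_after)

lemma after_in_future: "0 \<le> t \<Longrightarrow> f \<in> step_functions \<Longrightarrow> E (after t f) \<in> future t"
  by (simp add: future_def cinner_after)

lemma vacuum_in_future: "\<Omega> \<in> future t"
  by (simp add: future_def E_vacuum step_functions_after)

lemma future_mono:
  assumes "s \<le> t" "w \<in> future t"
  shows "w \<in> future s"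
  unfolding future_def
proof (intro CollectI ballI)
  fix f :: "real \<Rightarrow> 'd" assume f: "f \<in> step_functions"
  show "cinner (E f) w = cinner (E (after s f)) w"
    using futureD[OF assms(2) f] futureD[OF assms(2) step_functions_after[OF f, of s]]
    by (simp add: after_after[OF assms(1)])
qed

text \<open>\<open>z\<close> is the orthogonal projection of \<open>y\<close> to the future of
  \<open>t\<close>: on an exponential vector it replaces \<open>f\<close> by
  \<open>after t f\<close>, and this extends linearly to the span.\<close>

lemma future_projection:
  assumes t: "0 \<le> t" and y: "y \<in> cspan (E ` step_functions)"
  shows "\<exists>z \<in> cspan ((\<lambda>f. E (after t f)) ` step_functions). z \<in> future t \<and>
    (\<forall>w\<in>future t. cinner z w = cinner y w)"
  using y
proof (induction rule: complex_vector.span_induct_alt)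
  case base
  show ?case
    by (intro bexI[of _ 0]) (auto intro: complex_vector.subspace_0[OF csubspace_future] complex_vector.span_zero)
next
  case (step c x y)
  then obtain f z where f: "f \<in> step_functions" "x = E f"
    and z: "z \<in> cspan ((\<lambda>f. E (after t f)) ` step_functions)" "z \<in> future t"
      "\<forall>w\<in>future t. cinner z w = cinner y w"
    by blast
  show ?case
  proof (intro bexI[of _ "c *\<^sub>C E (after t f) + z"] conjI ballI)
    show "c *\<^sub>C E (after t f) + z \<in> future t"
      using z(2) after_in_future[OF t f(1)]
      by (intro complex_vector.subspace_add[OF csubspace_future] complex_vector.subspace_scale[OF csubspace_future])
    show "cinner (c *\<^sub>C E (after t f) + z) w = cinner (c *\<^sub>C x + y) w" if "w \<in> future t" for w
      using z(3) that futureD[OF that f(1)] by (simp add: cinner_add_left cinner_scaleC_left f(2))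
    show "c *\<^sub>C E (after t f) + z \<in> cspan ((\<lambda>f. E (after t f)) ` step_functions)"
      by (rule complex_vector.span_add[OF complex_vector.span_scale[OF complex_vector.span_base] z(1)])
        (use f(1) in blast)
  qed
qed

text \<open>Projecting an approximation of \<open>w\<close> to the future of \<open>t\<close> does not increase its distance to \<open>w\<close>.\<close>

lemma future_subset_closure:
  assumes t: "0 \<le> t"
  shows "future t \<subseteq> closure (cspan ((\<lambda>f. E (after t f)) ` step_functions))"
proof
  fix w assume w: "w \<in> future t"
  show "w \<in> closure (cspan ((\<lambda>f. E (after t f)) ` step_functions))"
    unfolding closure_approachable
  proof (intro allI impI)
    fix e :: real assume "e > 0"
    moreover have "w \<in> closure (cspan (E ` step_functions))" using E_total by simp
    ultimately obtain y where y: "y \<in> cspan (E ` step_functions)" "dist y w < e"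
      unfolding closure_approachable by blast
    obtain z where z: "z \<in> cspan ((\<lambda>f. E (after t f)) ` step_functions)" "z \<in> future t"
      "\<And>w. w \<in> future t \<Longrightarrow> cinner z w = cinner y w"
      using future_projection[OF t y(1)] by blast
    have "(norm z)\<^sup>2 = norm (cinner y z)"
      using z(3)[OF z(2)] by (metis cinner_same norm_of_real abs_power2 norm_power real_norm_def abs_norm_cancel)
    also have "\<dots> \<le> norm y * norm z" by (rule norm_cinner_le)
    finally have "norm z \<le> norm y"
      by (metis mult_right_le_imp_le norm_ge_zero norm_zero order_le_less power2_eq_square zero_less_norm_iff)
    then have "(norm z)\<^sup>2 \<le> (norm y)\<^sup>2" by (intro power_mono) auto
    then have "(norm (z - w))\<^sup>2 \<le> (norm (y - w))\<^sup>2"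
      unfolding norm_diff_square z(3)[OF w] by simp
    then have "norm (z - w) \<le> norm (y - w)" by (rule power2_le_imp_le) simp
    then show "\<exists>z\<in>cspan ((\<lambda>f. E (after t f)) ` step_functions). dist z w < e"
      using y(2) z(1) by (intro bexI[of _ z]) (auto simp: dist_norm)
  qed
qed

text \<open>\<open>adapted\<close> covers exponential vectors, while \<open>w\<close> may already
  carry later increments. The operator may be unbounded, so it is moved to the left as its adjoint;
  both sides are then continuous in \<open>w\<close>, and density of the exponential vectors in the
  future gives the formula.\<close>

lemma cinner_op_future:
  assumes st: "0 \<le> s" "s \<le> t" and w: "w \<in> \<D>" "w \<in> future t" and f: "f \<in> step_functions"
  shows "cinner (E f) (j s t b w) = mat f s t b * cinner (E (after t f)) w"
proof -
  have t: "0 \<le> t" using st by simp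
  have Ef: "E f \<in> \<D>" by (rule qs.exp_in_domain[OF f])
  let ?M = "{z. cinner (j s t (star b) (E f)) z = mat f s t b * cinner (E (after t f)) z}"
  have "closure (cspan ((\<lambda>g. E (after t g)) ` step_functions)) \<subseteq> ?M"
  proof (intro closure_cspan_subset csubspace_cinner_eq closed_cinner_eq)
    show "(\<lambda>g. E (after t g)) ` step_functions \<subseteq> ?M"
    proof safe
      fix g :: "real \<Rightarrow> 'd" assume g: "g \<in> step_functions"
      note ag = step_functions_after[OF g, of t]
      have "cinner (j s t (star b) (E f)) (E (after t g)) = cinner (E f) (j s t b (E (after t g)))"
        by (rule op_star[OF st Ef qs.exp_in_domain[OF ag]])
      also have "\<dots> = mat f s t b * cinner (E (after t f)) (E (after t g))"
        using qs.adapted[OF st f ag, of b] mat_before[OF st f, of b]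
        by (simp add: mat_def after_after)
      finally show "cinner (j s t (star b) (E f)) (E (after t g)) =
          mat f s t b * cinner (E (after t f)) (E (after t g))" .
    qed
  qed
  then have "cinner (j s t (star b) (E f)) w = mat f s t b * cinner (E (after t f)) w"
    using future_subset_closure[OF t] w(2) by blast
  then show ?thesis by (simp add: op_star[OF st Ef w(1)])
qed

text \<open>The squared norm is a matrix element of \<open>star b * b\<close> at \<open>w\<close>,
  and the vacuum expectation factors out because \<open>w\<close> and the increment live on disjoint
  times. The density argument is run with \<open>w\<close> on the left, whence the conjugate of
  \<open>?c\<close>.\<close>

lemma cinner_op_op_future:
  assumes st: "0 \<le> s" "s \<le> t" and w: "w \<in> \<D>" "w \<in> future t"
  shows "cinner (j s t b w) (j s t b w) = mat (\<lambda>_. 0) s t (star b * b) * cinner w w"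
proof -
  have t: "0 \<le> t" using st by simp
  let ?a = "star b * b" and ?c = "mat (\<lambda>_. 0) s t (star b * b)"
  let ?M = "{z. cinner (j s t ?a w) z = cnj ?c * cinner w z}"
  have "closure (cspan ((\<lambda>g. E (after t g)) ` step_functions)) \<subseteq> ?M"
  proof (intro closure_cspan_subset csubspace_cinner_eq closed_cinner_eq)
    show "(\<lambda>g. E (after t g)) ` step_functions \<subseteq> ?M"
    proof safe
      fix g :: "real \<Rightarrow> 'd" assume g: "g \<in> step_functions"
      note ag = step_functions_after[OF g, of t]
      have "cinner (E (after t g)) (j s t ?a w) = mat (after t g) s t ?a * cinner (E (after t g)) w"
        using cinner_op_future[OF st w ag, of ?a] by (simp add: after_after)
      \<comment> \<open>\<open>after t g\<close> vanishes on \<open>{s..<t}\<close>, so by locality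
        it can be replaced by the zero function.\<close>
      also have "mat (after t g) s t ?a = ?c"
        by (rule mat_local[OF st ag step_functions_zero]) (auto simp: after_def)
      finally show "cinner (j s t ?a w) (E (after t g)) = cnj ?c * cinner w (E (after t g))"
        by (metis cinner_commute complex_cnj_mult)
    qed
  qed
  then have "cinner (j s t ?a w) w = cnj ?c * cinner w w"
    using future_subset_closure[OF t] w(2) by blast
  then have "cinner w (j s t ?a w) = ?c * cinner w w"
    by (metis cinner_commute complex_cnj_mult complex_cnj_cnj)
  moreover have "cinner (j s t b w) (j s t b w) = cinner w (j s t (star b) (j s t b w))"
    using op_star[OF st w(1) op_domain[OF st w(1)], of "star b" b] by (simp add: star_star)
  ultimately show ?thesis by (simp add: op_mult[OF st w(1)])
qed

text \<open>Locality at the left end point says that these matrix elements do not see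
  \<open>f\<close> before \<open>s\<close>. The new vector can therefore take the role of
  \<open>w\<close> for the preceding increment.\<close>

lemma op_in_future:
  assumes st: "0 \<le> s" "s \<le> t" and w: "w \<in> \<D>" "w \<in> future t"
  shows "j s t b w \<in> future s"
  unfolding future_def
proof (intro CollectI ballI)
  fix f :: "real \<Rightarrow> 'd" assume f: "f \<in> step_functions"
  note af = step_functions_after[OF f, of s]
  have "mat f s t b = mat (after s f) s t b"
    by (rule mat_local[OF st f af]) (auto simp: after_def)
  then show "cinner (E f) (j s t b w) = cinner (E (after s f)) (j s t b w)"
    by (simp add: cinner_op_future[OF st w] f af after_after[OF st(2)])
qed

section \<open>Time-ordered products of increments\<close>

fun ordered_from :: "real \<Rightarrow> (real \<times> real \<times> 'b) list \<Rightarrow> bool" where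
  "ordered_from r [] \<longleftrightarrow> True"
| "ordered_from r ((s, t, b) # l) \<longleftrightarrow> r \<le> s \<and> s \<le> t \<and> ordered_from t l"

text \<open>The head of the list is outermost: the latest increment acts first on the vacuum, and
  each further one acts on a vector of the future of its interval.\<close>

definition op_prod :: "(real \<times> real \<times> 'b) list \<Rightarrow> 'h"
  where "op_prod l = foldr (\<lambda>(s, t, b). j s t b) l \<Omega>"

definition reachable :: "real \<Rightarrow> 'h set"
  where "reachable r = op_prod ` {l. ordered_from r l}"

lemma op_prod_in_future: "0 \<le> r \<Longrightarrow> ordered_from r l \<Longrightarrow> op_prod l \<in> \<D> \<and> op_prod l \<in> future r"
proof (induction r l rule: ordered_from.induct)
  case (1 r)
  show ?case by (simp add: op_prod_def vacuum_in_domain vacuum_in_future)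
next
  case (2 r s t b l)
  then have st: "0 \<le> s" "s \<le> t" and IH: "op_prod l \<in> \<D>" "op_prod l \<in> future t" by auto
  have "op_prod ((s, t, b) # l) = j s t b (op_prod l)" by (simp add: op_prod_def)
  with op_domain[OF st IH(1)] op_in_future[OF st IH] 2(3) show ?case
    using future_mono[of r s] by simp
qed

lemma reachable_op:
  assumes "r \<le> s" "s \<le> t" "w \<in> reachable t"
  shows "j s t b w \<in> reachable r"
proof -
  obtain l where l: "ordered_from t l" "w = op_prod l" using assms(3) by (auto simp: reachable_def)
  have "j s t b w = op_prod ((s, t, b) # l)" by (simp add: l op_prod_def)
  then show ?thesis using l assms by (auto simp: reachable_def intro!: image_eqI)
qed

lemma vacuum_reachable: "\<Omega> \<in> reachable r"
  by (auto simp: reachable_def op_prod_def intro!: image_eqI[of _ _ "[]"])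

text \<open>With \<open>\<eta> b = x\<close> and \<open>\<epsilon> b = 0\<close>, the operator \<open>j s (s + \<delta>) (1 + b - \<delta> L b)\<close> maps the vacuum to the
  exponential vector of \<open>x\<close> on \<open>{s..<s + \<delta>}\<close>, up to an error of order \<open>\<delta>\<^sup>2\<close> both in the norm and in
  the inner product.\<close>

lemma infinitesimal_step:
  "\<exists>C\<ge>0. \<exists>\<delta>\<^sub>0>0. \<forall>\<delta>. 0 \<le> \<delta> \<longrightarrow> \<delta> \<le> \<delta>\<^sub>0 \<longrightarrow> (\<exists>a. \<forall>s\<ge>0.
    norm (mat (piece {s..<s + \<delta>} x) s (s + \<delta>) a / of_real (exp (\<delta> * (norm x)\<^sup>2)) - 1) \<le> C * \<delta>\<^sup>2 \<and>
    norm (mat (\<lambda>_. 0) s (s + \<delta>) (star a * a) / of_real (exp (\<delta> * (norm x)\<^sup>2)) - 1) \<le> C * \<delta>\<^sup>2)"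
proof -
  define k where "k = (norm x)\<^sup>2"
  have k: "k \<ge> 0" by (simp add: k_def)
  have eps: "\<epsilon> 1 = 1" "\<epsilon> (y * z) = \<epsilon> y * \<epsilon> z" "\<epsilon> (star y) = cnj (\<epsilon> y)" for y z
    using counit_hom by (simp_all add: unital_star_hom_def star_complex_def)
  have "\<rho> 1 y = y" for y using tr.rep by (simp add: star_representation_def)
  then have eta1: "\<eta> 1 = 0" using tr.cocycle[of 1 1] by (simp add: eps scaleC_one)
  obtain b0 where b0: "\<eta> b0 = x" using \<eta>_surj by (metis surjD)
  \<comment> \<open>Since \<open>\<eta> 1 = 0\<close>, the subtraction makes the counit vanish
    without changing the value of \<open>\<eta>\<close>.\<close>
  define b where "b = b0 - \<epsilon> b0 *\<^sub>C 1"
  have b: "\<eta> b = x" "\<epsilon> b = 0"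
    by (simp_all add: b_def clinear_simps[OF tr.cocycle_linear] clinear_simps[OF counit_linear]
        eta1 b0 eps scaleC_complex)
  define l where "l = L b"
  have func_x: "func x b = of_real k + l"
    by (simp add: func_def b l_def k_def cinner_same)
  have func_0: "func 0 y = L y" for y by (simp add: func_def)
  have Lstar: "L (star b) = cnj l" by (simp add: tr.generator_hermitian l_def)
  \<comment> \<open>In the coboundary relation for \<open>star b\<close> and \<open>b\<close> both
    counit terms vanish, which leaves the squared norm of \<open>\<eta> b\<close>.\<close>
  have Lbb: "L (star b * b) = of_real k"
    using tr.coboundary[of "star b" b] by (simp add: star_star b eps k_def cinner_same)
  obtain C1 \<delta>1 where C1: "C1 \<ge> 0" "\<delta>1 > 0" "\<And>s t. 0 \<le> s \<Longrightarrow> s \<le> t \<Longrightarrow> t \<le> s + \<delta>1 \<Longrightarrow>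
      norm (mat (piece {s..<t} x) s t b - \<epsilon> b - of_real (t - s) * func x b) \<le> C1 * (t - s)\<^sup>2"
    using mat_expansion[of x b] by blast
  have zero_expansion: "\<exists>C\<ge>0. \<exists>\<delta>>0. \<forall>s t. 0 \<le> s \<longrightarrow> s \<le> t \<longrightarrow> t \<le> s + \<delta> \<longrightarrow>
      norm (mat (\<lambda>_. 0) s t y - \<epsilon> y - of_real (t - s) * L y) \<le> C * (t - s)\<^sup>2" for y
    using mat_expansion[of 0 y] by (simp add: func_0 piece_def)
  obtain C2 \<delta>2 where C2: "C2 \<ge> 0" "\<delta>2 > 0" "\<And>s t. 0 \<le> s \<Longrightarrow> s \<le> t \<Longrightarrow> t \<le> s + \<delta>2 \<Longrightarrow>
      norm (mat (\<lambda>_. 0) s t b - \<epsilon> b - of_real (t - s) * L b) \<le> C2 * (t - s)\<^sup>2"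
    using zero_expansion[of b] by blast
  obtain C3 \<delta>3 where C3: "C3 \<ge> 0" "\<delta>3 > 0" "\<And>s t. 0 \<le> s \<Longrightarrow> s \<le> t \<Longrightarrow> t \<le> s + \<delta>3 \<Longrightarrow>
      norm (mat (\<lambda>_. 0) s t (star b) - \<epsilon> (star b) - of_real (t - s) * L (star b)) \<le> C3 * (t - s)\<^sup>2"
    using zero_expansion[of "star b"] by blast
  obtain C4 \<delta>4 where C4: "C4 \<ge> 0" "\<delta>4 > 0" "\<And>s t. 0 \<le> s \<Longrightarrow> s \<le> t \<Longrightarrow> t \<le> s + \<delta>4 \<Longrightarrow>
      norm (mat (\<lambda>_. 0) s t (star b * b) - \<epsilon> (star b * b) - of_real (t - s) * L (star b * b)) \<le> C4 * (t - s)\<^sup>2"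
    using zero_expansion[of "star b * b"] by blast
  define C where "C = C1 + (norm l)\<^sup>2 + C2 + C3 + C4 + norm l * C2 + norm l * C3"
  have C: "C \<ge> 0" "C1 \<le> C"
    using C1(1) C2(1) C3(1) C4(1) by (simp_all add: C_def)
  \<comment> \<open>The entry 1 lets third-order terms be absorbed into second order;
    \<open>1 / (k + 1)\<close> ensures \<delta> * k \<le> 1, as required for comparing the
    exponential with its linear part.\<close>
  define \<delta>0 where "\<delta>0 = Min {\<delta>1, \<delta>2, \<delta>3, \<delta>4, 1, 1 / (k + 1)}"
  have \<delta>0_le: "\<delta>0 \<le> y" if "y \<in> {\<delta>1, \<delta>2, \<delta>3, \<delta>4, 1, 1 / (k + 1)}" for y
    unfolding \<delta>0_def using that by (intro Min_le) auto
  have "\<delta>0 > 0"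
    unfolding \<delta>0_def using C1(2) C2(2) C3(2) C4(2) k by (subst Min_gr_iff) auto
  then have \<delta>0: "\<delta>0 > 0" "\<delta>0 \<le> \<delta>1" "\<delta>0 \<le> \<delta>2" "\<delta>0 \<le> \<delta>3" "\<delta>0 \<le> \<delta>4" "\<delta>0 \<le> 1" "\<delta>0 \<le> 1 / (k + 1)"
    by (simp_all add: \<delta>0_le)
  have main: "\<exists>a. \<forall>s\<ge>0. norm (mat (piece {s..<s + \<delta>} x) s (s + \<delta>) a / of_real (exp (\<delta> * k)) - 1) \<le> (C + k\<^sup>2) * \<delta>\<^sup>2 \<and>
      norm (mat (\<lambda>_. 0) s (s + \<delta>) (star a * a) / of_real (exp (\<delta> * k)) - 1) \<le> (C + k\<^sup>2) * \<delta>\<^sup>2"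
    if \<delta>: "0 \<le> \<delta>" "\<delta> \<le> \<delta>0" for \<delta>
  proof (intro exI allI impI conjI)
    \<comment> \<open>The choice cancels the first-order terms in \<open>l\<close>. The element
      \<open>?a\<close> depends on \<open>\<delta>\<close> but not on \<open>s\<close>, so it serves
      for every increment of this length.\<close>
    define c where "c = 1 - of_real \<delta> * l"
    let ?a = "c *\<^sub>C 1 + b"
    fix s :: real assume s: "s \<ge> 0"
    have st: "s \<le> s + \<delta>" using \<delta> by simp
    have "\<delta> * k \<le> 1 / (k + 1) * k" using \<delta> \<delta>0(7) k by (intro mult_right_mono) auto
    also have "\<dots> \<le> 1" using k by simp
    finally have dk: "\<delta> * k \<le> 1" .
    have d1: "\<delta> \<le> 1" using \<delta> \<delta>0 by simp
    note lin = clinear_simps[OF mat_linear[OF s st]]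
    have mat1: "mat f s (s + \<delta>) 1 = 1" if "f \<in> step_functions" for f
      using that by (simp add: mat_def op_one[OF s st vacuum_in_domain] E_vacuum)
    have p: "piece {s..<s + \<delta>} x \<in> step_functions" using s \<delta> by (intro step_functions_piece) auto
    define r1 where "r1 = mat (piece {s..<s + \<delta>} x) s (s + \<delta>) b - of_real \<delta> * (of_real k + l)"
    have r1: "norm r1 \<le> C1 * \<delta>\<^sup>2"
      using C1(3)[OF s st] \<delta> \<delta>0 by (simp add: r1_def b func_x)
    have "mat (piece {s..<s + \<delta>} x) s (s + \<delta>) ?a = c + mat (piece {s..<s + \<delta>} x) s (s + \<delta>) b"
      by (simp only: lin mat1[OF p] scaleC_complex mult_1_right)
    then have "mat (piece {s..<s + \<delta>} x) s (s + \<delta>) ?a - (1 + of_real (\<delta> * k)) = r1"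
      by (simp add: r1_def c_def algebra_simps)
    then have "norm (mat (piece {s..<s + \<delta>} x) s (s + \<delta>) ?a - (1 + of_real (\<delta> * k))) \<le> C * \<delta>\<^sup>2"
      using r1 mult_right_mono[OF C(2), of "\<delta>\<^sup>2"] by simp
    then show "norm (mat (piece {s..<s + \<delta>} x) s (s + \<delta>) ?a / of_real (exp (\<delta> * k)) - 1) \<le> (C + k\<^sup>2) * \<delta>\<^sup>2"
      by (rule norm_div_exp_minus_one_le[OF _ k \<delta>(1) dk])
    let ?m = "mat (\<lambda>_. 0) s (s + \<delta>)"
    define r2 where "r2 = ?m b - of_real \<delta> * l"
    define r3 where "r3 = ?m (star b) - of_real \<delta> * cnj l"
    define r4 where "r4 = ?m (star b * b) - of_real \<delta> * of_real k"
    have r2: "norm r2 \<le> C2 * \<delta>\<^sup>2"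
      using C2(3)[OF s st] \<delta> \<delta>0 by (simp add: r2_def b l_def)
    have r3: "norm r3 \<le> C3 * \<delta>\<^sup>2"
      using C3(3)[OF s st] \<delta> \<delta>0 by (simp add: r3_def b Lstar eps)
    have r4: "norm r4 \<le> C4 * \<delta>\<^sup>2"
      using C4(3)[OF s st] \<delta> \<delta>0 by (simp add: r4_def b Lbb eps)
    have "star ?a * ?a = (cnj c * c) *\<^sub>C 1 + cnj c *\<^sub>C b + c *\<^sub>C star b + star b * b"
      by (simp add: star_add star_scaleC star_one distrib_left distrib_right scaleC_mult_left
          scaleC_mult_right scaleC_scaleC scaleC_add_right mult.commute add_ac)
    then have "?m (star ?a * ?a) = cnj c * c + cnj c * ?m b + c * ?m (star b) + ?m (star b * b)"
      by (simp only: lin mat1[OF step_functions_zero] scaleC_complex mult_1_right)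
    also have "\<dots> = cnj c * c + cnj c * (r2 + of_real \<delta> * l) + c * (r3 + of_real \<delta> * cnj l) +
        (r4 + of_real \<delta> * of_real k)"
      by (simp add: r2_def r3_def r4_def)
    \<comment> \<open>The first-order terms in \<open>l\<close> and \<open>cnj l\<close> cancel. To
      second order, \<open>cnj c * c\<close> contributes |l|^2 once with a plus sign and the cross
      terms contribute it twice with a minus sign.\<close>
    also have "\<dots> = (1 + of_real (\<delta> * k)) +
        (- (of_real (\<delta>\<^sup>2) * (l * cnj l)) + (r2 + r3 + r4) + (- (of_real \<delta> * cnj l * r2) - of_real \<delta> * l * r3))"
      by (simp add: c_def algebra_simps power2_eq_square)
    finally have eq: "?m (star ?a * ?a) - (1 + of_real (\<delta> * k)) =
        - (of_real (\<delta>\<^sup>2) * (l * cnj l)) + (r2 + r3 + r4) + (- (of_real \<delta> * cnj l * r2) - of_real \<delta> * l * r3)"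
      by simp
    have "norm (- (of_real (\<delta>\<^sup>2) * (l * cnj l))) = (norm l)\<^sup>2 * \<delta>\<^sup>2"
      by (simp add: norm_mult norm_power power2_eq_square)
    moreover have "norm (r2 + r3 + r4) \<le> (C2 + C3 + C4) * \<delta>\<^sup>2"
      using norm_triangle_ineq[of "r2 + r3" r4] norm_triangle_ineq[of r2 r3] r2 r3 r4
      by (simp add: distrib_right)
    moreover have "norm (- (of_real \<delta> * cnj l * r2) - of_real \<delta> * l * r3) \<le>
        (norm l * C2 + norm l * C3) * \<delta>\<^sup>2"
    proof -
      have "\<delta> * norm l * norm r2 \<le> 1 * norm l * (C2 * \<delta>\<^sup>2)"
        using d1 \<delta> r2 by (intro mult_mono) auto
      moreover have "\<delta> * norm l * norm r3 \<le> 1 * norm l * (C3 * \<delta>\<^sup>2)"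
        using d1 \<delta> r3 by (intro mult_mono) auto
      moreover have "norm (- (of_real \<delta> * cnj l * r2) - of_real \<delta> * l * r3) \<le>
          \<delta> * norm l * norm r2 + \<delta> * norm l * norm r3"
        using \<delta> norm_triangle_ineq4[of "- (of_real \<delta> * cnj l * r2)" "of_real \<delta> * l * r3"]
        by (simp add: norm_mult)
      ultimately show ?thesis by (simp add: algebra_simps)
    qed
    ultimately have "norm (?m (star ?a * ?a) - (1 + of_real (\<delta> * k))) \<le>
        (norm l)\<^sup>2 * \<delta>\<^sup>2 + (C2 + C3 + C4) * \<delta>\<^sup>2 + (norm l * C2 + norm l * C3) * \<delta>\<^sup>2"
      unfolding eq by (intro order_trans[OF norm_triangle3 add_mono[OF add_mono]] order_refl) simp_all
    also have "\<dots> = (C - C1) * \<delta>\<^sup>2" by (simp add: C_def algebra_simps)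
    also have "\<dots> \<le> C * \<delta>\<^sup>2" using C1(1) by (intro mult_right_mono) auto
    finally show "norm (?m (star ?a * ?a) / of_real (exp (\<delta> * k)) - 1) \<le> (C + k\<^sup>2) * \<delta>\<^sup>2"
      by (rule norm_div_exp_minus_one_le[OF _ k \<delta>(1) dk])
  qed
  have "C + k\<^sup>2 \<ge> 0" using C by simp
  with \<delta>0(1) main show ?thesis unfolding k_def by blast
qed

end

section \<open>Convergence of products of increments to exponential vectors\<close>

context qsde_exp_system
begin

text \<open>Increments are prepended backwards in time. By \<open>cinner_op_op_future\<close> and
  \<open>cinner_op_future\<close> each multiplies the squared norm and the inner product by a number
  close to exp(\<delta> k); \<open>p\<close> and \<open>q\<close> accumulate the relative errors.
  The vector \<open>v\<close> is chosen before \<open>f\<close>, so the same \<open>q\<close> serves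
  every \<open>f\<close>.\<close>

lemma iterated_step:
  assumes C: "0 \<le> C" and \<delta>: "0 \<le> \<delta>"
    and a: "\<forall>s\<ge>0. norm (mat (piece {s..<s + \<delta>} x) s (s + \<delta>) a / of_real (exp (\<delta> * k)) - 1) \<le> C * \<delta>\<^sup>2"
      "\<forall>s\<ge>0. norm (mat (\<lambda>_. 0) s (s + \<delta>) (star a * a) / of_real (exp (\<delta> * k)) - 1) \<le> C * \<delta>\<^sup>2"
    and r: "0 \<le> r" and w: "w \<in> reachable (r + real n * \<delta>)"
  shows "\<exists>v\<in>reachable r. \<exists>p q. norm (p - 1) \<le> (1 + C * \<delta>\<^sup>2) ^ n - 1 \<and> norm (q - 1) \<le> (1 + C * \<delta>\<^sup>2) ^ n - 1 \<and>
    cinner v v = p * of_real (exp (real n * \<delta> * k)) * cinner w w \<and>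
    (\<forall>f\<in>step_functions. (\<forall>\<tau>\<in>{r..<r + real n * \<delta>}. f \<tau> = x) \<longrightarrow>
      cinner (E (after r f)) v = q * of_real (exp (real n * \<delta> * k)) * cinner (E (after (r + real n * \<delta>) f)) w)"
  using r w
proof (induction n arbitrary: r)
  case 0
  then show ?case by (intro bexI[of _ w] exI[of _ 1]) auto
next
  case (Suc n)
  let ?t = "r + \<delta>" and ?T = "r + real (Suc n) * \<delta>" and ?e = "complex_of_real (exp (\<delta> * k))"
  let ?en = "complex_of_real (exp (real n * \<delta> * k))"
  have T: "?t + real n * \<delta> = ?T" by (simp add: algebra_simps)
  have t: "0 \<le> ?t" "r \<le> ?t" using Suc.prems \<delta> by auto
  have nd: "0 \<le> real n * \<delta>" using \<delta> by simp
  obtain v p q where v: "v \<in> reachable ?t" and p: "norm (p - 1) \<le> (1 + C * \<delta>\<^sup>2) ^ n - 1"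
    and q: "norm (q - 1) \<le> (1 + C * \<delta>\<^sup>2) ^ n - 1"
    and vv: "cinner v v = p * ?en * cinner w w"
    and fv: "\<And>f. f \<in> step_functions \<Longrightarrow> \<forall>\<tau>\<in>{?t..<?T}. f \<tau> = x \<Longrightarrow>
      cinner (E (after ?t f)) v = q * ?en * cinner (E (after ?T f)) w"
    using Suc.IH[OF t(1)] Suc.prems(2) unfolding T by blast
  have vD: "v \<in> \<D>" "v \<in> future ?t"
    using v op_prod_in_future[OF t(1)] by (auto simp: reachable_def)
  have e: "exp (real (Suc n) * \<delta> * k) = exp (\<delta> * k) * exp (real n * \<delta> * k)"
    by (simp add: algebra_simps exp_add)
  define p' where "p' = mat (\<lambda>_. 0) r ?t (star a * a) / ?e"
  define q' where "q' = mat (piece {r..<?t} x) r ?t a / ?e"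
  have p': "mat (\<lambda>_. 0) r ?t (star a * a) = p' * ?e" and q': "mat (piece {r..<?t} x) r ?t a = q' * ?e"
    by (simp_all add: p'_def q'_def)
  have prod: "norm (u' * u - 1) \<le> (1 + C * \<delta>\<^sup>2) ^ Suc n - 1"
    if "norm (u' - 1) \<le> C * \<delta>\<^sup>2" "norm (u - 1) \<le> (1 + C * \<delta>\<^sup>2) ^ n - 1" for u u' :: complex
    using norm_mult_minus_one_le[of u' "1 + C * \<delta>\<^sup>2" u "(1 + C * \<delta>\<^sup>2) ^ n"] that by simp
  show ?case
  proof (rule bexI[of _ "j r ?t a v"], rule exI[of _ "p' * p"], rule exI[of _ "q' * q"], intro conjI ballI impI)
    show "j r ?t a v \<in> reachable r" by (rule reachable_op[OF order_refl t(2) v])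
    show "norm (p' * p - 1) \<le> (1 + C * \<delta>\<^sup>2) ^ Suc n - 1"
      by (rule prod[OF _ p]) (simp only: p'_def a(2)[rule_format, OF Suc.prems(1)])
    show "norm (q' * q - 1) \<le> (1 + C * \<delta>\<^sup>2) ^ Suc n - 1"
      by (rule prod[OF _ q]) (simp only: q'_def a(1)[rule_format, OF Suc.prems(1)])
    show "cinner (j r ?t a v) (j r ?t a v) = p' * p * of_real (exp (real (Suc n) * \<delta> * k)) * cinner w w"
      unfolding cinner_op_op_future[OF Suc.prems(1) t(2) vD] p' vv e of_real_mult by (simp only: mult_ac)
    fix f assume f: "f \<in> step_functions" "\<forall>\<tau>\<in>{r..<?T}. f \<tau> = x"
    have ar: "after r f \<in> step_functions" by (rule step_functions_after[OF f(1)])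
    have "mat (after r f) r ?t a = mat (piece {r..<?t} x) r ?t a"
    proof (rule mat_local[OF Suc.prems(1) t(2) ar])
      show "piece {r..<?t} x \<in> step_functions" by (rule step_functions_piece[OF Suc.prems(1) t(2)])
      fix \<tau> assume \<tau>: "\<tau> \<in> {r..<?t}"
      have "?t \<le> ?T" unfolding T[symmetric] using nd by simp
      moreover have "\<tau> < ?t" using \<tau> by simp
      ultimately have "\<tau> < ?T" by (rule less_le_trans[rotated])
      with \<tau> f(2) show "after r f \<tau> = piece {r..<?t} x \<tau>" by (simp add: after_def piece_def)
    qed
    moreover have "cinner (E (after ?t f)) v = q * ?en * cinner (E (after ?T f)) w"
      using f(2) t(2) by (intro fv[OF f(1)]) auto
    ultimately show "cinner (E (after r f)) (j r ?t a v) =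
        q' * q * of_real (exp (real (Suc n) * \<delta> * k)) * cinner (E (after ?T f)) w"
      unfolding cinner_op_future[OF Suc.prems(1) t(2) vD ar] after_after[OF t(2)] e of_real_mult
      by (simp only: q' mult_ac)
  qed
qed

lemma power_one_plus_le_exp:
  assumes "0 \<le> (y :: real)"
  shows "(1 + y) ^ n \<le> exp (real n * y)"
proof -
  have "(1 + y) ^ n \<le> exp y ^ n"
    using assms exp_ge_add_one_self[of y] by (intro power_mono) auto
  then show ?thesis by (simp add: exp_of_nat_mult)
qed

text \<open>Products of finer and finer increments on \<open>{s..<t}\<close> are prepended to
  approximants \<open>w i\<close> of the part after \<open>t\<close>. The resulting
  \<open>v i\<close> satisfy |v i|^2 \<rightarrow> |u|^2 and <u, v i> \<rightarrow> |u|^2, which is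
  norm convergence to \<open>?u\<close>.\<close>

lemma E_after_reachable_step:
  assumes s: "0 \<le> s" and st: "s < t" and f: "f \<in> step_functions"
    and x: "\<And>\<tau>. \<tau> \<in> {s..<t} \<Longrightarrow> f \<tau> = x"
    and cl: "E (after t f) \<in> closure (reachable t)"
  shows "E (after s f) \<in> closure (reachable s)"
proof -
  let ?u = "E (after s f)" and ?y = "E (after t f)"
  define k where "k = (norm x)\<^sup>2"
  obtain C \<delta>0 where C: "C \<ge> 0" "\<delta>0 > 0" and a: "\<And>\<delta>. 0 \<le> \<delta> \<Longrightarrow> \<delta> \<le> \<delta>0 \<Longrightarrow> \<exists>a. \<forall>s\<ge>0.
      norm (mat (piece {s..<s + \<delta>} x) s (s + \<delta>) a / of_real (exp (\<delta> * k)) - 1) \<le> C * \<delta>\<^sup>2 \<and>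
      norm (mat (\<lambda>_. 0) s (s + \<delta>) (star a * a) / of_real (exp (\<delta> * k)) - 1) \<le> C * \<delta>\<^sup>2"
    using infinitesimal_step[of x] unfolding k_def by blast
  define T where "T = t - s"
  have T: "T > 0" using st by (simp add: T_def)
  obtain w where w: "\<And>i. w i \<in> reachable t" "w \<longlonglongrightarrow> ?y"
    using cl unfolding closure_sequential by blast
  obtain n0 where n0: "T / \<delta>0 < real n0" using reals_Archimedean2 by blast
  \<comment> \<open>The shift by \<open>n0\<close> makes the increment length
    \<open>T / real (n i)\<close> at most \<open>\<delta>0\<close>.\<close>
  define n where "n i = Suc (i + n0)" for i
  let ?X = "complex_of_real (exp (T * k))"
  \<comment> \<open>This bounds (1 + C \<delta>^2)^n - 1 for \<delta> = T / n, by 1 + y \<le> exp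
    y.\<close>
  let ?b = "\<lambda>i. exp (C * T\<^sup>2 / real (n i)) - 1"
  define Q where "Q i v p q \<longleftrightarrow> v \<in> reachable s \<and> norm (p - 1) \<le> ?b i \<and> norm (q - 1) \<le> ?b i \<and>
      cinner v v = p * ?X * cinner (w i) (w i) \<and> cinner ?u v = q * ?X * cinner ?y (w i)" for i v p q
  have "\<exists>v p q. Q i v p q" for i
  proof -
    define \<delta> where "\<delta> = T / real (n i)"
    have n\<delta>: "real (n i) * \<delta> = T" by (simp add: \<delta>_def n_def)
    have \<delta>: "0 \<le> \<delta>" using T by (simp add: \<delta>_def)
    have "T < real n0 * \<delta>0" using n0 C(2) by (simp add: field_simps)
    also have "\<dots> \<le> real (n i) * \<delta>0" using C(2) by (intro mult_right_mono) (auto simp: n_def)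
    finally have "\<delta> \<le> \<delta>0" by (simp add: \<delta>_def n_def field_simps)
    then obtain a where a: "\<forall>s\<ge>0. norm (mat (piece {s..<s + \<delta>} x) s (s + \<delta>) a / of_real (exp (\<delta> * k)) - 1) \<le> C * \<delta>\<^sup>2"
      "\<forall>s\<ge>0. norm (mat (\<lambda>_. 0) s (s + \<delta>) (star a * a) / of_real (exp (\<delta> * k)) - 1) \<le> C * \<delta>\<^sup>2"
      using a[OF \<delta>] by blast
    have "(1 + C * \<delta>\<^sup>2) ^ n i \<le> exp (real (n i) * (C * \<delta>\<^sup>2))"
      using C(1) by (intro power_one_plus_le_exp) simp
    also have "real (n i) * (C * \<delta>\<^sup>2) = C * T\<^sup>2 / real (n i)"
      by (simp add: \<delta>_def n_def power2_eq_square)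
    finally have b: "(1 + C * \<delta>\<^sup>2) ^ n i - 1 \<le> ?b i" by simp
    have sT: "s + T = t" by (simp add: T_def)
    have "w i \<in> reachable (s + real (n i) * \<delta>)" by (simp only: n\<delta> sT w)
    from iterated_step[OF C(1) \<delta> a s this] obtain v p q where
      v: "v \<in> reachable s" "norm (p - 1) \<le> (1 + C * \<delta>\<^sup>2) ^ n i - 1" "norm (q - 1) \<le> (1 + C * \<delta>\<^sup>2) ^ n i - 1"
      "cinner v v = p * ?X * cinner (w i) (w i)"
      "\<forall>f\<in>step_functions. (\<forall>\<tau>\<in>{s..<t}. f \<tau> = x) \<longrightarrow>
        cinner (E (after s f)) v = q * ?X * cinner (E (after t f)) (w i)"
      unfolding n\<delta> sT by (elim bexE exE conjE) (rule that)
    have "cinner ?u v = q * ?X * cinner ?y (w i)" using v(5) f x by blast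
    then show ?thesis
      unfolding Q_def
      by (intro exI[of _ v] exI[of _ p] exI[of _ q] conjI order_trans[OF v(2) b] order_trans[OF v(3) b] v(1,4))
  qed
  then obtain v p q where "\<And>i. Q i (v i) (p i) (q i)" by metis
  then have v: "\<And>i. v i \<in> reachable s" and p: "\<And>i. norm (p i - 1) \<le> ?b i"
    and q: "\<And>i. norm (q i - 1) \<le> ?b i"
    and vv: "\<And>i. cinner (v i) (v i) = p i * ?X * cinner (w i) (w i)"
    and uv: "\<And>i. cinner ?u (v i) = q i * ?X * cinner ?y (w i)"
    by (simp_all add: Q_def)
  have "filterlim n at_top sequentially"
    unfolding n_def by (rule filterlim_subseq) (simp add: strict_mono_def)
  then have "filterlim (\<lambda>i. real (n i)) at_top sequentially"
    by (rule filterlim_compose[OF filterlim_real_sequentially])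
  then have "(\<lambda>i. C * T\<^sup>2 / real (n i)) \<longlonglongrightarrow> 0"
    by (rule real_tendsto_divide_at_top[OF tendsto_const])
  then have "?b \<longlonglongrightarrow> exp 0 - 1"
    by (intro tendsto_diff tendsto_exp tendsto_const)
  then have b: "?b \<longlonglongrightarrow> 0" by simp
  have "(\<lambda>i. p i - 1) \<longlonglongrightarrow> 0"
    by (rule Lim_null_comparison[OF always_eventually b]) (use p in blast)
  moreover have "(\<lambda>i. q i - 1) \<longlonglongrightarrow> 0"
    by (rule Lim_null_comparison[OF always_eventually b]) (use q in blast)
  ultimately have pq: "p \<longlonglongrightarrow> 1" "q \<longlonglongrightarrow> 1"
    by (simp_all add: LIM_zero_iff)
  have norm_u: "cinner ?u ?u = ?X * cinner ?y ?y"
  proof -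
    have t: "0 \<le> t" using s st by simp
    have "before t (after s f) = piece {s..<t} x"
      using x by (auto simp: before_def after_def piece_def fun_eq_iff)
    then have "cinner ?u ?u = cinner (E (piece {s..<t} x)) (E (piece {s..<t} x)) * cinner ?y ?y"
      using E_factor[OF step_functions_after[OF f] step_functions_after[OF f] t, of s s] st
      by (simp only: after_after[OF less_imp_le])
    then show ?thesis
      by (simp only: E_piece[OF s less_imp_le[OF st]] T_def k_def exp_of_real)
  qed
  \<comment> \<open>As |u|^2 equals \<open>?X\<close> times |y|^2, the four terms of the expanded
    square have the same limit up to sign and cancel.\<close>
  have "(\<lambda>i. cinner (v i - ?u) (v i - ?u)) \<longlonglongrightarrow>
      1 * ?X * cinner ?y ?y - cnj (1 * ?X * cinner ?y ?y) - 1 * ?X * cinner ?y ?y + ?X * cinner ?y ?y"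
  proof -
    have "(\<lambda>i. p i * ?X * cinner (w i) (w i) - cnj (q i * ?X * cinner ?y (w i))
        - q i * ?X * cinner ?y (w i) + ?X * cinner ?y ?y) \<longlonglongrightarrow>
      1 * ?X * cinner ?y ?y - cnj (1 * ?X * cinner ?y ?y) - 1 * ?X * cinner ?y ?y + ?X * cinner ?y ?y"
      by (intro tendsto_intros pq w(2))
    moreover have "cinner (v i - ?u) (v i - ?u) = p i * ?X * cinner (w i) (w i) -
        cnj (q i * ?X * cinner ?y (w i)) - q i * ?X * cinner ?y (w i) + ?X * cinner ?y ?y" for i
      using cinner_commute[of "v i" ?u]
      by (simp only: cinner_diff_left cinner_diff_right vv uv norm_u) simp
    ultimately show ?thesis by simp
  qed
  moreover have "cnj (cinner ?y ?y) = cinner ?y ?y" by (rule cinner_commute[symmetric])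
  ultimately have "(\<lambda>i. cinner (v i - ?u) (v i - ?u)) \<longlonglongrightarrow> 0" by simp
  then have "(\<lambda>i. norm (cinner (v i - ?u) (v i - ?u))) \<longlonglongrightarrow> 0" by (rule tendsto_norm_zero)
  then have "(\<lambda>i. (norm (v i - ?u))\<^sup>2) \<longlonglongrightarrow> 0"
    by (simp add: cinner_same norm_power)
  then have "(\<lambda>i. norm (v i - ?u)) \<longlonglongrightarrow> 0"
    using tendsto_real_sqrt[of "\<lambda>i. (norm (v i - ?u))\<^sup>2" 0] by simp
  then have "v \<longlonglongrightarrow> ?u" by (simp add: tendsto_norm_zero_iff LIM_zero_iff)
  then show ?thesis unfolding closure_sequential using v by blast
qed

text \<open>Backward induction over the jumps of \<open>f\<close>: past the last jump the vector is
  the vacuum, and each earlier stretch on which \<open>f\<close> is constant is added by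
  \<open>E_after_reachable_step\<close>.\<close>

lemma E_after_reachable:
  assumes f: "f \<in> step_functions" and s: "0 \<le> s"
  shows "E (after s f) \<in> closure (reachable s)"
proof -
  obtain P where P: "finite P" "\<And>u v. u \<le> v \<Longrightarrow> P \<inter> {u<..v} = {} \<Longrightarrow> f v = f u"
    "\<And>u. (\<forall>p\<in>P. p \<le> u) \<Longrightarrow> f u = 0"
    using step_functions_breakpoints[OF f] by blast
  show ?thesis
    using s
  proof (induction "card {p \<in> P. s < p}" arbitrary: s rule: less_induct)
    case (less s)
    let ?Q = "{p \<in> P. s < p}"
    have fin: "finite ?Q" using P(1) by simp
    show ?case
    proof (cases "?Q = {}")
      case True
      have "after s f = (\<lambda>_. 0)"
      proof
        fix u
        have "f u = 0" if "s \<le> u" using True that by (intro P(3)) force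
        then show "after s f u = 0" by (simp add: after_def)
      qed
      then show ?thesis using vacuum_reachable closure_subset by (metis subsetD)
    next
      case False
      define t where "t = Min ?Q"
      have t: "t \<in> ?Q" unfolding t_def by (rule Min_in[OF fin False])
      have min: "t \<le> p" if "p \<in> ?Q" for p unfolding t_def by (rule Min_le[OF fin that])
      have "{p \<in> P. t < p} \<subset> ?Q" using t by auto
      then have "card {p \<in> P. t < p} < card ?Q" by (rule psubset_card_mono[OF fin])
      then have cl: "E (after t f) \<in> closure (reachable t)"
        using t less.prems by (intro less.hyps) auto
      \<comment> \<open>No point of \<open>P\<close> lies in \<open>{s<..\<tau>}\<close>, because
        \<open>t\<close> is the first one after \<open>s\<close>.\<close>
      have fs: "f \<tau> = f s" if "\<tau> \<in> {s..<t}" for \<tau>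
        using that min by (intro P(2)) force+
      show ?thesis
        by (rule E_after_reachable_step[OF less.prems _ f fs cl]) (use t in simp)
    qed
  qed
qed

lemma closure_span_reachable: "closure (cspan (reachable 0)) = UNIV"
proof -
  have "E ` step_functions \<subseteq> closure (cspan (reachable 0))"
  proof safe
    fix f :: "real \<Rightarrow> 'd" assume f: "f \<in> step_functions"
    have "after 0 f = f" using step_functions_neg[OF f] by (auto simp: after_def fun_eq_iff)
    then have "E f \<in> closure (reachable 0)" using E_after_reachable[OF f order_refl] by simp
    then show "E f \<in> closure (cspan (reachable 0))"
      using closure_mono[OF complex_vector.span_superset] by blast
  qed
  then have "closure (cspan (E ` step_functions)) \<subseteq> closure (cspan (reachable 0))"
    by (intro closure_cspan_subset csubspace_closure_cspan closed_closure)
  then show ?thesis using E_total by auto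
qed

lemma ordered_from_nth:
  assumes "ordered_from r l"
  shows "\<forall>i<length l. r \<le> fst (l ! i) \<and> fst (l ! i) \<le> fst (snd (l ! i))"
    and "\<forall>i. Suc i < length l \<longrightarrow> fst (snd (l ! i)) \<le> fst (l ! Suc i)"
proof -
  have "(\<forall>i<length l. r \<le> fst (l ! i) \<and> fst (l ! i) \<le> fst (snd (l ! i))) \<and>
      (\<forall>i. Suc i < length l \<longrightarrow> fst (snd (l ! i)) \<le> fst (l ! Suc i))"
    using assms
  proof (induction r l rule: ordered_from.induct)
    case (2 r s t b l)
    then have IH: "\<And>i. i < length l \<Longrightarrow> t \<le> fst (l ! i) \<and> fst (l ! i) \<le> fst (snd (l ! i))"
      "\<And>i. Suc i < length l \<Longrightarrow> fst (snd (l ! i)) \<le> fst (l ! Suc i)" and rs: "r \<le> s" "s \<le> t"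
      by auto
    show ?case
    proof (intro conjI allI impI)
      fix i assume "i < length ((s, t, b) # l)"
      then show "r \<le> fst (((s, t, b) # l) ! i)" "fst (((s, t, b) # l) ! i) \<le> fst (snd (((s, t, b) # l) ! i))"
        using IH(1)[of "i - 1"] rs by (cases i; force)+
    next
      fix i assume "Suc i < length ((s, t, b) # l)"
      then show "fst (snd (((s, t, b) # l) ! i)) \<le> fst (((s, t, b) # l) ! Suc i)"
        using IH(1)[of 0] IH(2)[of "i - 1"] by (cases i) auto
    qed
  qed simp
  then show "\<forall>i<length l. r \<le> fst (l ! i) \<and> fst (l ! i) \<le> fst (snd (l ! i))"
    and "\<forall>i. Suc i < length l \<longrightarrow> fst (snd (l ! i)) \<le> fst (l ! Suc i)"
    by blast+
qed

lemma reachable_products: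
  "reachable 0 \<subseteq> {foldr (\<lambda>k. j (s k) (t k) (b k)) [0..<n] \<Omega> | (n::nat) s t b.
    (\<forall>k<n. 0 \<le> s k \<and> s k \<le> t k) \<and> (\<forall>k. Suc k < n \<longrightarrow> t k \<le> s (Suc k))}"
proof
  fix w assume "w \<in> reachable 0"
  then obtain l where l: "ordered_from 0 l" "w = op_prod l" by (auto simp: reachable_def)
  have "w = foldr (\<lambda>(s, t, b). j s t b) (map ((!) l) [0..<length l]) \<Omega>"
    by (simp only: l(2) op_prod_def map_nth)
  also have "\<dots> = foldr (\<lambda>i. j (fst (l ! i)) (fst (snd (l ! i))) (snd (snd (l ! i)))) [0..<length l] \<Omega>"
    by (simp add: foldr_map comp_def case_prod_beta)
  finally show "w \<in> {foldr (\<lambda>k. j (s k) (t k) (b k)) [0..<n] \<Omega> | (n::nat) s t b.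
      (\<forall>k<n. 0 \<le> s k \<and> s k \<le> t k) \<and> (\<forall>k. Suc k < n \<longrightarrow> t k \<le> s (Suc k))}"
    using ordered_from_nth[OF l(1)]
    by (intro CollectI exI[of _ "length l"] exI[of _ "\<lambda>i. fst (l ! i)"] exI[of _ "\<lambda>i. fst (snd (l ! i))"]
        exI[of _ "\<lambda>i. snd (snd (l ! i))"]) blast
qed

end

theorem theorem1p4p1:
  fixes \<Delta> :: "'b::complex_star_algebra \<Rightarrow> ('b, 'b) tensor"
    and \<epsilon> :: "'b \<Rightarrow> complex"
    and \<rho> :: "'b \<Rightarrow> 'd::complex_inner \<Rightarrow> 'd"
    and \<eta> :: "'b \<Rightarrow> 'd"
    and L :: "'b \<Rightarrow> complex"
    and \<iota> :: "'d \<Rightarrow> 'k::complex_hilbert"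
    and sp :: "(real \<Rightarrow> 'k) list \<Rightarrow> 'h::complex_hilbert"
    and \<D> :: "'h set"
    and j :: "real \<Rightarrow> real \<Rightarrow> 'b \<Rightarrow> 'h \<Rightarrow> 'h"
  assumes "involutive_bialgebra \<Delta> \<epsilon>"
    and "schuermann_triple \<epsilon> \<rho> \<eta> L"
    and "surj \<eta>"
    and "is_completion \<iota>"
    and "symmetric_fock_space L2 L2_inner sp"
    and "qsde_solution \<Delta> \<epsilon> \<rho> \<eta> L (\<lambda>f. exp_vector sp (\<lambda>\<tau>. \<iota> (f \<tau>))) \<D> j"
  shows "closure (cspan
      {foldr (\<lambda>k. j (s k) (t k) (b k)) [0..<n] (vacuum sp) | (n::nat) s t b.
        (\<forall>k<n. 0 \<le> s k \<and> s k \<le> t k) \<and> (\<forall>k. Suc k < n \<longrightarrow> t k \<le> s (Suc k))}) = UNIV"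
proof -
  interpret symmetric_fock_space L2 L2_inner sp by fact
  interpret step_fock sp \<iota> by unfold_locales fact
  have E: "E = (\<lambda>f. exp_vector sp (\<lambda>\<tau>. \<iota> (f \<tau>)))" by (simp add: E_def[abs_def])
  interpret q: qsde_exp_system \<Delta> \<epsilon> \<rho> \<eta> L E \<D> j
  proof (intro qsde_exp_system.intro qsde_exp_system_axioms.intro)
    show "qsde_solution \<Delta> \<epsilon> \<rho> \<eta> L E \<D> j" unfolding E by fact
  qed (fact | rule exp_vectors_total E_factor cinner_vacuum cinner_E_piece; assumption)+
  have "closure (cspan (q.reachable 0)) \<subseteq> closure (cspan
      {foldr (\<lambda>k. j (s k) (t k) (b k)) [0..<n] (vacuum sp) | (n::nat) s t b.
        (\<forall>k<n. 0 \<le> s k \<and> s k \<le> t k) \<and> (\<forall>k. Suc k < n \<longrightarrow> t k \<le> s (Suc k))})"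
    unfolding vacuum_eq by (intro closure_mono complex_vector.span_mono q.reachable_products)
  then show ?thesis unfolding q.closure_span_reachable by (rule top_le)
qed

end
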